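(* The following unital Banach algebras are not amenable: (a) $\mathcal{B}(\ell_p)$ for each $p\in\{1,2,\infty\}$; (b) $\prod_{n=1}^\infty \mathcal{B}(\ell_p^n)$ for each $p\in[1,\infty]$; (c) $\mathcal{B}_r(\ell_p)$ for each $p\in[1,\infty]$.
   Context: All spaces are over $\mathbb{C}$. For a Banach space $X$, $\mathcal{B}(X)$ is the Banach algebra of bounded linear operators on $X$ with the operator norm; $\ell_p=\ell_p(\mathbb{N})$ and $\ell_p^n$ is $\mathbb{C}^n$ with the $p$-norm. $\prod_{n=1}^\infty \mathcal{B}(\ell_p^n)$ is the Banach algebra of all bounded sequences $(x_n)_n$ with $x_n\in\mathcal{B}(\ell_p^n)$, with coordinatewise operations and norm $\sup_n\|x_n\|$. $\mathcal{B}_r(\ell_p)$ is the Banach algebra (under composition) consisting of those operators $x\in\mathcal{B}(\ell_p)$, given by a matrix $x=(x_{ij})_{i,j}$ with respect to the standard basis, such that $\|x\|_{\mathcal{B}_r(\ell_p)}:=\|\,|x|\,\|_{\mathcal{B}(\ell_p)}<\infty$, where $|x|=(|x_{ij}|)_{i,j}$ is the matrix of entrywise absolute values (the condition means that $|x|$ defines a bounded operator on $\ell_p$). For $p<\infty$ every bounded operator is given by its matrix; for $p=\infty$, "given by a matrix" means $(x\xi)_i=\sum_j x_{ij}\xi_j$ with absolutely convergent sums for all $\xi\in\ell_\infty$. A unital Banach algebra $A$ is amenable if there exists a constant $C>0$ such that for every finite set $F\subset A$ and every $\varepsilon>0$ there exists $T=\sum_{i=1}^r a_i\otimes b_i$ in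 the algebraic tensor product $A\otimes A$ with: (i) $\sum_{i=1}^r a_ib_i=1$; (ii) $\left\|\sum_{i=1}^r xa_i\otimes b_i-\sum_{i=1}^r a_i\otimes b_ix\right\|_\wedge\le\varepsilon$ for all $x\in F$; (iii) $\|T\|_\wedge\le C$, where $\|\cdot\|_\wedge$ denotes the projective tensor norm on $A\otimes A$. *)

theory Defs
  imports
    Complex_Main
    "HOL-Library.Extended_Real"
    "HOL-Library.FuncSet"
    "HOL-Library.Poly_Mapping"
    "HOL-Algebra.Module"
begin

section \<open>Normed algebras and amenability\<close>

text \<open>
  The exponent \<open>p\<close> ranges over \<open>[1,\<infinity>]\<close>, so the algebras below cannot be types. They are
  records in the style of \<open>HOL-Algebra\<close>: a complex algebra with its carrier, and a norm.
  (The locale \<open>algebra\<close> of \<open>HOL-Algebra\<close> is for commutative algebras and is not used.)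
\<close>

record 'a normed_algebra = "(complex, 'a) module" +
  anorm :: "'a \<Rightarrow> real"

text \<open>
  The algebraic tensor product \<open>A \<otimes> A\<close> over the complex numbers is the free complex vector space
  on pairs, modulo the span of the bilinearity relations on \<open>carrier A\<close>; its elements are the
  cosets \<open>tensor_class A f\<close>, for \<open>f\<close> a formal combination of pairs from the carrier.
\<close>

abbreviation free_scale :: "complex \<Rightarrow> ('b \<Rightarrow>\<^sub>0 complex) \<Rightarrow> ('b \<Rightarrow>\<^sub>0 complex)" where
  "free_scale c f \<equiv> Poly_Mapping.map ((*) c) f"

abbreviation pair :: "'a \<Rightarrow> 'a \<Rightarrow> ('a \<times> 'a \<Rightarrow>\<^sub>0 complex)" where
  "pair a b \<equiv> Poly_Mapping.single (a, b) 1"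

lemma lookup_free_scale: "Poly_Mapping.lookup (free_scale c f) k = c * Poly_Mapping.lookup f k"
  by (simp add: map.rep_eq when_def)

lemma vector_space_free_scale: "vector_space free_scale"
  by standard (auto intro!: poly_mapping_eqI simp: lookup_free_scale lookup_add algebra_simps)

definition bilinear_relations :: "('a, 'm) normed_algebra_scheme \<Rightarrow> ('a \<times> 'a \<Rightarrow>\<^sub>0 complex) set" where
  "bilinear_relations A =
     {pair (a \<oplus>\<^bsub>A\<^esub> a') b - pair a b - pair a' b | a a' b.
        a \<in> carrier A \<and> a' \<in> carrier A \<and> b \<in> carrier A} \<union>
     {pair a (b \<oplus>\<^bsub>A\<^esub> b') - pair a b - pair a b' | a b b'.
        a \<in> carrier A \<and> b \<in> carrier A \<and> b' \<in> carrier A} \<union>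
     {pair (c \<odot>\<^bsub>A\<^esub> a) b - free_scale c (pair a b) | c a b.
        a \<in> carrier A \<and> b \<in> carrier A} \<union>
     {pair a (c \<odot>\<^bsub>A\<^esub> b) - free_scale c (pair a b) | c a b.
        a \<in> carrier A \<and> b \<in> carrier A}"

definition tensor_null :: "('a, 'm) normed_algebra_scheme \<Rightarrow> ('a \<times> 'a \<Rightarrow>\<^sub>0 complex) set" where
  "tensor_null A = Modules.module.span free_scale (bilinear_relations A)"

definition tensor_class ::
    "('a, 'm) normed_algebra_scheme \<Rightarrow> ('a \<times> 'a \<Rightarrow>\<^sub>0 complex) \<Rightarrow> ('a \<times> 'a \<Rightarrow>\<^sub>0 complex) set" where
  "tensor_class A f = {g. g - f \<in> tensor_null A}"

text \<open>
  The infimum is over all representations of \<open>u\<close> as a finite sum of elementary tensors; scalars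
  can be absorbed into a factor, so every element of the tensor product has one.
\<close>

definition proj_norm ::
    "('a, 'm) normed_algebra_scheme \<Rightarrow> ('a \<times> 'a \<Rightarrow>\<^sub>0 complex) set \<Rightarrow> real" where
  "proj_norm A u = Inf {(\<Sum>i<r. anorm A (a i) * anorm A (b i)) | (r::nat) a b.
     (\<forall>i<r. a i \<in> carrier A \<and> b i \<in> carrier A) \<and> u = tensor_class A (\<Sum>i<r. pair (a i) (b i))}"

definition amenable :: "('a, 'm) normed_algebra_scheme \<Rightarrow> bool" where
  "amenable A \<longleftrightarrow>
     (\<exists>C>0. \<forall>F \<epsilon>. finite F \<and> F \<subseteq> carrier A \<and> \<epsilon> > 0 \<longrightarrow>
       (\<exists>(r::nat) a b. (\<forall>i<r. a i \<in> carrier A \<and> b i \<in> carrier A) \<and>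
          (\<Oplus>\<^bsub>A\<^esub> i \<in> {..<r}. a i \<otimes>\<^bsub>A\<^esub> b i) = \<one>\<^bsub>A\<^esub> \<and>
          (\<forall>x\<in>F. proj_norm A (tensor_class A
              ((\<Sum>i<r. pair (x \<otimes>\<^bsub>A\<^esub> a i) (b i)) - (\<Sum>i<r. pair (a i) (b i \<otimes>\<^bsub>A\<^esub> x)))) \<le> \<epsilon>) \<and>
          proj_norm A (tensor_class A (\<Sum>i<r. pair (a i) (b i))) \<le> C))"


section \<open>The sequence spaces\<close>

definition lp :: "ereal \<Rightarrow> (nat \<Rightarrow> complex) set" where
  "lp p = {x. if p = \<infinity> then bdd_above (range (\<lambda>i. cmod (x i)))
              else summable (\<lambda>i. cmod (x i) powr real_of_ereal p)}"

definition lp_norm :: "ereal \<Rightarrow> (nat \<Rightarrow> complex) \<Rightarrow> real" where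
  "lp_norm p x = (if p = \<infinity> then (SUP i. cmod (x i))
     else suminf (\<lambda>i. cmod (x i) powr real_of_ereal p) powr (1 / real_of_ereal p))"

text \<open>
  \<open>\<complex>\<^sup>n\<close> is the space of sequences vanishing from index \<open>n\<close> on; \<open>lp_norm p\<close> restricts to the
  \<open>p\<close>-norm there.
\<close>

definition lp_fin :: "nat \<Rightarrow> (nat \<Rightarrow> complex) set" where
  "lp_fin n = {x. \<forall>i\<ge>n. x i = 0}"


section \<open>Algebras of bounded operators\<close>

type_synonym seq_op = "(nat \<Rightarrow> complex) \<Rightarrow> (nat \<Rightarrow> complex)"

text \<open>
  Operators on a sequence space \<open>V\<close> with norm \<open>N\<close> are extensional functions on \<open>V\<close>, so that
  equality of operators is equality of functions.
\<close>

definition bounded_ops :: "(nat \<Rightarrow> complex) set \<Rightarrow> ((nat \<Rightarrow> complex) \<Rightarrow> real) \<Rightarrow> seq_op set" where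
  "bounded_ops V N = {T \<in> V \<rightarrow>\<^sub>E V.
     (\<forall>x\<in>V. \<forall>y\<in>V. T (\<lambda>i. x i + y i) = (\<lambda>i. T x i + T y i)) \<and>
     (\<forall>c. \<forall>x\<in>V. T (\<lambda>i. c * x i) = (\<lambda>i. c * T x i)) \<and>
     (\<exists>K. \<forall>x\<in>V. N (T x) \<le> K * N x)}"

definition op_norm :: "(nat \<Rightarrow> complex) set \<Rightarrow> ((nat \<Rightarrow> complex) \<Rightarrow> real) \<Rightarrow> seq_op \<Rightarrow> real" where
  "op_norm V N T = (SUP x \<in> {x \<in> V. N x \<le> 1}. N (T x))"

definition op_algebra ::
    "(nat \<Rightarrow> complex) set \<Rightarrow> ((nat \<Rightarrow> complex) \<Rightarrow> real) \<Rightarrow> seq_op normed_algebra" where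
  "op_algebra V N =
     \<lparr>carrier = bounded_ops V N,
      monoid.mult = (\<lambda>S T. compose V S T),
      one = (\<lambda>x\<in>V. x),
      zero = (\<lambda>x\<in>V. \<lambda>i. 0),
      add = (\<lambda>S T. \<lambda>x\<in>V. \<lambda>i. S x i + T x i),
      smult = (\<lambda>c T. \<lambda>x\<in>V. \<lambda>i. c * T x i),
      anorm = op_norm V N\<rparr>"

definition B_lp :: "ereal \<Rightarrow> seq_op normed_algebra" where
  "B_lp p = op_algebra (lp p) (lp_norm p)"

definition B_lp_fin :: "nat \<Rightarrow> ereal \<Rightarrow> seq_op normed_algebra" where
  "B_lp_fin n p = op_algebra (lp_fin n) (lp_norm p)"


section \<open>Products\<close>

definition bounded_product :: "(nat \<Rightarrow> 'a normed_algebra) \<Rightarrow> (nat \<Rightarrow> 'a) normed_algebra" where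
  "bounded_product A =
     \<lparr>carrier = {x. (\<forall>n. x n \<in> carrier (A n)) \<and> bdd_above (range (\<lambda>n. anorm (A n) (x n)))},
      monoid.mult = (\<lambda>x y n. x n \<otimes>\<^bsub>A n\<^esub> y n),
      one = (\<lambda>n. \<one>\<^bsub>A n\<^esub>),
      zero = (\<lambda>n. \<zero>\<^bsub>A n\<^esub>),
      add = (\<lambda>x y n. x n \<oplus>\<^bsub>A n\<^esub> y n),
      smult = (\<lambda>c x n. c \<odot>\<^bsub>A n\<^esub> x n),
      anorm = (\<lambda>x. SUP n. anorm (A n) (x n))\<rparr>"

text \<open>The product is over \<open>n \<ge> 1\<close>, hence the shift of the index.\<close>

definition prod_B_lp_fin :: "ereal \<Rightarrow> (nat \<Rightarrow> seq_op) normed_algebra" where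
  "prod_B_lp_fin p = bounded_product (\<lambda>n. B_lp_fin (Suc n) p)"


section \<open>Regular operators\<close>

definition matrix_of :: "seq_op \<Rightarrow> nat \<Rightarrow> nat \<Rightarrow> complex" where
  "matrix_of T i j = T (\<lambda>k. if k = j then 1 else 0) i"

definition abs_matrix :: "(nat \<Rightarrow> nat \<Rightarrow> complex) \<Rightarrow> nat \<Rightarrow> nat \<Rightarrow> complex" where
  "abs_matrix m i j = complex_of_real (cmod (m i j))"

definition matrix_op :: "ereal \<Rightarrow> (nat \<Rightarrow> nat \<Rightarrow> complex) \<Rightarrow> seq_op" where
  "matrix_op p m = (\<lambda>x\<in>lp p. \<lambda>i. suminf (\<lambda>j. m i j * x j))"

text \<open>
  For \<open>p < \<infinity>\<close> every bounded operator is given by its matrix, with absolutely convergent sums.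
\<close>

definition bounded_matrix :: "ereal \<Rightarrow> (nat \<Rightarrow> nat \<Rightarrow> complex) \<Rightarrow> bool" where
  "bounded_matrix p m \<longleftrightarrow>
     (\<forall>x\<in>lp p. \<forall>i. summable (\<lambda>j. cmod (m i j * x j))) \<and> matrix_op p m \<in> carrier (B_lp p)"

definition regular_ops :: "ereal \<Rightarrow> seq_op set" where
  "regular_ops p = {T \<in> carrier (B_lp p).
     bounded_matrix p (matrix_of T) \<and> T = matrix_op p (matrix_of T) \<and>
     bounded_matrix p (abs_matrix (matrix_of T))}"

definition Br_lp :: "ereal \<Rightarrow> seq_op normed_algebra" where
  "Br_lp p = (B_lp p)
     \<lparr>carrier := regular_ops p,
      anorm := (\<lambda>T. anorm (B_lp p) (matrix_op p (abs_matrix (matrix_of T))))\<rparr>"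

end

theory Submission
  imports Defs "HOL-Analysis.Analysis" "HOL-Library.Function_Algebras"
begin

text \<open>
  Let \<open>\<Sum>\<^sub>i a\<^sub>i \<otimes> b\<^sub>i\<close> be an approximate diagonal with \<open>R\<close> terms. For a finite set of coordinates and
  each index \<open>r\<close> the matrix \<open>T\<^sub>r(s,t) = \<Sum>\<^sub>i a\<^sub>i(s,r) b\<^sub>i(r,t)\<close> has rank at most \<open>R\<close>. The traces of the
  \<open>T\<^sub>r\<close> add up to the number of coordinates, and by Khinchine's inequality the trace norms of the
  commutators of the \<open>T\<^sub>r\<close> with a fixed finite family of monomial matrices in the algebra add up to
  at most a small multiple of it, so some \<open>T\<^sub>r\<close> almost commutes with the family relative to its own
  trace. After passing to the hermitian part \<open>H\<close>, the Powers-Stormer inequality shows that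
  \<open>K = sqrt |H|\<close> almost commutes with the family in Hilbert-Schmidt norm.

  The coordinates are the points of \<open>(\<int>/q)\<^sup>2\<close> and the family consists of the characters, the
  translations and the two elementary shears. A measure on \<open>(\<int>/q)\<^sup>2\<close> that is concentrated near \<open>0\<close> and
  almost invariant under both shears is concentrated at \<open>0\<close>. Applied to the difference \<open>s - t\<close> this
  makes \<open>K\<close> almost diagonal, and applied to the Fourier transform of the diagonal it makes \<open>K\<close> almost
  scalar. For \<open>q\<close> large this contradicts \<open>rank K \<le> 2 R\<close>.
\<close>

section \<open>The spectral theorem for hermitian matrices\<close>

text \<open>The finite set and the tolerance in the definition of amenability are fixed before
  \<open>R\<close> is known, so no estimate may lose a factor that grows with \<open>R\<close> or
  with the number of coordinates. Only the size \<open>q\<close> and the discretisation are chosen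
  in terms of \<open>R\<close>; everything else rests on a spectral gap uniform in \<open>q\<close>.
  This explains the coordinates: the gap is a finite form of relative property (T) for the integer
  plane in its semidirect product with SL(2), proved by Burger's comparison of sectors. Each
  generator has to serve all \<open>q\<close> at once.

  The gap is a statement about Hilbert spaces, whereas the projective norm controls sums of products
  of operator norms on \<open>lp\<close>. Two devices connect them. Averaging over signs replaces
  \<open>lp\<close> norms by Euclidean ones, and the norm of a sign vector cancels against its dual
  norm, so that no exponent is distinguished. The square root of \<open>|H|\<close> then carries
  trace norms to Hilbert-Schmidt norms, with a loss that depends on the tolerance alone.\<close>

locale finite_index =
  fixes I :: "'i set"
  assumes fin: "finite I"
begin

definition inner_prod :: "('i \<Rightarrow> complex) \<Rightarrow> ('i \<Rightarrow> complex) \<Rightarrow> complex" where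
  "inner_prod x y = (\<Sum>s\<in>I. cnj (x s) * y s)"

definition sqnorm :: "('i \<Rightarrow> complex) \<Rightarrow> real" where
  "sqnorm x = (\<Sum>s\<in>I. (cmod (x s))\<^sup>2)"

definition mat_vec :: "('i \<Rightarrow> 'i \<Rightarrow> complex) \<Rightarrow> ('i \<Rightarrow> complex) \<Rightarrow> 'i \<Rightarrow> complex" where
  "mat_vec H x s = (if s \<in> I then \<Sum>t\<in>I. H s t * x t else 0)"

definition herm :: "('i \<Rightarrow> 'i \<Rightarrow> complex) \<Rightarrow> bool" where
  "herm H \<longleftrightarrow> (\<forall>s\<in>I. \<forall>t\<in>I. H t s = cnj (H s t))"

text \<open>Vectors are functions on a possibly infinite type; making them vanish off
  \<open>I\<close> gives a compact unit sphere and turns agreement on \<open>I\<close> into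
  equality.\<close>

definition vec :: "('i \<Rightarrow> complex) \<Rightarrow> bool" where
  "vec x \<longleftrightarrow> (\<forall>s. s \<notin> I \<longrightarrow> x s = 0)"

lemma inner_prod_self: "inner_prod x x = of_real (sqnorm x)"
  unfolding inner_prod_def sqnorm_def of_real_sum
  by (rule sum.cong) (simp_all only: complex_norm_square mult.commute)

lemma sqnorm_nonneg: "sqnorm x \<ge> 0"
  unfolding sqnorm_def by (rule sum_nonneg) simp

lemma sqnorm_zero_iff: "sqnorm x = 0 \<longleftrightarrow> (\<forall>s\<in>I. x s = 0)"
  unfolding sqnorm_def using fin by (subst sum_nonneg_eq_0_iff) auto

lemma sqnorm_scale: "sqnorm (\<lambda>s. c * y s) = (cmod c)\<^sup>2 * sqnorm y"
  by (simp add: sqnorm_def norm_mult power_mult_distrib sum_distrib_left)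

lemma inner_prod_add_right: "inner_prod x (\<lambda>s. y s + z s) = inner_prod x y + inner_prod x z"
  by (simp add: inner_prod_def algebra_simps sum.distrib)

lemma inner_prod_scale_right: "inner_prod x (\<lambda>s. c * y s) = c * inner_prod x y"
  by (simp add: inner_prod_def algebra_simps sum_distrib_left)

lemma inner_prod_cnj: "cnj (inner_prod x y) = inner_prod y x"
  by (simp add: inner_prod_def mult.commute)

lemma inner_prod_add_left: "inner_prod (\<lambda>s. y s + z s) x = inner_prod y x + inner_prod z x"
  by (simp add: inner_prod_def algebra_simps sum.distrib)

lemma inner_prod_scale_left: "inner_prod (\<lambda>s. c * y s) x = cnj c * inner_prod y x"
  by (simp add: inner_prod_def algebra_simps sum_distrib_left)

lemma inner_prod_mat_vec:
  assumes "herm H" shows "inner_prod x (mat_vec H y) = inner_prod (mat_vec H x) y"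
proof -
  have "inner_prod x (mat_vec H y) = (\<Sum>s\<in>I. \<Sum>t\<in>I. cnj (x s) * H s t * y t)"
    by (simp add: inner_prod_def mat_vec_def sum_distrib_left mult.assoc)
  also have "\<dots> = (\<Sum>t\<in>I. \<Sum>s\<in>I. cnj (x s) * H s t * y t)" by (rule sum.swap)
  also have "\<dots> = (\<Sum>t\<in>I. \<Sum>s\<in>I. cnj (H t s * x s) * y t)"
  proof (intro sum.cong refl)
    fix s t assume "s \<in> I" "t \<in> I"
    then have "H s t = cnj (H t s)" using assms unfolding herm_def by blast
    then show "cnj (x s) * H s t * y t = cnj (H t s * x s) * y t" by simp
  qed
  also have "\<dots> = inner_prod (mat_vec H x) y"
    by (simp add: inner_prod_def mat_vec_def sum_distrib_right)
  finally show ?thesis .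
qed

lemma mat_vec_add: "mat_vec H (\<lambda>s. x s + y s) = (\<lambda>s. mat_vec H x s + mat_vec H y s)"
  by (auto simp: mat_vec_def algebra_simps sum.distrib)

lemma mat_vec_scale: "mat_vec H (\<lambda>s. c * x s) = (\<lambda>s. c * mat_vec H x s)"
  by (auto simp: mat_vec_def algebra_simps sum_distrib_left)

text \<open>A unit vector has coordinates in the closed unit disc on \<open>I\<close> and zero
  elsewhere, so Tychonoff's theorem gives a compact box in the product topology. The remaining
  conditions are closed because they involve finitely many coordinates.\<close>

lemma compact_unit_vectors:
  "compact {x. vec x \<and> sqnorm x = 1 \<and> (\<forall>k<m. inner_prod (w k) x = 0)}"
proof -
  let ?K = "PiE UNIV (\<lambda>i. if i \<in> I then cball (0::complex) 1 else {0})"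
  have "compactin (product_topology (\<lambda>i. euclidean) UNIV) ?K"
    by (subst compactin_PiE) (auto simp: compactin_euclidean_iff)
  then have K: "compact ?K"
    by (simp add: euclidean_product_topology compactin_euclidean_iff)
  have c: "continuous_on UNIV (\<lambda>x::'i \<Rightarrow> complex. x i)" for i
    by (rule continuous_on_product_coordinates)
  have c1: "continuous_on UNIV sqnorm"
    unfolding sqnorm_def by (intro continuous_intros c)
  have c2: "continuous_on UNIV (inner_prod y)" for y
    unfolding inner_prod_def by (intro continuous_intros c)
  have cl: "closed {x. sqnorm x = 1}"
    using continuous_closed_preimage_constant[OF c1 closed_UNIV] by auto
  have "closed {x. inner_prod (w k) x = 0}" for k
    using continuous_closed_preimage_constant[OF c2 closed_UNIV] by auto
  then have "closed (\<Inter>k\<in>{..<m}. {x. inner_prod (w k) x = 0})" by auto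
  with cl have "closed ({x. sqnorm x = 1} \<inter> (\<Inter>k\<in>{..<m}. {x. inner_prod (w k) x = 0}))"
    by (rule closed_Int)
  with K have "compact (?K \<inter> ({x. sqnorm x = 1} \<inter> (\<Inter>k\<in>{..<m}. {x. inner_prod (w k) x = 0})))"
    by (rule compact_Int_closed)
  also have "?K \<inter> ({x. sqnorm x = 1} \<inter> (\<Inter>k\<in>{..<m}. {x. inner_prod (w k) x = 0}))
     = {x. vec x \<and> sqnorm x = 1 \<and> (\<forall>k<m. inner_prod (w k) x = 0)}" (is "?L = ?R")
  proof
    show "?L \<subseteq> ?R" by (auto simp: vec_def PiE_iff split: if_splits)
    have "cmod (x i) \<le> 1" if "sqnorm x = 1" "i \<in> I" for x i
    proof -
      have "(cmod (x i))\<^sup>2 \<le> sqnorm x"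
        unfolding sqnorm_def using fin that by (intro member_le_sum) auto
      with that show ?thesis by (simp add: power_le_one_iff abs_square_le_1)
    qed
    then show "?R \<subseteq> ?L" by (auto simp: vec_def PiE_iff)
  qed
  finally show ?thesis .
qed

text \<open>The projection \<open>E\<close> onto the complement of the \<open>w k\<close> has trace
  \<open>card I - m\<close>, which is not zero. Some diagonal entry is then nonzero, and the column
  through it, normalised, is the vector sought.\<close>

lemma orthogonal_unit_vector:
  assumes on: "\<And>j k. j < m \<Longrightarrow> k < m \<Longrightarrow> inner_prod (w j) (w k) = (if j = k then 1 else 0)"
    and m: "m < card I"
  obtains x where "vec x" "sqnorm x = 1" "\<forall>k<m. inner_prod (w k) x = 0"
proof -
  define E where "E s t = (if s = t then 1 else 0) - (\<Sum>k<m. w k s * cnj (w k t))" for s t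
  have "(\<Sum>s\<in>I. E s s) = of_nat (card I) - (\<Sum>k<m. inner_prod (w k) (w k))"
    unfolding E_def sum_subtractf inner_prod_def
    by (subst (2) sum.swap) (simp add: mult.commute)
  also have "\<dots> = of_nat (card I) - of_nat m" using on by simp
  also have "\<dots> \<noteq> 0" using m by simp
  finally have "(\<Sum>s\<in>I. E s s) \<noteq> 0" .
  then obtain t where t: "t \<in> I" "E t t \<noteq> 0" by (rule sum.not_neutral_contains_not_neutral)
  define y where "y s = (if s \<in> I then E s t else 0)" for s
  have orth: "inner_prod (w k) y = 0" if "k < m" for k
  proof -
    have "inner_prod (w k) y = (\<Sum>s\<in>I. cnj (w k s) * (if s = t then 1 else 0))
        - (\<Sum>s\<in>I. \<Sum>j<m. cnj (w k s) * w j s * cnj (w j t))"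
      by (simp add: inner_prod_def y_def E_def algebra_simps sum_subtractf sum_distrib_left)
    also have "(\<Sum>s\<in>I. \<Sum>j<m. cnj (w k s) * w j s * cnj (w j t)) = (\<Sum>j<m. inner_prod (w k) (w j) * cnj (w j t))"
      by (subst sum.swap) (simp add: inner_prod_def sum_distrib_right)
    also have "\<dots> = (\<Sum>j<m. if j = k then cnj (w j t) else 0)"
      using on[OF that] by (intro sum.cong) auto
    also have "\<dots> = cnj (w k t)" using that by simp
    also have "(\<Sum>s\<in>I. cnj (w k s) * (if s = t then 1 else 0)) = cnj (w k t)"
      using t fin by (simp add: sum.delta' if_distrib cong: if_cong)
    finally show ?thesis by simp
  qed
  have "y t \<noteq> 0" using t by (simp add: y_def)
  then have "sqnorm y \<noteq> 0" using t(1) sqnorm_zero_iff by blast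
  then have pos: "sqnorm y > 0" using sqnorm_nonneg[of y] by linarith
  define x where "x s = of_real (1 / sqrt (sqnorm y)) * y s" for s
  have "vec x" by (simp add: vec_def x_def y_def)
  moreover have "sqnorm x = 1"
    unfolding x_def sqnorm_scale using pos by (simp add: norm_divide power_divide)
  moreover have "\<forall>k<m. inner_prod (w k) x = 0"
    unfolding x_def inner_prod_scale_right using orth by simp
  ultimately show thesis by (rule that)
qed

text \<open>This is how a first variation is shown to vanish: for small positive \<open>t\<close>
  the quadratic side loses.\<close>

lemma quadratic_dominates_linear:
  fixes a b :: real
  assumes "\<And>t. t * a \<le> t\<^sup>2 * b" "a \<ge> 0" shows "a = 0"
proof (rule ccontr)
  assume "a \<noteq> 0"
  with assms have a: "a > 0" by simp
  obtain c where c: "c > 0" "b \<le> c" by (meson gt_ex linorder_le_cases order_less_imp_le order_le_less_trans)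
  define t where "t = a / (2 * c)"
  have t: "t > 0" using a c by (simp add: t_def)
  have "t * a \<le> t\<^sup>2 * b" by (rule assms)
  then have "a \<le> t * b" using t by (simp add: power2_eq_square mult.assoc)
  also have "\<dots> \<le> t * c" using t c by (intro mult_left_mono) auto
  also have "\<dots> = a / 2" using c by (simp add: t_def)
  finally show False using a by simp
qed

text \<open>A maximiser \<open>x\<close> of the Rayleigh quotient on the complement of the earlier
  eigenvectors is an eigenvector. Its residual \<open>v\<close> lies in that complement too, so
  maximality may be tested along \<open>x + t v\<close>.\<close>

lemma eigenvector_step:
  assumes H: "herm H"
    and on: "\<And>j k. j < m \<Longrightarrow> k < m \<Longrightarrow> inner_prod (w j) (w k) = (if j = k then 1 else 0)"
    and ev: "\<And>k. k < m \<Longrightarrow> mat_vec H (w k) = (\<lambda>s. of_real (h k) * w k s)"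
    and m: "m < card I"
  obtains x l where "vec x" "sqnorm x = 1" "\<forall>k<m. inner_prod (w k) x = 0"
    "mat_vec H x = (\<lambda>s. of_real l * x s)"
proof -
  let ?C = "{x. vec x \<and> sqnorm x = 1 \<and> (\<forall>k<m. inner_prod (w k) x = 0)}"
  let ?q = "\<lambda>x. Re (inner_prod x (mat_vec H x))"
  have ne: "?C \<noteq> {}" using orthogonal_unit_vector[OF on m] by blast
  have c: "continuous_on UNIV (\<lambda>x::'i \<Rightarrow> complex. x i)" for i
    by (rule continuous_on_product_coordinates)
  have "continuous_on UNIV (\<lambda>x. inner_prod x (mat_vec H x))"
    unfolding inner_prod_def mat_vec_def
    by (intro continuous_on_sum continuous_on_mult continuous_on_cnj c)
       (auto intro!: continuous_on_sum continuous_on_mult c continuous_intros)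
  then have "continuous_on ?C ?q"
    using continuous_on_subset by (intro continuous_on_Re) blast
  from continuous_attains_sup[OF compact_unit_vectors ne this]
  obtain x where x: "x \<in> ?C" and max: "\<And>y. y \<in> ?C \<Longrightarrow> ?q y \<le> ?q x" by auto
  define l where "l = ?q x"
  have max': "?q y \<le> l * sqnorm y" if "vec y" "\<forall>k<m. inner_prod (w k) y = 0" for y
  proof (cases "sqnorm y = 0")
    case True
    then have "inner_prod y (mat_vec H y) = 0" by (auto simp: sqnorm_zero_iff inner_prod_def)
    then show ?thesis using True by simp
  next
    case False
    then have pos: "sqnorm y > 0" using sqnorm_nonneg[of y] by linarith
    define c where "c = 1 / sqrt (sqnorm y)"
    define z where "z s = of_real c * y s" for s
    have c2: "c * c = 1 / sqnorm y" using pos by (simp add: c_def)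
    have "sqnorm z = 1"
      unfolding z_def sqnorm_scale using pos by (simp add: power2_eq_square c2)
    moreover have "vec z" using that by (auto simp: vec_def z_def)
    moreover have "\<forall>k<m. inner_prod (w k) z = 0"
      unfolding z_def inner_prod_scale_right using that by simp
    ultimately have "?q z \<le> l" unfolding l_def by (intro max) simp
    moreover have "inner_prod z (mat_vec H z) = of_real (c * c) * inner_prod y (mat_vec H y)"
      unfolding z_def mat_vec_scale inner_prod_scale_left inner_prod_scale_right by simp
    ultimately have "(1 / sqnorm y) * ?q y \<le> l" unfolding c2 by simp
    then show ?thesis using pos by (simp add: field_simps)
  qed
  have xv: "vec x" and x1: "sqnorm x = 1" and xo: "\<forall>k<m. inner_prod (w k) x = 0" using x by auto
  define v where "v s = mat_vec H x s + (- of_real l) * x s" for s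
  have vv: "vec v" using xv by (auto simp: vec_def v_def mat_vec_def)
  have vo: "\<forall>k<m. inner_prod (w k) v = 0"
  proof (intro allI impI)
    fix k assume k: "k < m"
    have "inner_prod (w k) (mat_vec H x) = inner_prod (mat_vec H (w k)) x"
      by (rule inner_prod_mat_vec[OF H])
    also have "\<dots> = 0" using k xo by (simp add: ev inner_prod_scale_left)
    finally show "inner_prod (w k) v = 0"
      unfolding v_def inner_prod_add_right inner_prod_scale_right using xo k by simp
  qed
  have herm_real: "inner_prod x (mat_vec H x) = of_real l"
  proof -
    have "cnj (inner_prod x (mat_vec H x)) = inner_prod x (mat_vec H x)"
      using inner_prod_mat_vec[OF H, of x x] by (simp add: inner_prod_cnj)
    then have "Im (inner_prod x (mat_vec H x)) = 0" by (simp add: complex_eq_iff)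
    then show ?thesis unfolding l_def by (simp add: complex_eq_iff)
  qed
  have vx: "inner_prod x v = 0"
    unfolding v_def inner_prod_add_right inner_prod_scale_right herm_real
    by (simp add: inner_prod_self x1)
  have vx': "inner_prod v x = 0" using vx by (metis inner_prod_cnj complex_cnj_zero)
  have vH: "inner_prod v (mat_vec H x) = of_real (sqnorm v)"
  proof -
    have veq: "(\<lambda>s. mat_vec H x s + (- of_real l) * x s) = v" by (rule ext) (simp only: v_def)
    have "inner_prod v (\<lambda>s. mat_vec H x s + (- of_real l) * x s)
        = inner_prod v (mat_vec H x) + (- of_real l) * inner_prod v x"
      by (simp only: inner_prod_add_right inner_prod_scale_right)
    then have "inner_prod v v = inner_prod v (mat_vec H x) + (- of_real l) * inner_prod v x"
      by (simp only: veq)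
    then show ?thesis using vx' by (simp add: inner_prod_self)
  qed
  have xHv: "inner_prod x (mat_vec H v) = of_real (sqnorm v)"
    using inner_prod_mat_vec[OF H, of x v] vH inner_prod_cnj[of "v" "mat_vec H x"] by simp
  \<comment> \<open>Since \<open>v\<close> is orthogonal to \<open>x\<close>, the squared norm of
    \<open>x + t v\<close> has no linear term, while the quadratic form has the linear term
    \<open>2 * t * sqnorm v\<close>.\<close>
  have "t * (2 * sqnorm v) \<le> t\<^sup>2 * (l * sqnorm v - ?q v)" for t :: real
  proof -
    let ?y = "\<lambda>s. x s + of_real t * v s"
    have "vec ?y" using xv vv by (auto simp: vec_def)
    moreover have "\<forall>k<m. inner_prod (w k) ?y = 0"
      unfolding inner_prod_add_right inner_prod_scale_right using xo vo by simp
    ultimately have "?q ?y \<le> l * sqnorm ?y" by (rule max')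
    moreover have "complex_of_real (sqnorm ?y) = of_real (1 + t\<^sup>2 * sqnorm v)"
      unfolding inner_prod_self[symmetric] inner_prod_add_right inner_prod_add_left
        inner_prod_scale_right inner_prod_scale_left vx vx'
      by (simp add: inner_prod_self x1 power2_eq_square)
    moreover have "inner_prod ?y (mat_vec H ?y)
        = of_real (l + 2 * t * sqnorm v) + of_real (t\<^sup>2) * inner_prod v (mat_vec H v)"
      unfolding mat_vec_add mat_vec_scale inner_prod_add_right inner_prod_add_left
        inner_prod_scale_right inner_prod_scale_left vH xHv herm_real
      by (simp add: power2_eq_square algebra_simps)
    ultimately have "l + 2 * t * sqnorm v + t\<^sup>2 * ?q v \<le> l * (1 + t\<^sup>2 * sqnorm v)"
      unfolding of_real_eq_iff by simp
    then show ?thesis by (simp add: algebra_simps)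
  qed
  then have "2 * sqnorm v = 0"
    by (rule quadratic_dominates_linear) (simp add: sqnorm_nonneg)
  then have "\<forall>s\<in>I. v s = 0" by (simp add: sqnorm_zero_iff)
  then have "mat_vec H x = (\<lambda>s. of_real l * x s)"
    using vv by (auto simp: vec_def v_def fun_eq_iff)
  with xv x1 xo show thesis by (rule that)
qed

lemma orthonormal_eigenvectors:
  assumes H: "herm H" and "m \<le> card I"
  shows "\<exists>w h. (\<forall>k<m. vec (w k) \<and> mat_vec H (w k) = (\<lambda>s. of_real (h k :: real) * w k s)) \<and>
     (\<forall>j<m. \<forall>k<m. inner_prod (w j) (w k) = (if j = k then 1 else 0))"
  using assms(2)
proof (induction m)
  case 0
  then show ?case by simp
next
  case (Suc m)
  from Suc.IH[OF Suc_leD[OF Suc.prems]] obtain w h where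
    *: "\<forall>k<m. vec (w k) \<and> mat_vec H (w k) = (\<lambda>s. of_real (h k :: real) * w k s)"
      "\<forall>j<m. \<forall>k<m. inner_prod (w j) (w k) = (if j = k then 1 else 0)"
    by (elim exE conjE) (rule that)
  have w: "\<And>k. k < m \<Longrightarrow> vec (w k)" "\<And>k. k < m \<Longrightarrow> mat_vec H (w k) = (\<lambda>s. of_real (h k :: real) * w k s)"
    and on: "\<And>j k. j < m \<Longrightarrow> k < m \<Longrightarrow> inner_prod (w j) (w k) = (if j = k then 1 else 0)"
    using * by blast+
  have "m < card I" using Suc.prems by simp
  from eigenvector_step[of H m w h, OF H on w(2) this] obtain x l where
    x: "vec x" "sqnorm x = 1" "\<forall>k<m. inner_prod (w k) x = 0" "mat_vec H x = (\<lambda>s. of_real l * x s)"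
    by blast
  have x': "\<forall>k<m. inner_prod x (w k) = 0"
    using x(3) inner_prod_cnj[of "w _" x] by (metis complex_cnj_zero)
  show ?case
    by (rule exI[of _ "w(m := x)"], rule exI[of _ "h(m := l)"])
      (use w on x x' in \<open>auto simp: less_Suc_eq inner_prod_self\<close>)
qed

text \<open>The defect \<open>E\<close> of the resolution of the identity annihilates every
  \<open>w k\<close>, so its squared Hilbert-Schmidt norm reduces to its trace. That trace is
  \<open>card I\<close> minus the number of eigenvectors, hence \<open>0\<close>.\<close>

lemma spectral_decomposition:
  assumes H: "herm H"
  obtains w :: "nat \<Rightarrow> 'i \<Rightarrow> complex" and h :: "nat \<Rightarrow> real" where
    "\<And>k. k < card I \<Longrightarrow> vec (w k)"
    "\<And>j k. j < card I \<Longrightarrow> k < card I \<Longrightarrow> inner_prod (w j) (w k) = (if j = k then 1 else 0)"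
    "\<And>s t. s \<in> I \<Longrightarrow> t \<in> I \<Longrightarrow> (\<Sum>k<card I. w k s * cnj (w k t)) = (if s = t then 1 else 0)"
    "\<And>s t. s \<in> I \<Longrightarrow> t \<in> I \<Longrightarrow> H s t = (\<Sum>k<card I. of_real (h k) * w k s * cnj (w k t))"
proof -
  let ?n = "card I"
  obtain w h where w: "\<And>k. k < ?n \<Longrightarrow> vec (w k)"
      "\<And>k. k < ?n \<Longrightarrow> mat_vec H (w k) = (\<lambda>s. of_real (h k :: real) * w k s)"
    and on: "\<And>j k. j < ?n \<Longrightarrow> k < ?n \<Longrightarrow> inner_prod (w j) (w k) = (if j = k then 1 else 0)"
  proof -
    from orthonormal_eigenvectors[OF H order_refl] obtain w h where
      *: "\<forall>k<?n. vec (w k) \<and> mat_vec H (w k) = (\<lambda>s. of_real (h k :: real) * w k s)"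
        "\<forall>j<?n. \<forall>k<?n. inner_prod (w j) (w k) = (if j = k then 1 else 0)"
      by (elim exE conjE) (rule that)
    show thesis by (rule that[of w h]) (use * in blast)+
  qed
  define E where "E s t = (if s = t then 1 else 0) - (\<Sum>k<?n. w k s * cnj (w k t))" for s t
  have ann: "(\<Sum>t\<in>I. E s t * w k t) = 0" if "s \<in> I" "k < ?n" for s k
  proof -
    have "(\<Sum>t\<in>I. E s t * w k t) = (\<Sum>t\<in>I. (if t = s then 1 else 0) * w k t)
       - (\<Sum>t\<in>I. \<Sum>j<?n. w j s * (cnj (w j t) * w k t))"
      by (simp add: E_def algebra_simps sum_subtractf sum_distrib_left eq_commute)
    also have "(\<Sum>t\<in>I. \<Sum>j<?n. w j s * (cnj (w j t) * w k t)) = (\<Sum>j<?n. w j s * inner_prod (w j) (w k))"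
      by (subst sum.swap) (simp add: inner_prod_def sum_distrib_left)
    also have "\<dots> = (\<Sum>j<?n. if j = k then w j s else 0)"
      using on that by (intro sum.cong) auto
    also have "\<dots> = w k s" using that by simp
    also have "(\<Sum>t\<in>I. (if t = s then 1 else 0) * w k t) = w k s"
      using that fin by (simp add: if_distrib[of "\<lambda>x. x * _"] cong: if_cong)
    finally show ?thesis by simp
  qed
  have cE: "cnj (E s t) = (if t = s then 1 else 0) - (\<Sum>k<?n. cnj (w k s) * w k t)" for s t
    by (auto simp: E_def)
  have "(\<Sum>s\<in>I. \<Sum>t\<in>I. (cmod (E s t))\<^sup>2) = 0"
  proof -
    have "complex_of_real (\<Sum>s\<in>I. \<Sum>t\<in>I. (cmod (E s t))\<^sup>2) = (\<Sum>s\<in>I. \<Sum>t\<in>I. E s t * cnj (E s t))"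
      by (simp only: of_real_sum complex_norm_square)
    also have "\<dots> = (\<Sum>s\<in>I. (\<Sum>t\<in>I. E s t * (if t = s then 1 else 0)) - (\<Sum>t\<in>I. \<Sum>k<?n. cnj (w k s) * (E s t * w k t)))"
      unfolding cE by (simp add: algebra_simps sum_subtractf sum_distrib_left)
    also have "\<dots> = (\<Sum>s\<in>I. E s s - (\<Sum>k<?n. cnj (w k s) * (\<Sum>t\<in>I. E s t * w k t)))"
    proof (rule sum.cong)
      fix s assume "s \<in> I"
      moreover have "(\<Sum>t\<in>I. \<Sum>k<?n. cnj (w k s) * (E s t * w k t)) = (\<Sum>k<?n. cnj (w k s) * (\<Sum>t\<in>I. E s t * w k t))"
        by (subst sum.swap) (simp add: sum_distrib_left)
      ultimately show "(\<Sum>t\<in>I. E s t * (if t = s then 1 else 0)) - (\<Sum>t\<in>I. \<Sum>k<?n. cnj (w k s) * (E s t * w k t))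
          = E s s - (\<Sum>k<?n. cnj (w k s) * (\<Sum>t\<in>I. E s t * w k t))"
        using fin by (simp add: if_distrib cong: if_cong)
    qed simp
    also have "\<dots> = (\<Sum>s\<in>I. E s s)" using ann by (intro sum.cong) auto
    also have "\<dots> = of_nat ?n - (\<Sum>k<?n. inner_prod (w k) (w k))"
      unfolding E_def sum_subtractf inner_prod_def
      by (subst (2) sum.swap) (simp add: mult.commute)
    also have "\<dots> = 0" using on by simp
    finally show ?thesis unfolding of_real_eq_0_iff .
  qed
  then have "\<forall>s\<in>I. (\<Sum>t\<in>I. (cmod (E s t))\<^sup>2) = 0"
    using fin by (subst (asm) sum_nonneg_eq_0_iff) (auto intro: sum_nonneg)
  then have E0: "E s t = 0" if "s \<in> I" "t \<in> I" for s t
    using that fin by (subst (asm) sum_nonneg_eq_0_iff) auto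
  have compl: "(\<Sum>k<?n. w k s * cnj (w k t)) = (if s = t then 1 else 0)" if "s \<in> I" "t \<in> I" for s t
    using E0[OF that] by (simp add: E_def)
  have dec: "H s t = (\<Sum>k<?n. of_real (h k) * w k s * cnj (w k t))" if "s \<in> I" "t \<in> I" for s t
  proof -
    have "(\<Sum>k<?n. of_real (h k) * w k s * cnj (w k t)) = (\<Sum>k<?n. mat_vec H (w k) s * cnj (w k t))"
      by (rule sum.cong) (simp_all add: w)
    also have "\<dots> = (\<Sum>k<?n. \<Sum>u\<in>I. H s u * (w k u * cnj (w k t)))"
      using that by (simp add: mat_vec_def sum_distrib_right mult.assoc)
    also have "\<dots> = (\<Sum>u\<in>I. H s u * (\<Sum>k<?n. w k u * cnj (w k t)))"
      by (subst sum.swap) (simp add: sum_distrib_left)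
    also have "\<dots> = (\<Sum>u\<in>I. if u = t then H s u else 0)"
      using that by (intro sum.cong) (auto simp: compl)
    also have "\<dots> = H s t" using that fin by simp
    finally show ?thesis by simp
  qed
  show thesis by (rule that[OF w(1) on compl dec])
qed

end

section \<open>Matrices, functional calculus and the Powers-Stormer inequality\<close>

type_synonym 'i matrix = "'i \<Rightarrow> 'i \<Rightarrow> complex"

context finite_index
begin

definition mul :: "'i matrix \<Rightarrow> 'i matrix \<Rightarrow> 'i matrix" (infixl "\<star>" 70) where
  "A \<star> B = (\<lambda>s t. \<Sum>u\<in>I. A s u * B u t)"

definition adj :: "'i matrix \<Rightarrow> 'i matrix" where
  "adj A = (\<lambda>s t. cnj (A t s))"

definition tr :: "'i matrix \<Rightarrow> complex" where
  "tr A = (\<Sum>s\<in>I. A s s)"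

definition hs :: "'i matrix \<Rightarrow> real" where
  "hs A = (\<Sum>s\<in>I. \<Sum>t\<in>I. (cmod (A s t))\<^sup>2)"

text \<open>Only entries over \<open>I\<close> matter; making the others zero turns matrix
  identities into identities of functions and gives \<open>idm\<close> the role of a unit.\<close>

definition mat :: "'i matrix \<Rightarrow> bool" where
  "mat A \<longleftrightarrow> (\<forall>s t. s \<notin> I \<or> t \<notin> I \<longrightarrow> A s t = 0)"

definition idm :: "'i matrix" where
  "idm = (\<lambda>s t. if s = t \<and> s \<in> I then 1 else 0)"

definition unitary :: "'i matrix \<Rightarrow> bool" where
  "unitary V \<longleftrightarrow> mat V \<and> V \<star> adj V = idm \<and> adj V \<star> V = idm"

lemma mul_assoc: "(A \<star> B) \<star> C = A \<star> (B \<star> C)"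
proof (intro ext)
  fix s t
  have "((A \<star> B) \<star> C) s t = (\<Sum>u\<in>I. \<Sum>v\<in>I. A s v * (B v u * C u t))"
    by (simp add: mul_def sum_distrib_right mult.assoc)
  also have "\<dots> = (\<Sum>v\<in>I. \<Sum>u\<in>I. A s v * (B v u * C u t))" by (rule sum.swap)
  also have "\<dots> = (A \<star> (B \<star> C)) s t" by (simp add: mul_def sum_distrib_left)
  finally show "((A \<star> B) \<star> C) s t = (A \<star> (B \<star> C)) s t" .
qed

lemma mul_add_left: "(A + B) \<star> C = A \<star> C + B \<star> C"
  by (simp add: mul_def fun_eq_iff algebra_simps sum.distrib)

lemma mul_add_right: "C \<star> (A + B) = C \<star> A + C \<star> B"
  by (simp add: mul_def fun_eq_iff algebra_simps sum.distrib)

lemma mul_diff_left: "(A - B) \<star> C = A \<star> C - B \<star> C"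
  by (simp add: mul_def fun_eq_iff algebra_simps sum_subtractf)

lemma mul_diff_right: "C \<star> (A - B) = C \<star> A - C \<star> B"
  by (simp add: mul_def fun_eq_iff algebra_simps sum_subtractf)

lemmas mul_distribs = mul_add_left mul_add_right mul_diff_left mul_diff_right

lemma adj_mul: "adj (A \<star> B) = adj B \<star> adj A"
  by (simp add: adj_def mul_def fun_eq_iff mult.commute)

lemma adj_adj [simp]: "adj (adj A) = A"
  by (simp add: adj_def)

lemma adj_add: "adj (A + B) = adj A + adj B"
  by (simp add: adj_def fun_eq_iff)

lemma adj_diff: "adj (A - B) = adj A - adj B"
  by (simp add: adj_def fun_eq_iff)

lemma adj_idm [simp]: "adj idm = idm"
  by (auto simp: adj_def idm_def fun_eq_iff)

lemma tr_add: "tr (A + B) = tr A + tr B"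
  by (simp add: tr_def sum.distrib)

lemma tr_diff: "tr (A - B) = tr A - tr B"
  by (simp add: tr_def sum_subtractf)

lemma tr_adj: "tr (adj A) = cnj (tr A)"
  by (simp add: tr_def adj_def)

lemma tr_mul: "tr (A \<star> B) = (\<Sum>s\<in>I. \<Sum>t\<in>I. A s t * B t s)"
  by (simp add: tr_def mul_def)

lemma tr_mul_commute: "tr (A \<star> B) = tr (B \<star> A)"
  unfolding tr_mul by (subst sum.swap) (simp add: mult.commute)

lemma mat_mul [intro]: "mat A \<Longrightarrow> mat B \<Longrightarrow> mat (A \<star> B)"
  by (auto simp: mat_def mul_def intro!: sum.neutral)

lemma mat_add [intro]: "mat A \<Longrightarrow> mat B \<Longrightarrow> mat (A + B)"
  by (auto simp: mat_def)

lemma mat_diff [intro]: "mat A \<Longrightarrow> mat B \<Longrightarrow> mat (A - B)"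
  by (auto simp: mat_def)

lemma mat_adj [intro]: "mat A \<Longrightarrow> mat (adj A)"
  by (auto simp: mat_def adj_def)

lemma mat_idm [simp]: "mat idm"
  by (auto simp: mat_def idm_def)

lemma idm_mul [simp]: assumes "mat A" shows "idm \<star> A = A"
proof (intro ext)
  fix s t
  have "(idm \<star> A) s t = (\<Sum>u\<in>I. if u = s then A s t else 0)"
    unfolding mul_def by (intro sum.cong) (auto simp: idm_def)
  also have "\<dots> = A s t" using fin assms by (auto simp: mat_def)
  finally show "(idm \<star> A) s t = A s t" .
qed

lemma mul_idm [simp]: assumes "mat A" shows "A \<star> idm = A"
proof -
  have "adj (A \<star> idm) = adj A" using assms by (simp add: adj_mul mat_adj)
  then have "adj (adj (A \<star> idm)) = adj (adj A)" by (rule arg_cong)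
  then show ?thesis by simp
qed

lemma unitary_mul: "unitary U \<Longrightarrow> unitary V \<Longrightarrow> unitary (U \<star> V)"
proof -
  assume U: "unitary U" and V: "unitary V"
  have "U \<star> V \<star> (adj V \<star> adj U) = U \<star> ((V \<star> adj V) \<star> adj U)" by (simp only: mul_assoc)
  moreover have "adj V \<star> adj U \<star> (U \<star> V) = adj V \<star> ((adj U \<star> U) \<star> V)" by (simp only: mul_assoc)
  ultimately show ?thesis using U V by (auto simp: unitary_def adj_mul mat_adj)
qed

lemma unitary_adj: "unitary U \<Longrightarrow> unitary (adj U)"
  by (auto simp: unitary_def)

lemma hs_nonneg: "hs A \<ge> 0"
  unfolding hs_def by (intro sum_nonneg) simp

lemma hs_eq_tr: "complex_of_real (hs A) = tr (adj A \<star> A)"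
  unfolding tr_mul hs_def adj_def of_real_sum
  by (subst sum.swap) (intro sum.cong refl, simp only: complex_norm_square mult.commute)

lemma hs_adj: "hs (adj A) = hs A"
  unfolding hs_def adj_def by (subst sum.swap) simp

lemma hs_unitary_left: assumes "unitary U" "mat A" shows "hs (U \<star> A) = hs A"
proof -
  have "adj (U \<star> A) \<star> (U \<star> A) = adj A \<star> ((adj U \<star> U) \<star> A)"
    by (simp only: adj_mul mul_assoc)
  also have "\<dots> = adj A \<star> A" using assms by (simp add: unitary_def)
  finally have "complex_of_real (hs (U \<star> A)) = of_real (hs A)" by (simp only: hs_eq_tr)
  then show ?thesis by simp
qed

lemma hs_unitary_right: assumes "unitary U" "mat A" shows "hs (A \<star> U) = hs A"
  using hs_unitary_left[of "adj U" "adj A"] assms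
  by (simp add: unitary_adj mat_adj hs_adj flip: adj_mul)

lemma cmod_tr_mul_le: "cmod (tr (A \<star> B)) \<le> sqrt (hs A) * sqrt (hs B)"
proof -
  let ?P = "I \<times> I"
  have "cmod (tr (A \<star> B)) \<le> (\<Sum>(s,t)\<in>?P. cmod (A s t) * cmod (B t s))"
    unfolding tr_mul sum.cartesian_product by (rule order_trans[OF norm_sum]) (simp add: norm_mult case_prod_unfold)
  also have "\<dots> \<le> sqrt (\<Sum>(s,t)\<in>?P. (cmod (A s t))\<^sup>2) * sqrt (\<Sum>(s,t)\<in>?P. (cmod (B t s))\<^sup>2)"
    using L2_set_mult_ineq[of "\<lambda>(s,t). cmod (A s t)" "\<lambda>(s,t). cmod (B t s)" ?P]
    by (simp add: L2_set_def case_prod_unfold)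
  also have "(\<Sum>(s,t)\<in>?P. (cmod (A s t))\<^sup>2) = hs A" by (simp add: hs_def sum.cartesian_product)
  also have "(\<Sum>(s,t)\<in>?P. (cmod (B t s))\<^sup>2) = hs (adj B)"
    by (simp add: hs_def adj_def sum.cartesian_product)
  finally show ?thesis by (simp add: hs_adj)
qed

section \<open>Functional calculus and the comparison of square roots\<close>

definition calculus :: "'i matrix \<Rightarrow> ((real \<Rightarrow> real) \<Rightarrow> 'i matrix) \<Rightarrow> bool" where
  "calculus H F \<longleftrightarrow> (\<forall>f. mat (F f)) \<and> (\<forall>f. adj (F f) = F f) \<and>
     (\<forall>f g. F f \<star> F g = F (\<lambda>x. f x * g x)) \<and>
     (\<forall>f g. F f + F g = F (\<lambda>x. f x + g x)) \<and>
     (\<forall>f g. F f - F g = F (\<lambda>x. f x - g x)) \<and>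
     F (\<lambda>x. x) = H \<and> F (\<lambda>x. 1) = idm"

lemma calculusD:
  assumes "calculus H F"
  shows "mat (F f)" "adj (F f) = F f"
    "F f \<star> F g = F (\<lambda>x. f x * g x)"
    "F f + F g = F (\<lambda>x. f x + g x)"
    "F f - F g = F (\<lambda>x. f x - g x)"
    "F (\<lambda>x. x) = H" "F (\<lambda>x. 1) = idm"
  using assms unfolding calculus_def by simp_all

lemma functional_calculus:
  assumes H: "mat H" "adj H = H"
  obtains F where "calculus H F"
proof -
  let ?n = "card I"
  have "herm H" using H(2) unfolding herm_def adj_def by (metis)
  then obtain w h where
    w: "\<And>k. k < ?n \<Longrightarrow> vec (w k)"
    and on: "\<And>j k. j < ?n \<Longrightarrow> k < ?n \<Longrightarrow> inner_prod (w j) (w k) = (if j = k then 1 else 0)"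
    and cp: "\<And>s t. s \<in> I \<Longrightarrow> t \<in> I \<Longrightarrow> (\<Sum>k<?n. w k s * cnj (w k t)) = (if s = t then 1 else 0)"
    and dc: "\<And>s t. s \<in> I \<Longrightarrow> t \<in> I \<Longrightarrow> H s t = (\<Sum>k<?n. of_real (h k :: real) * w k s * cnj (w k t))"
    using spectral_decomposition[of H] by blast
  define F where "F f = (\<lambda>s t. \<Sum>k<?n. of_real (f (h k)) * w k s * cnj (w k t))" for f :: "real \<Rightarrow> real"
  have m: "mat (F f)" for f
    using w by (auto simp: mat_def F_def vec_def intro!: sum.neutral)
  have "F f \<star> F g = F (\<lambda>x. f x * g x)" for f g
  proof (intro ext)
    fix s t
    have "(F f \<star> F g) s t = (\<Sum>u\<in>I. \<Sum>j<?n. \<Sum>k<?n. (of_real (f (h j)) * w j s * cnj (w j u)) * (of_real (g (h k)) * w k u * cnj (w k t)))"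
      by (simp add: mul_def F_def sum_product)
    also have "\<dots> = (\<Sum>j<?n. \<Sum>u\<in>I. \<Sum>k<?n. (of_real (f (h j)) * w j s * cnj (w j u)) * (of_real (g (h k)) * w k u * cnj (w k t)))"
      by (rule sum.swap)
    also have "\<dots> = (\<Sum>j<?n. \<Sum>k<?n. of_real (f (h j)) * w j s * of_real (g (h k)) * cnj (w k t) * inner_prod (w j) (w k))"
      by (intro sum.cong refl, subst sum.swap) (simp add: inner_prod_def sum_distrib_left mult_ac)
    also have "\<dots> = (\<Sum>j<?n. \<Sum>k<?n. if k = j then of_real (f (h j)) * w j s * of_real (g (h k)) * cnj (w k t) else 0)"
      by (intro sum.cong refl) (simp add: on)
    also have "\<dots> = F (\<lambda>x. f x * g x) s t"
      unfolding F_def by (intro sum.cong refl) simp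
    finally show "(F f \<star> F g) s t = F (\<lambda>x. f x * g x) s t" .
  qed
  moreover have "F (\<lambda>x. x) = H"
  proof (intro ext)
    fix s t show "F (\<lambda>x. x) s t = H s t"
    proof (cases "s \<in> I \<and> t \<in> I")
      case True
      then show ?thesis using dc[of s t] by (simp add: F_def)
    next
      case False
      then show ?thesis using m[of "\<lambda>x. x"] H(1) unfolding mat_def by metis
    qed
  qed
  moreover have "F (\<lambda>x. 1) = idm"
  proof (intro ext)
    fix s t show "F (\<lambda>x. 1) s t = idm s t"
    proof (cases "s \<in> I \<and> t \<in> I")
      case True
      then show ?thesis using cp[of s t] by (simp add: F_def idm_def)
    next
      case False
      then show ?thesis using m[of "\<lambda>x. 1"] mat_idm unfolding mat_def by metis
    qed
  qed
  moreover have "adj (F f) = F f" for f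
    by (simp add: adj_def F_def fun_eq_iff mult_ac)
  moreover have "F f + F g = F (\<lambda>x. f x + g x)" for f g
    by (simp add: F_def fun_eq_iff algebra_simps sum.distrib)
  moreover have "F f - F g = F (\<lambda>x. f x - g x)" for f g
    by (simp add: F_def fun_eq_iff algebra_simps sum_subtractf)
  ultimately show thesis using m by (intro that[of F]) (simp add: calculus_def)
qed

text \<open>By cyclicity the trace is the squared Hilbert-Schmidt norm of
  \<open>B \<star> P\<close>, although a product of two positive matrices need not be
  positive.\<close>

lemma tr_square_square_nonneg:
  assumes "adj P = P" "adj B = B"
  shows "Re (tr (P \<star> P \<star> (B \<star> B))) \<ge> 0"
proof -
  have "tr (P \<star> P \<star> (B \<star> B)) = tr (P \<star> (P \<star> B \<star> B))" by (simp only: mul_assoc)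
  also have "\<dots> = tr (P \<star> B \<star> B \<star> P)" by (subst tr_mul_commute) simp
  also have "P \<star> B \<star> B \<star> P = adj (B \<star> P) \<star> (B \<star> P)"
    using assms by (simp add: adj_mul mul_assoc)
  also have "tr \<dots> = of_real (hs (B \<star> P))" by (rule hs_eq_tr[symmetric])
  finally show ?thesis by (simp add: hs_nonneg)
qed

(* S is the sign of K - L, so the right-hand side is at most the trace norm of the difference of
   the squares. *)
lemma powers_stormer:
  assumes B: "mat B" "adj B = B" and C: "mat C" "adj C = C"
    and K: "K = B \<star> B" and L: "L = C \<star> C"
  obtains S where "unitary S" "hs (K - L) \<le> Re (tr (S \<star> (K \<star> K - L \<star> L)))"
proof -
  define D where "D = K - L"
  have mKL: "mat K" "mat L" "adj K = K" "adj L = L"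
    using B C by (auto simp: K L adj_mul)
  then have mD: "mat D" and aD: "adj D = D" by (auto simp: D_def adj_diff)
  obtain F where "calculus D F"
    by (rule functional_calculus[OF mD aD])
  note F = calculusD[OF this]
  define S where "S = F (\<lambda>x. if x \<ge> 0 then 1 else -1)"
  define P where "P = F (\<lambda>x. sqrt (max x 0))"
  define N where "N = F (\<lambda>x. sqrt (max (- x) 0))"
  have e: "(\<lambda>x::real. (if x \<ge> 0 then 1 else -1) * (if x \<ge> 0 then 1 else -1 :: real)) = (\<lambda>x. 1)"
    by auto
  have uS: "unitary S" using F unfolding unitary_def S_def by (simp add: e)
  \<comment> \<open>\<open>P\<close> and \<open>N\<close> are square roots of the positive and the
    negative part of \<open>D\<close>, so multiplying \<open>D\<close> by its sign \<open>S\<close>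
    on either side gives \<open>|D|\<close>.\<close>
  have SD: "S \<star> D = P \<star> P + N \<star> N" "D \<star> S = P \<star> P + N \<star> N" "D = P \<star> P - N \<star> N"
    unfolding S_def P_def N_def F(6)[symmetric] F(3) F(4) F(5)
    by (intro arg_cong[of _ _ F]; auto simp: max_def fun_eq_iff)+
  have X1: "tr (S \<star> (D \<star> (K + L) + (K + L) \<star> D)) = tr ((S \<star> D) \<star> (K + L)) + tr ((D \<star> S) \<star> (K + L))"
  proof -
    have "tr (S \<star> ((K + L) \<star> D)) = tr (D \<star> (S \<star> (K + L)))"
      by (simp only: mul_assoc[symmetric] tr_mul_commute[of _ D])
    then show ?thesis by (simp only: mul_add_right[of S] tr_add mul_assoc)
  qed
  \<comment> \<open>Symmetrising removes the mixed products \<open>K \<star> L\<close> and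
    \<open>L \<star> K\<close>, which a plain difference of squares would leave behind.\<close>
  have X2: "D \<star> (K + L) + (K + L) \<star> D = (K \<star> K - L \<star> L) + (K \<star> K - L \<star> L)"
    by (simp add: D_def mul_distribs)
  from X1 have "tr (S \<star> (K \<star> K - L \<star> L)) + tr (S \<star> (K \<star> K - L \<star> L))
      = tr ((P \<star> P + N \<star> N) \<star> (K + L)) + tr ((P \<star> P + N \<star> N) \<star> (K + L))"
    unfolding X2 SD(1,2) by (simp only: mul_add_right[of S] tr_add)
  then have 1: "tr (S \<star> (K \<star> K - L \<star> L)) = tr ((P \<star> P + N \<star> N) \<star> (K + L))" by simp
  have "complex_of_real (hs D) = tr (D \<star> D)" by (simp add: hs_eq_tr aD)
  also have "\<dots> = tr ((P \<star> P - N \<star> N) \<star> (K - L))" using SD(3) by (simp add: D_def)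
  \<comment> \<open>The difference of \<open>|D| (K + L)\<close> and \<open>D (K - L)\<close> pairs
    the positive part of \<open>D\<close> with \<open>L\<close> and the negative part with
    \<open>K\<close>; both traces are nonnegative.\<close>
  finally have "tr (S \<star> (K \<star> K - L \<star> L)) - of_real (hs D) = 2 * tr (P \<star> P \<star> L) + 2 * tr (N \<star> N \<star> K)"
    unfolding 1 by (simp add: mul_distribs tr_add tr_diff)
  moreover have "Re (tr (P \<star> P \<star> L)) \<ge> 0" "Re (tr (N \<star> N \<star> K)) \<ge> 0"
    using tr_square_square_nonneg F(2) B C by (auto simp: K L P_def N_def)
  ultimately have "Re (tr (S \<star> (K \<star> K - L \<star> L))) - hs D \<ge> 0"
    by (metis Re_complex_of_real add_nonneg_nonneg minus_complex.simps(1) mult_2 plus_complex.simps(1))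
  with uS show thesis by (intro that[of S]) (simp_all add: D_def)
qed

lemma conj_mul: assumes "unitary g" "mat A"
  shows "(g \<star> A \<star> adj g) \<star> (g \<star> B \<star> adj g) = g \<star> (A \<star> B) \<star> adj g"
proof -
  have "(g \<star> A \<star> adj g) \<star> (g \<star> B \<star> adj g) = g \<star> (A \<star> (adj g \<star> g)) \<star> (B \<star> adj g)"
    by (simp only: mul_assoc)
  also have "\<dots> = g \<star> A \<star> (B \<star> adj g)" using assms by (simp add: unitary_def)
  finally show ?thesis by (simp only: mul_assoc)
qed

(* K = |H|^{1/2}, the noncommutative Mazur map from the trace class to the Hilbert-Schmidt class;
   testing against unitaries computes the trace norm. *)
lemma sqrt_abs_almost_central:
  assumes H: "mat H" "adj H = H"
  obtains K F where "mat K" "adj K = K" "K = H \<star> F" "Re (tr H) \<le> hs K"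
    "\<And>g \<epsilon>. unitary g \<Longrightarrow> \<epsilon> \<ge> 0 \<Longrightarrow> (\<And>V. unitary V \<Longrightarrow> cmod (tr (V \<star> (g \<star> H - H \<star> g))) \<le> \<epsilon> * hs K)
       \<Longrightarrow> hs (g \<star> K - K \<star> g) \<le> (\<epsilon> + sqrt (2 * \<epsilon>)) * hs K"
proof -
  obtain F where "calculus H F"
    by (rule functional_calculus[OF H])
  note F = calculusD[OF this]
  define K where "K = F (\<lambda>x. sqrt \<bar>x\<bar>)"
  define B where "B = F (\<lambda>x. sqrt (sqrt \<bar>x\<bar>))"
  define s where "s = F (\<lambda>x. if x \<ge> 0 then 1 else -1)"
  have mK: "mat K" "adj K = K" and mB: "mat B" "adj B = B" and ms: "mat s" "adj s = s"
    using F by (auto simp: K_def B_def s_def)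
  have KB: "K = B \<star> B" unfolding K_def B_def F(3) by simp
  have ss: "s \<star> s = idm" unfolding s_def F(3) F(7)[symmetric] by (intro arg_cong[of _ _ F]) auto
  then have us: "unitary s" using ms by (simp add: unitary_def)
  have KK: "K \<star> K = s \<star> H" unfolding s_def K_def F(6)[symmetric] F(3)
    by (intro arg_cong[of _ _ F]) auto
  have sKK: "s \<star> (K \<star> K) = H" using H ss by (simp add: KK flip: mul_assoc)
  have hsK: "of_real (hs K) = tr (s \<star> H)" by (simp add: hs_eq_tr mK KK)
  \<comment> \<open>The quotient is \<open>0\<close> at \<open>x = 0\<close>, where both sides
    vanish. A factor \<open>H\<close> on the left transfers rank bounds from \<open>H\<close> to
    \<open>K\<close>.\<close>
  have KHF: "K = H \<star> F (\<lambda>x. sqrt \<bar>x\<bar> / x)" unfolding K_def F(6)[symmetric] F(3)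
    by (intro arg_cong[of _ _ F]) (auto simp: fun_eq_iff)
  have trH: "Re (tr H) \<le> hs K"
  proof -
    \<comment> \<open>\<open>\<bar>x\<bar> - x\<close> is nonnegative, so
      \<open>s \<star> H - H\<close> is a square and has nonnegative trace.\<close>
    define P where "P = F (\<lambda>x. sqrt (\<bar>x\<bar> - x))"
    have "P \<star> P = s \<star> H - H" unfolding P_def F(6)[symmetric] s_def F(3) F(5)
      by (intro arg_cong[of _ _ F]) (auto simp: fun_eq_iff)
    then have "of_real (hs P) = tr (s \<star> H) - tr H"
      by (simp add: hs_eq_tr P_def F(2) tr_diff)
    then have "of_real (hs P) = complex_of_real (hs K) - tr H" by (simp add: hsK)
    then have "hs P = hs K - Re (tr H)" by (metis Re_complex_of_real minus_complex.simps(1))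
    then show ?thesis using hs_nonneg[of P] by simp
  qed
  have main: "hs (g \<star> K - K \<star> g) \<le> (\<epsilon> + sqrt (2 * \<epsilon>)) * hs K"
    if g: "unitary g" and e: "\<epsilon> \<ge> 0"
      and near: "\<And>V. unitary V \<Longrightarrow> cmod (tr (V \<star> (g \<star> H - H \<star> g))) \<le> \<epsilon> * hs K" for g \<epsilon>
  proof -
    have mg: "mat g" "mat (adj g)" and gg: "g \<star> adj g = idm" "adj g \<star> g = idm"
      using g by (auto simp: unitary_def)
    \<comment> \<open>Conjugation by \<open>g\<close> turns commutators into differences, and the
      conjugated matrices satisfy the same identities. What remains is to compare the positive
      matrices \<open>K\<close> and \<open>K'\<close>.\<close>
    define s' where "s' = g \<star> s \<star> adj g"
    define H' where "H' = g \<star> H \<star> adj g"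
    define K' where "K' = g \<star> K \<star> adj g"
    define B' where "B' = g \<star> B \<star> adj g"
    have m': "mat s'" "mat H'" "mat K'" "mat B'"
      using mg ms H mK mB by (auto simp: s'_def H'_def K'_def B'_def)
    have a': "adj s' = s'" "adj B' = B'" "adj K' = K'"
      using ms mB mK by (simp_all add: s'_def B'_def K'_def adj_mul mul_assoc)
    have K'B': "K' = B' \<star> B'" using conj_mul[OF g mB(1), of B] by (simp add: K'_def B'_def KB)
    have ss': "s' \<star> s' = idm" using conj_mul[OF g ms(1), of s] mg gg by (simp add: s'_def ss)
    have KK': "K' \<star> K' = s' \<star> H'"
      using conj_mul[OF g mK(1), of K] conj_mul[OF g ms(1), of H] by (simp add: K'_def s'_def H'_def KK)
    have sKK': "s' \<star> (K' \<star> K') = H'" using m' ss' by (simp add: KK' flip: mul_assoc)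
    have hsK': "hs K' = hs K"
      using g mK mg by (simp add: K'_def hs_unitary_left hs_unitary_right unitary_adj mat_mul)
    have diffH: "H - H' = - ((g \<star> H - H \<star> g) \<star> adj g)"
    proof -
      have "(g \<star> H - H \<star> g) \<star> adj g = H' - H \<star> (g \<star> adj g)"
        by (simp only: mul_distribs mul_assoc H'_def)
      then show ?thesis using H gg by simp
    qed
    have near': "cmod (tr (V \<star> (H - H'))) \<le> \<epsilon> * hs K" if V: "unitary V" for V
    proof -
      have "tr (V \<star> ((g \<star> H - H \<star> g) \<star> adj g)) = tr ((adj g \<star> V) \<star> (g \<star> H - H \<star> g))"
        by (simp only: mul_assoc[symmetric] tr_mul_commute[of _ "adj g"])
      moreover have "tr (V \<star> (H - H')) = - tr (V \<star> ((g \<star> H - H \<star> g) \<star> adj g))"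
        unfolding diffH by (simp add: tr_def mul_def sum_negf)
      ultimately show ?thesis
        using near[of "adj g \<star> V"] V g by (simp add: unitary_mul unitary_adj)
    qed
    obtain S where S: "unitary S" and PS: "hs (K - K') \<le> Re (tr (S \<star> (K \<star> K - K' \<star> K')))"
      using powers_stormer[OF mB m'(4) a'(2) KB K'B'] by blast
    \<comment> \<open>The squares of \<open>K\<close> and \<open>K'\<close> are
      \<open>s \<star> H\<close> and \<open>s' \<star> H'\<close>, with different signs. Splitting
      off \<open>s \<star> (H - H')\<close> leaves \<open>E \<star> (K' \<star> K')\<close>, where
      \<open>E\<close> measures the mismatch of the signs.\<close>
    define E where "E = s \<star> s' - idm"
    have "E \<star> (K' \<star> K') = s \<star> (s' \<star> (K' \<star> K')) - K' \<star> K'"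
      using m' by (simp add: E_def mul_distribs mul_assoc mat_mul)
    then have E1: "K \<star> K - K' \<star> K' = s \<star> (H - H') + E \<star> (K' \<star> K')"
      by (simp add: KK sKK' mul_distribs)
    \<comment> \<open>The mismatch is small where \<open>K'\<close> is large: \<open>s\<close> and
      \<open>s'\<close> are self-adjoint unitaries, so expanding the square gives
      \<open>2 * Re (tr (s \<star> (H - H')))\<close>.\<close>
    have hsE: "hs (E \<star> K') \<le> 2 * \<epsilon> * hs K"
    proof -
      have X: "of_real (hs (E \<star> K')) = tr (K' \<star> (adj E \<star> (E \<star> K')))"
        by (simp only: hs_eq_tr adj_mul a' mul_assoc)
      have aE: "adj E \<star> E = idm + idm - s \<star> s' - s' \<star> s"
      proof -
        have "s' \<star> s \<star> (s \<star> s') = s' \<star> ((s \<star> s) \<star> s')" by (simp only: mul_assoc)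
        then have "s' \<star> s \<star> (s \<star> s') = idm" using ss ss' m' by simp
        then show ?thesis
          using m' ms a' by (simp add: E_def adj_diff adj_mul mul_distribs mat_mul)
      qed
      have "adj E \<star> (E \<star> K') = (adj E \<star> E) \<star> K'" by (simp only: mul_assoc)
      also have "\<dots> = K' + K' - s \<star> s' \<star> K' - s' \<star> s \<star> K'"
        by (simp only: aE mul_distribs idm_mul[OF m'(3)])
      finally have EE: "adj E \<star> (E \<star> K') = K' + K' - s \<star> s' \<star> K' - s' \<star> s \<star> K'" .
      have X2: "of_real (hs (E \<star> K')) = 2 * tr (K' \<star> K') - tr (K' \<star> (s \<star> s' \<star> K')) - tr (K' \<star> (s' \<star> s \<star> K'))"
        unfolding X EE by (simp only: mul_distribs tr_diff tr_add mult_2)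
      have t1: "tr (K' \<star> (s \<star> s' \<star> K')) = tr (s \<star> H')"
      proof -
        have "tr (K' \<star> (s \<star> s' \<star> K')) = tr (s \<star> (s' \<star> (K' \<star> K')))"
          by (subst tr_mul_commute) (simp only: mul_assoc)
        then show ?thesis by (simp add: sKK')
      qed
      have "adj (K' \<star> (s \<star> s' \<star> K')) = K' \<star> (s' \<star> s \<star> K')"
        using ms a' by (simp add: adj_mul mul_assoc)
      then have t2: "tr (K' \<star> (s' \<star> s \<star> K')) = cnj (tr (s \<star> H'))"
        using tr_adj[of "K' \<star> (s \<star> s' \<star> K')"] t1 by simp
      have t3: "tr (K' \<star> K') = of_real (hs K)" using hs_eq_tr[of K'] by (simp add: a' hsK')
      have hr: "hs (E \<star> K') = 2 * hs K - 2 * Re (tr (s \<star> H'))"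
        using arg_cong[OF X2[unfolded t1 t2 t3], of Re] by simp
      have "tr (s \<star> (H - H')) = of_real (hs K) - tr (s \<star> H')"
        by (simp add: mul_distribs tr_diff hsK)
      then have "hs K - Re (tr (s \<star> H')) = Re (tr (s \<star> (H - H')))" by simp
      also have "\<dots> \<le> \<epsilon> * hs K" using near'[OF us] complex_Re_le_cmod order_trans by blast
      finally show ?thesis using hr by simp
    qed
    have "tr (S \<star> (K \<star> K - K' \<star> K')) = tr ((S \<star> s) \<star> (H - H')) + tr ((S \<star> (E \<star> K')) \<star> K')"
      by (simp only: E1 mul_add_right tr_add mul_assoc)
    then have "Re (tr (S \<star> (K \<star> K - K' \<star> K')))
        \<le> cmod (tr ((S \<star> s) \<star> (H - H'))) + cmod (tr ((S \<star> (E \<star> K')) \<star> K'))"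
      using complex_Re_le_cmod by (simp add: add_mono)
    also have "cmod (tr ((S \<star> s) \<star> (H - H'))) \<le> \<epsilon> * hs K"
      by (intro near' unitary_mul S us)
    \<comment> \<open>One factor \<open>K'\<close> enters \<open>hsE\<close>, the other is spent on
      Cauchy-Schwarz; this is where the square root of \<open>\<epsilon>\<close> arises.\<close>
    also have "cmod (tr ((S \<star> (E \<star> K')) \<star> K')) \<le> sqrt (hs (S \<star> (E \<star> K'))) * sqrt (hs K')"
      by (rule cmod_tr_mul_le)
    also have "hs (S \<star> (E \<star> K')) = hs (E \<star> K')"
      using m' ms by (intro hs_unitary_left S) (simp add: E_def mat_mul mat_diff)
    also have "sqrt (hs (E \<star> K')) * sqrt (hs K') \<le> sqrt (2 * \<epsilon> * hs K) * sqrt (hs K)"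
      using hsE by (intro mult_mono) (simp_all add: hsK' e hs_nonneg)
    also have "\<dots> = sqrt (2 * \<epsilon>) * hs K"
      using hs_nonneg[of K] by (simp add: real_sqrt_mult)
    finally have "Re (tr (S \<star> (K \<star> K - K' \<star> K'))) \<le> \<epsilon> * hs K + sqrt (2 * \<epsilon>) * hs K"
      by (simp add: fun_diff_def)
    from order_trans[OF PS this] have "hs (K - K') \<le> (\<epsilon> + sqrt (2 * \<epsilon>)) * hs K"
      by (simp only: distrib_right)
    moreover have "hs (g \<star> K - K \<star> g) = hs (K - K')"
    proof -
      have "(K - K') \<star> g = K \<star> g - g \<star> (K \<star> (adj g \<star> g))"
        by (simp only: mul_distribs K'_def mul_assoc)
      also have "\<dots> = - (g \<star> K - K \<star> g)" using mK gg by simp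
      finally have "hs ((K - K') \<star> g) = hs (g \<star> K - K \<star> g)" by (simp add: hs_def norm_minus_commute)
      then show ?thesis using hs_unitary_right[OF g, of "K - K'"] mK m' by (simp add: mat_diff)
    qed
    ultimately show ?thesis by simp
  qed
  show thesis by (rule that[OF mK KHF trH main])
qed

text \<open>Gram-Schmidt, one vector at a time: the component \<open>v\<close> of the new vector
  orthogonal to the range of \<open>Q\<close> is zero or contributes the rank-one projection
  \<open>W\<close>. The trace counts dimensions, so it may stay below \<open>m\<close>.\<close>

lemma range_projection:
  fixes \<xi> :: "nat \<Rightarrow> 'i \<Rightarrow> complex"
  shows "\<exists>Q. mat Q \<and> adj Q = Q \<and> Q \<star> Q = Q \<and> Re (tr Q) \<le> real m \<and>
     (\<forall>i<m. \<forall>s\<in>I. (\<Sum>t\<in>I. Q s t * \<xi> i t) = \<xi> i s)"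
proof (induction m)
  case 0
  show ?case by (rule exI[of _ "\<lambda>s t. 0"]) (simp add: mat_def adj_def mul_def tr_def)
next
  case (Suc m)
  then obtain Q where Q: "mat Q" "adj Q = Q" "Q \<star> Q = Q" "Re (tr Q) \<le> real m"
    "\<And>i s. i < m \<Longrightarrow> s \<in> I \<Longrightarrow> (\<Sum>t\<in>I. Q s t * \<xi> i t) = \<xi> i s" by blast
  define v where "v s = (if s \<in> I then \<xi> m s - (\<Sum>t\<in>I. Q s t * \<xi> m t) else 0)" for s
  have Qv: "(\<Sum>t\<in>I. Q s t * v t) = 0" for s
  proof -
    have "(\<Sum>t\<in>I. Q s t * v t) = (\<Sum>t\<in>I. Q s t * \<xi> m t) - (\<Sum>t\<in>I. \<Sum>u\<in>I. Q s t * Q t u * \<xi> m u)"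
      by (simp add: v_def algebra_simps sum_subtractf sum_distrib_left)
    also have "(\<Sum>t\<in>I. \<Sum>u\<in>I. Q s t * Q t u * \<xi> m u) = (\<Sum>u\<in>I. (Q \<star> Q) s u * \<xi> m u)"
      by (subst sum.swap) (simp add: mul_def sum_distrib_right)
    finally show ?thesis using Q(3) by simp
  qed
  have vQ: "(\<Sum>t\<in>I. cnj (v t) * Q t u) = 0" for u
  proof -
    have "cnj (Q u t) = Q t u" for t using fun_cong[OF fun_cong[OF Q(2)], of t u] unfolding adj_def .
    then have "cnj (\<Sum>t\<in>I. Q u t * v t) = (\<Sum>t\<in>I. cnj (v t) * Q t u)"
      by (simp add: mult.commute)
    then show ?thesis by (simp add: Qv)
  qed
  show ?case
  proof (cases "sqnorm v = 0")
    case True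
    then have "\<forall>s\<in>I. v s = 0" by (simp add: sqnorm_zero_iff)
    then have "(\<Sum>t\<in>I. Q s t * \<xi> m t) = \<xi> m s" if "s \<in> I" for s using that by (auto simp: v_def)
    with Q show ?thesis by (intro exI[of _ Q]) (auto simp: less_Suc_eq)
  next
    case False
    then have pos: "sqnorm v > 0" using sqnorm_nonneg[of v] by linarith
    define c where "c = complex_of_real (1 / sqnorm v)"
    have cn: "cnj c = c" "c * of_real (sqnorm v) = 1" using pos by (simp_all add: c_def flip: of_real_mult)
    define W where "W = (\<lambda>s t. c * v s * cnj (v t))"
    have ip: "(\<Sum>t\<in>I. cnj (v t) * v t) = of_real (sqnorm v)"
      using inner_prod_self[of v] by (simp add: inner_prod_def)
    have mW: "mat W" by (auto simp: mat_def W_def v_def)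
    have aW: "adj W = W" by (simp add: adj_def W_def fun_eq_iff cn mult_ac)
    have WW: "W \<star> W = W"
    proof (intro ext)
      fix s t
      have "(W \<star> W) s t = c * v s * cnj (v t) * (c * (\<Sum>u\<in>I. cnj (v u) * v u))"
        by (simp add: mul_def W_def sum_distrib_left mult_ac)
      then show "(W \<star> W) s t = W s t" by (simp add: ip cn W_def)
    qed
    have QW: "Q \<star> W = (\<lambda>s t. 0)"
    proof (intro ext)
      fix s t
      have "(Q \<star> W) s t = c * cnj (v t) * (\<Sum>u\<in>I. Q s u * v u)"
        by (simp add: mul_def W_def sum_distrib_left mult_ac)
      then show "(Q \<star> W) s t = 0" by (simp add: Qv)
    qed
    have WQ: "W \<star> Q = (\<lambda>s t. 0)"
      using arg_cong[OF QW, of adj] Q(2) aW by (simp add: adj_mul) (simp add: adj_def)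
    have trW: "tr W = 1" using cn ip by (simp add: tr_def W_def mult_ac flip: sum_distrib_left)
    have orth: "(\<Sum>t\<in>I. cnj (v t) * \<xi> i t) = 0" if "i < m" for i
    proof -
      have "(\<Sum>t\<in>I. cnj (v t) * \<xi> i t) = (\<Sum>t\<in>I. \<Sum>u\<in>I. cnj (v t) * Q t u * \<xi> i u)"
        using Q(5)[OF that] by (intro sum.cong refl) (simp add: mult.assoc flip: sum_distrib_left)
      also have "\<dots> = (\<Sum>u\<in>I. (\<Sum>t\<in>I. cnj (v t) * Q t u) * \<xi> i u)"
        by (subst sum.swap) (simp add: sum_distrib_right)
      finally show ?thesis by (simp add: vQ)
    qed
    have vm: "(\<Sum>t\<in>I. cnj (v t) * \<xi> m t) = of_real (sqnorm v)"
    proof -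
      have "(\<Sum>t\<in>I. cnj (v t) * \<xi> m t) = (\<Sum>t\<in>I. cnj (v t) * v t + (\<Sum>u\<in>I. cnj (v t) * Q t u * \<xi> m u))"
      proof (intro sum.cong refl)
        fix t assume "t \<in> I"
        then have *: "\<xi> m t = v t + (\<Sum>u\<in>I. Q t u * \<xi> m u)" by (simp add: v_def)
        show "cnj (v t) * \<xi> m t = cnj (v t) * v t + (\<Sum>u\<in>I. cnj (v t) * Q t u * \<xi> m u)"
          by (subst *) (simp only: distrib_left sum_distrib_left mult.assoc)
      qed
      also have "\<dots> = of_real (sqnorm v) + (\<Sum>t\<in>I. \<Sum>u\<in>I. cnj (v t) * Q t u * \<xi> m u)"
        by (simp add: sum.distrib ip)
      also have "(\<Sum>t\<in>I. \<Sum>u\<in>I. cnj (v t) * Q t u * \<xi> m u) = (\<Sum>u\<in>I. (\<Sum>t\<in>I. cnj (v t) * Q t u) * \<xi> m u)"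
        by (subst sum.swap) (simp add: sum_distrib_right)
      finally show ?thesis by (simp add: vQ)
    qed
    have W\<xi>: "(\<Sum>t\<in>I. W s t * \<xi> i t) = c * v s * (\<Sum>t\<in>I. cnj (v t) * \<xi> i t)" for s i
      by (simp add: W_def sum_distrib_left mult_ac)
    show ?thesis
    proof (intro exI[of _ "Q + W"] conjI allI impI ballI)
      show "mat (Q + W)" using Q(1) mW by blast
      show "adj (Q + W) = Q + W" by (simp add: adj_add Q aW)
      show "(Q + W) \<star> (Q + W) = Q + W"
        by (simp add: mul_distribs Q WW QW WQ) (simp add: fun_eq_iff)
      show "Re (tr (Q + W)) \<le> real (Suc m)" using Q(4) by (simp add: tr_add trW)
      fix i s assume i: "i < Suc m" and s: "s \<in> I"
      have "(\<Sum>t\<in>I. (Q + W) s t * \<xi> i t) = (\<Sum>t\<in>I. Q s t * \<xi> i t) + c * v s * (\<Sum>t\<in>I. cnj (v t) * \<xi> i t)"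
        unfolding W\<xi>[symmetric] by (simp add: distrib_right sum.distrib)
      also have "\<dots> = \<xi> i s"
      proof (cases "i = m")
        case True
        then have "(\<Sum>t\<in>I. Q s t * \<xi> i t) + c * v s * (\<Sum>t\<in>I. cnj (v t) * \<xi> i t)
            = (\<Sum>t\<in>I. Q s t * \<xi> m t) + v s * (c * of_real (sqnorm v))" by (simp add: vm mult_ac)
        also have "\<dots> = \<xi> m s" using s by (simp only: cn(2)) (simp add: v_def)
        finally show ?thesis using True by simp
      next
        case False
        then show ?thesis using i s Q(5) orth by simp
      qed
      finally show "(\<Sum>t\<in>I. (Q + W) s t * \<xi> i t) = \<xi> i s" .
    qed
  qed
qed

text \<open>Rank is measured by a projection \<open>Q\<close> with \<open>Q \<star> K = K\<close>.
  Then \<open>tr K\<close> is the Hilbert-Schmidt inner product of \<open>Q\<close> and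
  \<open>K\<close>, and the squared norm of \<open>Q\<close> is its trace. Nearly scalar matrices
  will violate this bound.\<close>

lemma tr_le_rank_hs:
  fixes \<xi> \<eta> :: "nat \<Rightarrow> 'i \<Rightarrow> complex"
  assumes A: "\<And>s t. s \<in> I \<Longrightarrow> t \<in> I \<Longrightarrow> A s t = (\<Sum>i<m. \<xi> i s * \<eta> i t)" and mA: "mat A"
    and K: "K = A \<star> F"
  shows "(cmod (tr K))\<^sup>2 \<le> real m * hs K"
proof -
  obtain Q where Q: "mat Q" "adj Q = Q" "Q \<star> Q = Q" "Re (tr Q) \<le> real m"
    "\<And>i s. i < m \<Longrightarrow> s \<in> I \<Longrightarrow> (\<Sum>t\<in>I. Q s t * \<xi> i t) = \<xi> i s"
    using range_projection[of m \<xi>] by blast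
  have "Q \<star> A = A"
  proof (intro ext)
    fix s t
    show "(Q \<star> A) s t = A s t"
    proof (cases "s \<in> I \<and> t \<in> I")
      case True
      have "(Q \<star> A) s t = (\<Sum>u\<in>I. \<Sum>i<m. Q s u * \<xi> i u * \<eta> i t)"
        using True by (simp add: mul_def A sum_distrib_left mult.assoc)
      also have "\<dots> = (\<Sum>i<m. (\<Sum>u\<in>I. Q s u * \<xi> i u) * \<eta> i t)"
        by (subst sum.swap) (simp add: sum_distrib_right)
      also have "\<dots> = A s t" using True Q(5) by (simp add: A)
      finally show ?thesis .
    next
      case False
      then show ?thesis using mat_mul[OF Q(1) mA] mA unfolding mat_def by metis
    qed
  qed
  then have QK: "Q \<star> K = K" by (simp add: K flip: mul_assoc)
  have "of_real (hs Q) = tr Q" using Q by (simp add: hs_eq_tr)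
  then have "hs Q \<le> real m" using Q(4) by (metis Re_complex_of_real)
  have "cmod (tr K) \<le> sqrt (hs Q) * sqrt (hs K)" using cmod_tr_mul_le[of Q K] QK by simp
  then have "(cmod (tr K))\<^sup>2 \<le> (sqrt (hs Q) * sqrt (hs K))\<^sup>2" by (rule power_mono) simp
  also have "\<dots> = hs Q * hs K" by (simp add: power_mult_distrib hs_nonneg)
  also have "\<dots> \<le> real m * hs K" using \<open>hs Q \<le> real m\<close> hs_nonneg by (rule mult_right_mono)
  finally show ?thesis .
qed

end

section \<open>A spectral gap for monomial matrices\<close>

definition torus :: "int \<Rightarrow> (int \<times> int) set" where
  "torus m = {-m..m} \<times> {-m..m}"

text \<open>The representative of least absolute value modulo the odd number
  \<open>2 * m + 1\<close>. Symmetric representatives allow points to be compared by sign and size,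
  as the sector argument requires.\<close>

definition red :: "int \<Rightarrow> int \<Rightarrow> int" where
  "red m x = (x + m) mod (2 * m + 1) - m"

definition chr :: "int \<Rightarrow> int \<Rightarrow> complex" where
  "chr m k = cis (2 * pi * of_int k / of_int (2 * m + 1))"

definition shear1 :: "int \<Rightarrow> int \<times> int \<Rightarrow> int \<times> int" where
  "shear1 m a = (red m (fst a + snd a), snd a)"

definition shear2 :: "int \<Rightarrow> int \<times> int \<Rightarrow> int \<times> int" where
  "shear2 m a = (fst a, red m (fst a + snd a))"

definition step1 :: "int \<Rightarrow> int \<times> int \<Rightarrow> int \<times> int" where
  "step1 m a = (red m (fst a + 1), snd a)"

definition step2 :: "int \<Rightarrow> int \<times> int \<Rightarrow> int \<times> int" where
  "step2 m a = (fst a, red m (snd a + 1))"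

lemma finite_torus [simp]: "finite (torus m)"
  by (simp add: torus_def)

lemma card_torus: "m \<ge> 0 \<Longrightarrow> card (torus m) = (nat (2 * m + 1))\<^sup>2"
  by (simp add: torus_def card_cartesian_product power2_eq_square)

lemma red_range: "m \<ge> 0 \<Longrightarrow> red m x \<in> {-m..m}"
  using pos_mod_bound[of "2 * m + 1" "x + m"] pos_mod_sign[of "2 * m + 1" "x + m"]
  by (auto simp: red_def)

lemma red_id: "x \<in> {-m..m} \<Longrightarrow> red m x = x"
  by (simp add: red_def)

lemma red_eq: obtains k where "red m x = x + k * (2 * m + 1)"
proof
  show "red m x = x + (- ((x + m) div (2 * m + 1))) * (2 * m + 1)"
    using div_mult_mod_eq[of "x + m" "2 * m + 1"] unfolding red_def by (simp add: algebra_simps)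
qed

lemma red_cong: "red m (x + k * (2 * m + 1)) = red m x"
proof -
  have "x + k * (2 * m + 1) + m = (x + m) + k * (2 * m + 1)" by simp
  then show ?thesis unfolding red_def by (simp only: mod_mult_self1)
qed

lemma red_add_red: "red m (red m x + y) = red m (x + y)"
proof -
  obtain k where "red m x = x + k * (2 * m + 1)" by (rule red_eq)
  then have "red m x + y = (x + y) + k * (2 * m + 1)" by simp
  then show ?thesis by (simp only: red_cong)
qed

lemma bij_red_add:
  assumes "m \<ge> 0" shows "bij_betw (\<lambda>x. red m (x + c)) {-m..m} {-m..m}"
proof (rule bij_betw_byWitness[where f' = "\<lambda>x. red m (x + (- c))"])
  show "\<forall>a\<in>{-m..m}. red m (red m (a + c) + - c) = a"
    by (simp only: red_add_red) (simp add: red_id)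
  show "\<forall>a\<in>{-m..m}. red m (red m (a + - c) + c) = a"
    by (simp only: red_add_red) (simp add: red_id)
qed (use red_range[OF assms] in auto)

lemma bij_shear1: assumes "m \<ge> 0" shows "bij_betw (shear1 m) (torus m) (torus m)"
proof (rule bij_betw_byWitness[where f' = "\<lambda>a. (red m (fst a + (- snd a)), snd a)"])
  show "\<forall>a\<in>torus m. (red m (fst (shear1 m a) + - snd (shear1 m a)), snd (shear1 m a)) = a"
    unfolding shear1_def fst_conv snd_conv by (simp only: red_add_red) (auto simp: red_id torus_def)
  show "\<forall>a\<in>torus m. shear1 m (red m (fst a + - snd a), snd a) = a"
    unfolding shear1_def fst_conv snd_conv by (simp only: red_add_red) (auto simp: red_id torus_def)
qed (use red_range[OF assms] in \<open>auto simp: shear1_def torus_def\<close>)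

lemma bij_shear2: assumes "m \<ge> 0" shows "bij_betw (shear2 m) (torus m) (torus m)"
proof -
  have s: "bij_betw prod.swap (torus m) (torus m)"
    by (rule bij_betw_byWitness[where f' = prod.swap]) (auto simp: torus_def)
  have "shear2 m = prod.swap \<circ> shear1 m \<circ> prod.swap"
    by (auto simp: fun_eq_iff shear1_def shear2_def add.commute)
  then show ?thesis using s bij_shear1[OF assms] by (auto intro: bij_betw_trans)
qed

lemma bij_step1: assumes "m \<ge> 0" shows "bij_betw (step1 m) (torus m) (torus m)"
proof -
  have "step1 m = map_prod (\<lambda>x. red m (x + 1)) id" by (auto simp: step1_def fun_eq_iff)
  then show ?thesis unfolding torus_def using bij_red_add[OF assms]
    by (simp only:) (intro bij_betw_map_prod bij_betw_id)
qed

lemma bij_step2: assumes "m \<ge> 0" shows "bij_betw (step2 m) (torus m) (torus m)"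
proof -
  have "step2 m = map_prod id (\<lambda>x. red m (x + 1))" by (auto simp: step2_def fun_eq_iff)
  then show ?thesis unfolding torus_def using bij_red_add[OF assms]
    by (simp only:) (intro bij_betw_map_prod bij_betw_id)
qed

lemma chr_add: "chr m (x + y) = chr m x * chr m y"
  by (simp add: chr_def cis_mult add_divide_distrib algebra_simps)

lemma chr_0 [simp]: "chr m 0 = 1" by (simp add: chr_def)

lemma norm_chr [simp]: "cmod (chr m x) = 1" by (simp add: chr_def)

lemma chr_period: assumes "m \<ge> 0" shows "chr m (x + k * (2 * m + 1)) = chr m x"
proof -
  have "2 * pi * of_int (k * (2 * m + 1)) / of_int (2 * m + 1) = 2 * pi * (of_int k :: real)"
    using assms by (simp add: field_simps)
  then have "chr m (k * (2 * m + 1)) = 1" by (simp only: chr_def) (simp add: cis_multiple_2pi)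
  then show ?thesis by (simp add: chr_add)
qed

lemma chr_red_mult: assumes "m \<ge> 0" shows "chr m (y * red m x) = chr m (y * x)"
proof -
  obtain k where "red m x = x + k * (2 * m + 1)" by (rule red_eq)
  then have "y * red m x = y * x + (y * k) * (2 * m + 1)" by (simp add: algebra_simps)
  then show ?thesis by (simp only: chr_period[OF assms])
qed

lemma chr_red: "m \<ge> 0 \<Longrightarrow> chr m (red m x) = chr m x"
  using chr_red_mult[of m 1 x] by simp

lemma sqrt_chr_diff: "(cmod (chr m x - 1))\<^sup>2 = 2 - 2 * cos (2 * pi * of_int x / of_int (2 * m + 1))"
  unfolding chr_def cmod_power2 by (simp add: power2_eq_square algebra_simps)

text \<open>The hypotheses put the angle between 60 and 180 degrees, so the chord has length at
  least \<open>1\<close>.\<close>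

lemma chr_far_from_one:
  assumes "m \<ge> 1" "\<bar>x\<bar> \<le> m" "2 * \<bar>x\<bar> > m"
  shows "(cmod (chr m x - 1))\<^sup>2 \<ge> 1"
proof -
  let ?t = "2 * pi * of_int \<bar>x\<bar> / of_int (2 * m + 1)"
  have q: "(0::real) < of_int (2 * m + 1)" using assms by simp
  have "of_int (2 * m + 1) \<le> (6 * of_int \<bar>x\<bar> :: real)" using assms by (simp flip: of_int_abs)
  then have "pi * of_int (2 * m + 1) \<le> pi * (6 * of_int \<bar>x\<bar>)" by (intro mult_left_mono) auto
  then have "pi / 3 \<le> ?t" using q by (simp add: field_simps)
  moreover have "(2 * of_int \<bar>x\<bar> :: real) \<le> of_int (2 * m + 1)" using assms by (simp flip: of_int_abs)
  then have "pi * (2 * of_int \<bar>x\<bar>) \<le> pi * of_int (2 * m + 1)" by (intro mult_left_mono) auto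
  then have "?t \<le> pi" using q by (simp add: field_simps)
  ultimately have "cos ?t \<le> cos (pi / 3)" by (intro cos_monotone_0_pi_le) auto
  moreover have "cos ?t = cos (2 * pi * of_int x / of_int (2 * m + 1))"
    by (cases "x \<ge> 0") (simp_all add: abs_if)
  ultimately show ?thesis unfolding sqrt_chr_diff by (simp add: cos_60)
qed

text \<open>The bound \<open>2 * m\<close> admits all differences of two representatives and is
  still below one period.\<close>

lemma chr_eq_1_imp:
  assumes "m \<ge> 0" "\<bar>x\<bar> \<le> 2 * m" "chr m x = 1" shows "x = 0"
proof -
  have "cos (2 * pi * of_int x / of_int (2 * m + 1)) = 1"
    using arg_cong[OF assms(3), of Re] unfolding chr_def cis.sel by simp
  then obtain n :: int where n: "2 * pi * of_int x / of_int (2 * m + 1) = of_int n * 2 * pi"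
    by (auto simp: cos_one_2pi_int)
  then have "(2 * pi) * of_int x = (2 * pi) * (of_int n * of_int (2 * m + 1))"
    using assms(1) by (simp add: field_simps)
  then have "of_int x = (of_int n * of_int (2 * m + 1) :: real)"
    unfolding mult_cancel_left by simp
  then have "x = n * (2 * m + 1)" by (metis of_int_eq_iff of_int_mult)
  then have "\<bar>n\<bar> * (2 * m + 1) \<le> 2 * m" using assms by (simp add: abs_mult)
  moreover have "1 * (2 * m + 1) \<le> \<bar>n\<bar> * (2 * m + 1)" if "n \<noteq> 0"
    using that assms(1) by (intro mult_right_mono) auto
  ultimately have "n = 0" by fastforce
  then show ?thesis using \<open>x = n * (2 * m + 1)\<close> by simp
qed

text \<open>A shift by one permutes the representatives and multiplies the sum by
  \<open>chr m v\<close>, which differs from \<open>1\<close> unless \<open>v = 0\<close>.\<close>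

lemma chr_orthogonal1:
  assumes m: "m \<ge> 0" and v: "\<bar>v\<bar> \<le> 2 * m"
  shows "(\<Sum>b\<in>{-m..m}. chr m (b * v)) = (if v = 0 then of_int (2 * m + 1) else 0)"
proof (cases "v = 0")
  case True
  then show ?thesis using m by simp
next
  case False
  let ?s = "\<Sum>b\<in>{-m..m}. chr m (b * v)"
  have "?s = (\<Sum>b\<in>{-m..m}. chr m (red m (b + 1) * v))"
    by (rule sum.reindex_bij_betw[OF bij_red_add[OF m], symmetric])
  also have "\<dots> = (\<Sum>b\<in>{-m..m}. chr m (b * v) * chr m v)"
    by (intro sum.cong refl) (subst mult.commute, subst chr_red_mult[OF m], simp add: algebra_simps chr_add)
  also have "\<dots> = ?s * chr m v" by (simp add: sum_distrib_right)
  finally have "?s * (chr m v - 1) = 0" by (simp add: algebra_simps)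
  moreover have "chr m v \<noteq> 1" using chr_eq_1_imp[OF m v] False by blast
  ultimately show ?thesis using False by simp
qed

definition dotp :: "int \<times> int \<Rightarrow> int \<times> int \<Rightarrow> int" where
  "dotp a b = fst a * fst b + snd a * snd b"

definition fourier :: "int \<Rightarrow> (int \<times> int \<Rightarrow> complex) \<Rightarrow> int \<times> int \<Rightarrow> complex" where
  "fourier m d b = (\<Sum>t\<in>torus m. chr m (dotp b t) * d t)"

lemma plancherel:
  assumes m: "m \<ge> 0"
  shows "(\<Sum>b\<in>torus m. (cmod (fourier m d b))\<^sup>2) = card (torus m) * (\<Sum>t\<in>torus m. (cmod (d t))\<^sup>2)"
proof -
  let ?L = "torus m"
  have cc: "cnj (chr m x) = chr m (- x)" for x by (simp add: chr_def cis_cnj)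
  have orth: "(\<Sum>b\<in>?L. chr m (dotp b t) * cnj (chr m (dotp b u))) = (if t = u then of_nat (card ?L) else 0)"
    if "t \<in> ?L" "u \<in> ?L" for t u
  proof -
    let ?v = "fst t - fst u" and ?w = "snd t - snd u"
    have vw: "\<bar>?v\<bar> \<le> 2 * m" "\<bar>?w\<bar> \<le> 2 * m" using that by (auto simp: torus_def)
    have "(\<Sum>b\<in>?L. chr m (dotp b t) * cnj (chr m (dotp b u)))
        = (\<Sum>b\<in>?L. chr m (fst b * ?v) * chr m (snd b * ?w))"
      by (intro sum.cong refl) (simp add: cc dotp_def algebra_simps flip: chr_add)
    also have "\<dots> = (\<Sum>x\<in>{-m..m}. chr m (x * ?v)) * (\<Sum>y\<in>{-m..m}. chr m (y * ?w))"
      unfolding torus_def sum_product sum.cartesian_product by (simp add: case_prod_unfold)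
    also have "\<dots> = (if t = u then of_nat (card ?L) else 0)"
      unfolding chr_orthogonal1[OF m vw(1)] chr_orthogonal1[OF m vw(2)] card_torus[OF m]
      using m by (auto simp: prod_eq_iff power2_eq_square)
    finally show ?thesis .
  qed
  have "complex_of_real (\<Sum>b\<in>?L. (cmod (fourier m d b))\<^sup>2) = (\<Sum>b\<in>?L. fourier m d b * cnj (fourier m d b))"
    by (simp only: of_real_sum complex_norm_square)
  also have "\<dots> = (\<Sum>b\<in>?L. \<Sum>t\<in>?L. \<Sum>u\<in>?L. (chr m (dotp b t) * cnj (chr m (dotp b u))) * (d t * cnj (d u)))"
    by (simp add: fourier_def sum_product mult_ac)
  also have "\<dots> = (\<Sum>t\<in>?L. \<Sum>b\<in>?L. \<Sum>u\<in>?L. (chr m (dotp b t) * cnj (chr m (dotp b u))) * (d t * cnj (d u)))"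
    by (rule sum.swap)
  also have "\<dots> = (\<Sum>t\<in>?L. \<Sum>u\<in>?L. (\<Sum>b\<in>?L. chr m (dotp b t) * cnj (chr m (dotp b u))) * (d t * cnj (d u)))"
  proof (rule sum.cong[OF refl])
    fix t
    show "(\<Sum>b\<in>?L. \<Sum>u\<in>?L. (chr m (dotp b t) * cnj (chr m (dotp b u))) * (d t * cnj (d u)))
        = (\<Sum>u\<in>?L. (\<Sum>b\<in>?L. chr m (dotp b t) * cnj (chr m (dotp b u))) * (d t * cnj (d u)))"
      by (subst sum.swap) (simp only: sum_distrib_right)
  qed
  also have "\<dots> = (\<Sum>t\<in>?L. \<Sum>u\<in>?L. if u = t then of_nat (card ?L) * (d t * cnj (d u)) else 0)"
    by (intro sum.cong refl) (simp add: orth)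
  also have "\<dots> = complex_of_real (card ?L * (\<Sum>t\<in>?L. (cmod (d t))\<^sup>2))"
    by (simp add: sum_distrib_left flip: complex_norm_square)
  finally show ?thesis by (simp only: of_real_eq_iff)
qed

text \<open>Moving a set by \<open>\<tau>\<close> changes its mass by at most the \<open>l1\<close>
  distance between \<open>|f|^2\<close> and its translate. Factoring the difference of squares and
  applying Cauchy-Schwarz bounds that distance.\<close>

lemma almost_invariant_mass:
  fixes f :: "'a \<Rightarrow> complex"
  assumes fin: "finite \<Omega>" and bij: "bij_betw \<tau> \<Omega> \<Omega>" and r: "\<rho> \<ge> 0"
    and inv: "(\<Sum>w\<in>\<Omega>. (cmod (f (\<tau> w) - f w))\<^sup>2) \<le> \<rho>\<^sup>2 * (\<Sum>w\<in>\<Omega>. (cmod (f w))\<^sup>2)"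
  shows "\<bar>(\<Sum>w\<in>\<Omega>. if P (\<tau> w) then (cmod (f w))\<^sup>2 else 0) - (\<Sum>w\<in>\<Omega>. if P w then (cmod (f w))\<^sup>2 else 0)\<bar>
     \<le> 2 * \<rho> * (\<Sum>w\<in>\<Omega>. (cmod (f w))\<^sup>2)"
proof -
  let ?W = "\<Sum>w\<in>\<Omega>. (cmod (f w))\<^sup>2"
  have W: "?W \<ge> 0" by (intro sum_nonneg) simp
  have re: "(\<Sum>w\<in>\<Omega>. (cmod (f (\<tau> w)))\<^sup>2) = ?W"
    using sum.reindex_bij_betw[OF bij, of "\<lambda>w. (cmod (f w))\<^sup>2"] .
  have "(\<Sum>w\<in>\<Omega>. if P w then (cmod (f w))\<^sup>2 else 0) = (\<Sum>w\<in>\<Omega>. if P (\<tau> w) then (cmod (f (\<tau> w)))\<^sup>2 else 0)"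
    using sum.reindex_bij_betw[OF bij, of "\<lambda>w. if P w then (cmod (f w))\<^sup>2 else 0"] by simp
  then have "\<bar>(\<Sum>w\<in>\<Omega>. if P (\<tau> w) then (cmod (f w))\<^sup>2 else 0) - (\<Sum>w\<in>\<Omega>. if P w then (cmod (f w))\<^sup>2 else 0)\<bar>
     = \<bar>\<Sum>w\<in>\<Omega>. if P (\<tau> w) then (cmod (f w))\<^sup>2 - (cmod (f (\<tau> w)))\<^sup>2 else 0\<bar>"
    by (simp only: sum_subtractf[symmetric]) (intro arg_cong[of _ _ abs] sum.cong; simp)
  also have "\<dots> \<le> (\<Sum>w\<in>\<Omega>. cmod (f (\<tau> w) - f w) * (cmod (f (\<tau> w)) + cmod (f w)))"
  proof (rule order_trans[OF sum_abs], rule sum_mono)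
    fix w
    have "\<bar>(cmod (f w))\<^sup>2 - (cmod (f (\<tau> w)))\<^sup>2\<bar> = \<bar>cmod (f (\<tau> w)) - cmod (f w)\<bar> * (cmod (f (\<tau> w)) + cmod (f w))"
      by (simp add: power2_eq_square square_diff_square_factored abs_mult abs_minus_commute mult.commute)
    also have "\<dots> \<le> cmod (f (\<tau> w) - f w) * (cmod (f (\<tau> w)) + cmod (f w))"
      by (intro mult_right_mono norm_triangle_ineq3) simp
    finally show "\<bar>if P (\<tau> w) then (cmod (f w))\<^sup>2 - (cmod (f (\<tau> w)))\<^sup>2 else 0\<bar>
        \<le> cmod (f (\<tau> w) - f w) * (cmod (f (\<tau> w)) + cmod (f w))" by auto
  qed
  also have "\<dots> \<le> sqrt (\<Sum>w\<in>\<Omega>. (cmod (f (\<tau> w) - f w))\<^sup>2) * sqrt (\<Sum>w\<in>\<Omega>. (cmod (f (\<tau> w)) + cmod (f w))\<^sup>2)"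
    using L2_set_mult_ineq[of "\<lambda>w. cmod (f (\<tau> w) - f w)" "\<lambda>w. cmod (f (\<tau> w)) + cmod (f w)" \<Omega>]
    by (simp add: L2_set_def)
  also have "\<dots> \<le> sqrt (\<rho>\<^sup>2 * ?W) * sqrt (4 * ?W)"
  proof (intro mult_mono real_sqrt_le_mono inv)
    have "(\<Sum>w\<in>\<Omega>. (cmod (f (\<tau> w)) + cmod (f w))\<^sup>2) \<le> (\<Sum>w\<in>\<Omega>. 2 * (cmod (f (\<tau> w)))\<^sup>2 + 2 * (cmod (f w))\<^sup>2)"
    proof (rule sum_mono)
      fix w
      show "(cmod (f (\<tau> w)) + cmod (f w))\<^sup>2 \<le> 2 * (cmod (f (\<tau> w)))\<^sup>2 + 2 * (cmod (f w))\<^sup>2"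
        using sum_squares_bound[of "cmod (f (\<tau> w))" "cmod (f w)"] by (simp add: power2_sum)
    qed
    also have "\<dots> = 4 * ?W" by (simp add: sum.distrib re flip: sum_distrib_left)
    finally show "(\<Sum>w\<in>\<Omega>. (cmod (f (\<tau> w)) + cmod (f w))\<^sup>2) \<le> 4 * ?W" .
  qed (auto intro!: sum_nonneg simp: W)
  also have "\<dots> = 2 * \<rho> * ?W" using r W by (simp add: real_sqrt_mult)
  finally show ?thesis .
qed

(* On the open sectors {xy > 0} and {xy < 0} of the plane the two shears, respectively their
   inverses, have disjoint images, so an almost invariant mass near the origin sits at the origin. *)
lemma sector_lemma:
  fixes f :: "'a \<Rightarrow> complex" and l :: "'a \<Rightarrow> int \<times> int"
  assumes m: "m \<ge> 1" and fin: "finite \<Omega>" and l: "\<And>w. w \<in> \<Omega> \<Longrightarrow> l w \<in> torus m" and r: "\<rho> \<ge> 0"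
    and b1: "bij_betw \<tau>1 \<Omega> \<Omega>" and b2: "bij_betw \<tau>2 \<Omega> \<Omega>"
    and l1: "\<And>w. w \<in> \<Omega> \<Longrightarrow> l (\<tau>1 w) = shear1 m (l w)"
    and l2: "\<And>w. w \<in> \<Omega> \<Longrightarrow> l (\<tau>2 w) = shear2 m (l w)"
    and i1: "(\<Sum>w\<in>\<Omega>. (cmod (f (\<tau>1 w) - f w))\<^sup>2) \<le> \<rho>\<^sup>2 * (\<Sum>w\<in>\<Omega>. (cmod (f w))\<^sup>2)"
    and i2: "(\<Sum>w\<in>\<Omega>. (cmod (f (\<tau>2 w) - f w))\<^sup>2) \<le> \<rho>\<^sup>2 * (\<Sum>w\<in>\<Omega>. (cmod (f w))\<^sup>2)"
    and c1: "(\<Sum>w\<in>\<Omega>. (cmod (chr m (fst (l w)) - 1))\<^sup>2 * (cmod (f w))\<^sup>2) \<le> \<rho>\<^sup>2 * (\<Sum>w\<in>\<Omega>. (cmod (f w))\<^sup>2)"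
    and c2: "(\<Sum>w\<in>\<Omega>. (cmod (chr m (snd (l w)) - 1))\<^sup>2 * (cmod (f w))\<^sup>2) \<le> \<rho>\<^sup>2 * (\<Sum>w\<in>\<Omega>. (cmod (f w))\<^sup>2)"
  shows "(\<Sum>w\<in>\<Omega>. if l w = (0, 0) then (cmod (f w))\<^sup>2 else 0)
     \<ge> (1 - 20 * \<rho> - 16 * \<rho>\<^sup>2) * (\<Sum>w\<in>\<Omega>. (cmod (f w))\<^sup>2)"
proof -
  define W where "W = (\<Sum>w\<in>\<Omega>. (cmod (f w))\<^sup>2)"
  define M where "M P = (\<Sum>w\<in>\<Omega>. if P (l w) then (cmod (f w))\<^sup>2 else 0)" for P :: "int \<times> int \<Rightarrow> bool"
  have mono: "M P \<le> M Q" if "\<And>a. a \<in> torus m \<Longrightarrow> P a \<Longrightarrow> Q a" for P Q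
    unfolding M_def
  proof (rule sum_mono)
    fix w assume "w \<in> \<Omega>"
    then show "(if P (l w) then (cmod (f w))\<^sup>2 else 0) \<le> (if Q (l w) then (cmod (f w))\<^sup>2 else 0)"
      using that[of "l w"] l[of w] by auto
  qed
  have un: "M P \<le> M Q + M R" if "\<And>a. a \<in> torus m \<Longrightarrow> P a \<Longrightarrow> Q a \<or> R a" for P Q R
    unfolding M_def sum.distrib[symmetric]
  proof (rule sum_mono)
    fix w assume "w \<in> \<Omega>"
    then show "(if P (l w) then (cmod (f w))\<^sup>2 else 0)
        \<le> (if Q (l w) then (cmod (f w))\<^sup>2 else 0) + (if R (l w) then (cmod (f w))\<^sup>2 else 0)"
      using that[of "l w"] l[of w] by auto
  qed
  have dis: "M Q + M R \<le> M P" if "\<And>a. a \<in> torus m \<Longrightarrow> Q a \<Longrightarrow> P a \<and> \<not> R a"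
    "\<And>a. a \<in> torus m \<Longrightarrow> R a \<Longrightarrow> P a" for P Q R
    unfolding M_def sum.distrib[symmetric]
  proof (rule sum_mono)
    fix w assume "w \<in> \<Omega>"
    then show "(if Q (l w) then (cmod (f w))\<^sup>2 else 0) + (if R (l w) then (cmod (f w))\<^sup>2 else 0)
        \<le> (if P (l w) then (cmod (f w))\<^sup>2 else 0)"
      using that[of "l w"] l[of w] by auto
  qed
  define h where "h = 2 * \<rho> * W"
  have S1: "\<bar>M (\<lambda>a. P (shear1 m a)) - M P\<bar> \<le> h" for P
  proof -
    have "M (\<lambda>a. P (shear1 m a)) = (\<Sum>w\<in>\<Omega>. if P (l (\<tau>1 w)) then (cmod (f w))\<^sup>2 else 0)"
      unfolding M_def by (intro sum.cong) (simp_all add: l1)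
    then show ?thesis using almost_invariant_mass[OF fin b1 r i1, of "\<lambda>w. P (l w)"]
      by (simp add: M_def h_def W_def)
  qed
  have S2: "\<bar>M (\<lambda>a. P (shear2 m a)) - M P\<bar> \<le> h" for P
  proof -
    have "M (\<lambda>a. P (shear2 m a)) = (\<Sum>w\<in>\<Omega>. if P (l (\<tau>2 w)) then (cmod (f w))\<^sup>2 else 0)"
      unfolding M_def by (intro sum.cong) (simp_all add: l2)
    then show ?thesis using almost_invariant_mass[OF fin b2 r i2, of "\<lambda>w. P (l w)"]
      by (simp add: M_def h_def W_def)
  qed
  \<comment> \<open>On small points the shears do not wrap around, so they act as on the integer
    plane. Outside this square a character of \<open>l w\<close> is far from \<open>1\<close>, so
    \<open>c1\<close> and \<open>c2\<close> leave at most the mass \<open>b\<close> there.\<close>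
  define small where "small a \<longleftrightarrow> 2 * \<bar>fst a\<bar> \<le> m \<and> 2 * \<bar>snd a\<bar> \<le> m" for a :: "int \<times> int"
  define b where "b = 2 * \<rho>\<^sup>2 * W"
  have far: "M (\<lambda>a. \<not> small a) \<le> b"
  proof -
    have "M (\<lambda>a. \<not> small a) \<le> (\<Sum>w\<in>\<Omega>. (cmod (chr m (fst (l w)) - 1))\<^sup>2 * (cmod (f w))\<^sup>2
        + (cmod (chr m (snd (l w)) - 1))\<^sup>2 * (cmod (f w))\<^sup>2)"
      unfolding M_def
    proof (rule sum_mono)
      fix w assume "w \<in> \<Omega>"
      then have t: "\<bar>fst (l w)\<bar> \<le> m" "\<bar>snd (l w)\<bar> \<le> m" using l[of w] by (auto simp: torus_def)
      let ?x = "(cmod (chr m (fst (l w)) - 1))\<^sup>2" and ?y = "(cmod (chr m (snd (l w)) - 1))\<^sup>2"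
      have "?x + ?y \<ge> 1" if "\<not> small (l w)"
      proof -
        have "?x \<ge> 1 \<or> ?y \<ge> 1"
          using that chr_far_from_one[OF m t(1)] chr_far_from_one[OF m t(2)] by (auto simp: small_def)
        then show ?thesis by (smt (verit) zero_le_power2)
      qed
      then have "1 * (cmod (f w))\<^sup>2 \<le> (?x + ?y) * (cmod (f w))\<^sup>2" if "\<not> small (l w)"
        using that by (intro mult_right_mono) auto
      then show "(if \<not> small (l w) then (cmod (f w))\<^sup>2 else 0) \<le> ?x * (cmod (f w))\<^sup>2 + ?y * (cmod (f w))\<^sup>2"
        by (auto simp: distrib_right)
    qed
    also have "\<dots> \<le> b" using c1 c2 by (simp add: sum.distrib b_def W_def)
    finally show ?thesis .
  qed
  have rs: "red m (x + y) = x + y" if "2 * \<bar>x\<bar> \<le> m" "2 * \<bar>y\<bar> \<le> m" for x y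
    using that by (intro red_id) auto
  have rs': "x = red m (x + y) - y"
    if "2 * \<bar>red m (x + y)\<bar> \<le> m" "2 * \<bar>y\<bar> \<le> m" "\<bar>x\<bar> \<le> m" for x y
  proof -
    have "red m (red m (x + y) + (- y)) = red m x" by (simp only: red_add_red) simp
    also have "red m x = x" using that by (intro red_id) auto
    finally show ?thesis using rs[of "red m (x + y)" "- y"] that by simp
  qed
  let ?pos = "\<lambda>a. fst a * snd a > (0::int)" and ?neg = "\<lambda>a. fst a * snd a < (0::int)"
  let ?A = "\<lambda>a. ?pos a \<and> \<bar>fst a\<bar> > \<bar>snd a\<bar>" and ?B = "\<lambda>a. ?pos a \<and> \<bar>snd a\<bar> > \<bar>fst a\<bar>"
  let ?C = "\<lambda>a. ?neg a \<and> \<bar>fst a\<bar> > \<bar>snd a\<bar>" and ?D = "\<lambda>a. ?neg a \<and> \<bar>snd a\<bar> > \<bar>fst a\<bar>"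
  \<comment> \<open>The first shear maps the positive sector to the region where the first
    coordinate dominates, the second shear to the opposite region. Both lie in the sector and are
    disjoint, so the sector holds nearly twice its own mass.\<close>
  have pA: "M (\<lambda>a. ?pos a \<and> small a) \<le> M (\<lambda>a. ?A (shear1 m a))"
    by (intro mono) (auto simp: small_def shear1_def rs zero_less_mult_iff)
  have pB: "M (\<lambda>a. ?pos a \<and> small a) \<le> M (\<lambda>a. ?B (shear2 m a))"
    by (intro mono) (auto simp: small_def shear2_def rs zero_less_mult_iff)
  have pAB: "M ?A + M ?B \<le> M ?pos" by (rule dis) auto
  have p1: "M ?pos \<le> M (\<lambda>a. ?pos a \<and> small a) + M (\<lambda>a. \<not> small a)" by (rule un) auto
  have n1: "M ?neg \<le> M (\<lambda>a. ?neg a \<and> small a) + M (\<lambda>a. \<not> small a)" by (rule un) auto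
  \<comment> \<open>In the negative sector it is the inverse shears that enlarge a coordinate, so
    the conclusion about \<open>a\<close> is read off from its image.\<close>
  have nC: "M (\<lambda>a. ?neg (shear1 m a) \<and> small (shear1 m a)) \<le> M ?C"
  proof (rule mono)
    fix a assume a: "a \<in> torus m" "?neg (shear1 m a) \<and> small (shear1 m a)"
    let ?x = "red m (fst a + snd a)"
    have "fst a = ?x - snd a" using a by (intro rs') (auto simp: small_def shear1_def torus_def)
    moreover have "?x * snd a < 0" using a by (simp add: shear1_def)
    ultimately show "?C a" by (auto simp: mult_less_0_iff)
  qed
  have nD: "M (\<lambda>a. ?neg (shear2 m a) \<and> small (shear2 m a)) \<le> M ?D"
  proof (rule mono)
    fix a assume a: "a \<in> torus m" "?neg (shear2 m a) \<and> small (shear2 m a)"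
    let ?x = "red m (snd a + fst a)"
    have "snd a = ?x - fst a" using a by (intro rs') (auto simp: small_def shear2_def torus_def add.commute)
    moreover have "?x * fst a < 0" using a by (simp add: shear2_def mult.commute add.commute)
    ultimately show "?D a" by (auto simp: mult_less_0_iff)
  qed
  have nCD: "M ?C + M ?D \<le> M ?neg" by (rule dis) auto
  let ?ax = "\<lambda>a. snd a = (0::int) \<and> fst a \<noteq> (0::int)" and ?ay = "\<lambda>a. fst a = (0::int) \<and> snd a \<noteq> (0::int)"
  \<comment> \<open>A nonzero point of an axis is sent to the diagonal, inside the positive
    sector.\<close>
  have ax: "M ?ax \<le> M (\<lambda>a. ?pos (shear2 m a))"
    by (rule mono) (auto simp: shear2_def red_id torus_def zero_less_mult_iff)
  have ay: "M ?ay \<le> M (\<lambda>a. ?pos (shear1 m a))"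
    by (rule mono) (auto simp: shear1_def red_id torus_def zero_less_mult_iff)
  have "W = M (\<lambda>a. True)" by (simp add: M_def W_def)
  also have "\<dots> \<le> M (\<lambda>a. a = (0,0)) + M (\<lambda>a. a \<noteq> (0,0))" by (rule un) auto
  also have "M (\<lambda>a. a \<noteq> (0,0)) \<le> M (\<lambda>a. ?pos a \<or> ?neg a) + M (\<lambda>a. ?ax a \<or> ?ay a)"
    by (rule un) (auto simp: prod_eq_iff zero_less_mult_iff mult_less_0_iff)
  also have "M (\<lambda>a. ?pos a \<or> ?neg a) \<le> M ?pos + M ?neg" by (rule un) auto
  also have "M (\<lambda>a. ?ax a \<or> ?ay a) \<le> M ?ax + M ?ay" by (rule un) auto
  finally have tot: "W \<le> M (\<lambda>a. a = (0,0)) + (M ?pos + M ?neg + (M ?ax + M ?ay))" by simp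
  have "M (\<lambda>a. ?pos a \<and> small a) \<le> M ?A + h" using pA S1[of ?A] by linarith
  moreover have "M (\<lambda>a. ?pos a \<and> small a) \<le> M ?B + h" using pB S2[of ?B] by linarith
  ultimately have pos: "M ?pos \<le> 2 * h + 2 * b" using pAB p1 far by linarith
  have "M (\<lambda>a. ?neg a \<and> small a) \<le> M ?C + h"
    using nC S1[of "\<lambda>a. ?neg a \<and> small a"] by linarith
  moreover have "M (\<lambda>a. ?neg a \<and> small a) \<le> M ?D + h"
    using nD S2[of "\<lambda>a. ?neg a \<and> small a"] by linarith
  ultimately have neg: "M ?neg \<le> 2 * h + 2 * b" using nCD n1 far by linarith
  have "M ?ax \<le> M ?pos + h" using ax S2[of ?pos] by linarith
  moreover have "M ?ay \<le> M ?pos + h" using ay S1[of ?pos] by linarith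
  \<comment> \<open>Each sector contributes \<open>2 * h + 2 * b\<close>, and each axis one
    \<open>h\<close> more than the positive sector: ten times \<open>h\<close> and eight times
    \<open>b\<close> give the constants 20 and 16.\<close>
  ultimately have "W \<le> M (\<lambda>a. a = (0,0)) + (10 * h + 8 * b)" using tot pos neg by linarith
  then show ?thesis unfolding h_def b_def W_def M_def by (simp add: algebra_simps)
qed

section \<open>The six generators and the Fourier transform\<close>

definition perm :: "int \<Rightarrow> nat \<Rightarrow> int \<times> int \<Rightarrow> int \<times> int" where
  "perm m j = (if j = 2 then step1 m else if j = 3 then step2 m
     else if j = 4 then shear1 m else if j = 5 then shear2 m else id)"

definition phase :: "int \<Rightarrow> nat \<Rightarrow> int \<times> int \<Rightarrow> complex" where
  "phase m j a = (if j = 0 then chr m (fst a) else if j = 1 then chr m (snd a) else 1)"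

lemma bij_perm: "m \<ge> 0 \<Longrightarrow> bij_betw (perm m j) (torus m) (torus m)"
  by (simp add: perm_def bij_step1 bij_step2 bij_shear1 bij_shear2)

lemma norm_phase [simp]: "cmod (phase m j a) = 1"
  by (simp add: phase_def)

text \<open>The two shears are transposes of each other for \<open>dotp\<close>, so the Fourier
  transform exchanges them.\<close>

lemma fourier_shear1:
  assumes m: "m \<ge> 0" shows "fourier m (d \<circ> shear1 m) (shear2 m b) = fourier m d b"
proof -
  have "fourier m (d \<circ> shear1 m) (shear2 m b) = (\<Sum>t\<in>torus m. chr m (dotp b (shear1 m t)) * d (shear1 m t))"
    unfolding fourier_def
  proof (intro sum.cong refl)
    fix t
    have "chr m (dotp (shear2 m b) t) = chr m (fst b * fst t) * chr m (snd t * red m (fst b + snd b))"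
      by (simp add: dotp_def shear2_def mult.commute flip: chr_add)
    also have "\<dots> = chr m (snd b * snd t) * chr m (fst b * red m (fst t + snd t))"
      unfolding chr_red_mult[OF m] by (simp add: algebra_simps flip: chr_add)
    also have "\<dots> = chr m (dotp b (shear1 m t))"
      by (simp add: dotp_def shear1_def add.commute flip: chr_add)
    finally show "chr m (dotp (shear2 m b) t) * (d \<circ> shear1 m) t = chr m (dotp b (shear1 m t)) * d (shear1 m t)"
      by simp
  qed
  also have "\<dots> = fourier m d b"
    unfolding fourier_def by (rule sum.reindex_bij_betw[OF bij_shear1[OF m]])
  finally show ?thesis .
qed

lemma fourier_shear2:
  assumes m: "m \<ge> 0" shows "fourier m (d \<circ> shear2 m) (shear1 m b) = fourier m d b"
proof -
  have "fourier m (d \<circ> shear2 m) (shear1 m b) = (\<Sum>t\<in>torus m. chr m (dotp b (shear2 m t)) * d (shear2 m t))"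
    unfolding fourier_def
  proof (intro sum.cong refl)
    fix t
    have "chr m (dotp (shear1 m b) t) = chr m (snd b * snd t) * chr m (fst t * red m (fst b + snd b))"
      by (simp add: dotp_def shear1_def mult.commute add.commute flip: chr_add)
    also have "\<dots> = chr m (fst b * fst t) * chr m (snd b * red m (fst t + snd t))"
      unfolding chr_red_mult[OF m] by (simp add: algebra_simps flip: chr_add)
    also have "\<dots> = chr m (dotp b (shear2 m t))"
      by (simp add: dotp_def shear2_def add.commute flip: chr_add)
    finally show "chr m (dotp (shear1 m b) t) * (d \<circ> shear2 m) t = chr m (dotp b (shear2 m t)) * d (shear2 m t)"
      by simp
  qed
  also have "\<dots> = fourier m d b"
    unfolding fourier_def by (rule sum.reindex_bij_betw[OF bij_shear2[OF m]])
  finally show ?thesis .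
qed

text \<open>Translations turn into characters of the frequency; almost invariance under them
  localises a transform at small frequencies, which is what \<open>c1\<close> and \<open>c2\<close>
  of \<open>sector_lemma\<close> ask for.\<close>

lemma fourier_step1:
  assumes m: "m \<ge> 0" shows "chr m (fst b) * fourier m (d \<circ> step1 m) b = fourier m d b"
proof -
  have "chr m (fst b) * fourier m (d \<circ> step1 m) b = (\<Sum>t\<in>torus m. chr m (dotp b (step1 m t)) * d (step1 m t))"
    unfolding fourier_def sum_distrib_left
  proof (intro sum.cong refl)
    fix t
    have "chr m (dotp b (step1 m t)) = chr m (snd b * snd t) * chr m (fst b * red m (fst t + 1))"
      by (simp add: dotp_def step1_def add.commute flip: chr_add)
    also have "\<dots> = chr m (fst b) * chr m (dotp b t)"
      unfolding chr_red_mult[OF m] by (simp add: dotp_def algebra_simps flip: chr_add)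
    finally show "chr m (fst b) * (chr m (dotp b t) * (d \<circ> step1 m) t) = chr m (dotp b (step1 m t)) * d (step1 m t)"
      by simp
  qed
  also have "\<dots> = fourier m d b"
    unfolding fourier_def by (rule sum.reindex_bij_betw[OF bij_step1[OF m]])
  finally show ?thesis .
qed

lemma fourier_step2:
  assumes m: "m \<ge> 0" shows "chr m (snd b) * fourier m (d \<circ> step2 m) b = fourier m d b"
proof -
  have "chr m (snd b) * fourier m (d \<circ> step2 m) b = (\<Sum>t\<in>torus m. chr m (dotp b (step2 m t)) * d (step2 m t))"
    unfolding fourier_def sum_distrib_left
  proof (intro sum.cong refl)
    fix t
    have "chr m (dotp b (step2 m t)) = chr m (fst b * fst t) * chr m (snd b * red m (snd t + 1))"
      by (simp add: dotp_def step2_def flip: chr_add)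
    also have "\<dots> = chr m (snd b) * chr m (dotp b t)"
      unfolding chr_red_mult[OF m] by (simp add: dotp_def algebra_simps flip: chr_add)
    finally show "chr m (snd b) * (chr m (dotp b t) * (d \<circ> step2 m) t) = chr m (dotp b (step2 m t)) * d (step2 m t)"
      by simp
  qed
  also have "\<dots> = fourier m d b"
    unfolding fourier_def by (rule sum.reindex_bij_betw[OF bij_step2[OF m]])
  finally show ?thesis .
qed

lemma fourier_diff: "fourier m (\<lambda>t. d t - e t) b = fourier m d b - fourier m e b"
  by (simp add: fourier_def algebra_simps sum_subtractf)

text \<open>The sector lemma is applied to the Fourier transform of \<open>d\<close>, whose value at
  frequency zero is the sum of \<open>d\<close>. Closeness of \<open>d\<close> to a constant is
  expressed as a nearly sharp Cauchy-Schwarz inequality.\<close>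

lemma almost_invariant_function:
  assumes m: "m \<ge> 1" and r: "\<rho> \<ge> 0"
    and inv: "\<And>j. 2 \<le> j \<Longrightarrow> j < 6 \<Longrightarrow> (\<Sum>t\<in>torus m. (cmod (d (perm m j t) - d t))\<^sup>2) \<le> \<rho>\<^sup>2 * (\<Sum>t\<in>torus m. (cmod (d t))\<^sup>2)"
  shows "(cmod (\<Sum>t\<in>torus m. d t))\<^sup>2
     \<ge> (1 - 20 * \<rho> - 16 * \<rho>\<^sup>2) * (card (torus m) * (\<Sum>t\<in>torus m. (cmod (d t))\<^sup>2))"
proof -
  let ?L = "torus m" and ?f = "fourier m d"
  have m0: "m \<ge> 0" using m by simp
  let ?N = "real (card ?L)" and ?D = "\<Sum>t\<in>?L. (cmod (d t))\<^sup>2"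
  have WP: "(\<Sum>b\<in>?L. (cmod (?f b))\<^sup>2) = ?N * ?D" by (rule plancherel[OF m0])
  have pl: "(\<Sum>b\<in>?L. (cmod (fourier m (d \<circ> perm m j) b - ?f b))\<^sup>2) \<le> \<rho>\<^sup>2 * (\<Sum>b\<in>?L. (cmod (?f b))\<^sup>2)"
    if "2 \<le> j" "j < 6" for j
  proof -
    have "(\<Sum>b\<in>?L. (cmod (fourier m (d \<circ> perm m j) b - ?f b))\<^sup>2)
        = ?N * (\<Sum>t\<in>?L. (cmod (d (perm m j t) - d t))\<^sup>2)"
      using plancherel[OF m0, of "\<lambda>t. (d \<circ> perm m j) t - d t"] by (simp only: fourier_diff o_def)
    also have "\<dots> \<le> ?N * (\<rho>\<^sup>2 * ?D)" by (intro mult_left_mono inv that) simp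
    finally show ?thesis unfolding WP by (simp add: mult_ac)
  qed
  have "(1 - 20 * \<rho> - 16 * \<rho>\<^sup>2) * (\<Sum>b\<in>?L. (cmod (?f b))\<^sup>2)
      \<le> (\<Sum>b\<in>?L. if id b = (0, 0) then (cmod (?f b))\<^sup>2 else 0)"
  proof (rule sector_lemma[OF m, where ?\<tau>1.0 = "shear1 m" and ?\<tau>2.0 = "shear2 m"])
    \<comment> \<open>Invariance of the transform under the first shear comes from invariance of
      \<open>d\<close> under the second, generator 5; the reversed direction is absorbed by
      reindexing.\<close>
    have "(\<Sum>b\<in>?L. (cmod (?f (shear1 m b) - ?f b))\<^sup>2) = (\<Sum>b\<in>?L. (cmod (fourier m (d \<circ> shear2 m) (shear1 m b) - ?f (shear1 m b)))\<^sup>2)"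
      by (simp add: fourier_shear2[OF m0] norm_minus_commute)
    also have "\<dots> = (\<Sum>b\<in>?L. (cmod (fourier m (d \<circ> perm m 5) b - ?f b))\<^sup>2)"
      unfolding perm_def using sum.reindex_bij_betw[OF bij_shear1[OF m0], of "\<lambda>b. (cmod (fourier m (d \<circ> shear2 m) b - ?f b))\<^sup>2"]
      by simp
    finally show "(\<Sum>b\<in>?L. (cmod (?f (shear1 m b) - ?f b))\<^sup>2) \<le> \<rho>\<^sup>2 * (\<Sum>b\<in>?L. (cmod (?f b))\<^sup>2)"
      using pl[of 5] by simp
    have "(\<Sum>b\<in>?L. (cmod (?f (shear2 m b) - ?f b))\<^sup>2) = (\<Sum>b\<in>?L. (cmod (fourier m (d \<circ> shear1 m) (shear2 m b) - ?f (shear2 m b)))\<^sup>2)"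
      by (simp add: fourier_shear1[OF m0] norm_minus_commute)
    also have "\<dots> = (\<Sum>b\<in>?L. (cmod (fourier m (d \<circ> perm m 4) b - ?f b))\<^sup>2)"
      unfolding perm_def using sum.reindex_bij_betw[OF bij_shear2[OF m0], of "\<lambda>b. (cmod (fourier m (d \<circ> shear1 m) b - ?f b))\<^sup>2"]
      by simp
    finally show "(\<Sum>b\<in>?L. (cmod (?f (shear2 m b) - ?f b))\<^sup>2) \<le> \<rho>\<^sup>2 * (\<Sum>b\<in>?L. (cmod (?f b))\<^sup>2)"
      using pl[of 4] by simp
    have eq: "(cmod (c - 1))\<^sup>2 * (cmod z)\<^sup>2 = (cmod (y - z))\<^sup>2" if "cmod c = 1" "c * y = z" for c y z
    proof -
      have "y - z = - ((c - 1) * y)" using that by (simp add: algebra_simps)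
      then have "cmod (y - z) = cmod (c - 1) * cmod y" by (simp add: norm_mult)
      moreover have "cmod z = cmod y" using that by (auto simp: norm_mult)
      ultimately show ?thesis by (simp add: power_mult_distrib)
    qed
    show "(\<Sum>b\<in>?L. (cmod (chr m (fst (id b)) - 1))\<^sup>2 * (cmod (?f b))\<^sup>2) \<le> \<rho>\<^sup>2 * (\<Sum>b\<in>?L. (cmod (?f b))\<^sup>2)"
      using pl[of 2] by (simp add: perm_def eq[OF norm_chr fourier_step1[OF m0]])
    show "(\<Sum>b\<in>?L. (cmod (chr m (snd (id b)) - 1))\<^sup>2 * (cmod (?f b))\<^sup>2) \<le> \<rho>\<^sup>2 * (\<Sum>b\<in>?L. (cmod (?f b))\<^sup>2)"
      using pl[of 3] by (simp add: perm_def eq[OF norm_chr fourier_step2[OF m0]])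
  qed (use r m0 in \<open>simp_all add: bij_shear1 bij_shear2\<close>)
  also have "\<dots> = (cmod (?f (0, 0)))\<^sup>2"
    using m by (simp add: torus_def)
  also have "?f (0, 0) = (\<Sum>t\<in>?L. d t)" by (simp add: fourier_def dotp_def)
  finally show ?thesis unfolding WP .
qed

text \<open>Characters and shears, \<open>j = 0, 1, 4, 5\<close>, act on the difference
  \<open>s - t\<close> of a pair and give the first use of the gap; translations and shears,
  \<open>j = 2, 3, 4, 5\<close>, act on the diagonal and give the second. The conclusion expresses
  near-scalarity: a scalar matrix attains \<open>card (torus m)\<close> times its squared
  norm.\<close>

lemma almost_central_matrix:
  fixes K :: "(int \<times> int) \<Rightarrow> (int \<times> int) \<Rightarrow> complex"
  assumes m: "m \<ge> 1"
    and inv: "\<And>j. j < 6 \<Longrightarrow> (\<Sum>s\<in>torus m. \<Sum>t\<in>torus m. (cmod (phase m j s * K (perm m j s) (perm m j t) - K s t * phase m j t))\<^sup>2)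
       \<le> (1 / 100)\<^sup>2 * (\<Sum>s\<in>torus m. \<Sum>t\<in>torus m. (cmod (K s t))\<^sup>2)"
  shows "(cmod (\<Sum>s\<in>torus m. K s s))\<^sup>2 \<ge> card (torus m) * (\<Sum>s\<in>torus m. \<Sum>t\<in>torus m. (cmod (K s t))\<^sup>2) / 2"
proof -
  let ?L = "torus m" and ?W = "\<Sum>s\<in>torus m. \<Sum>t\<in>torus m. (cmod (K s t))\<^sup>2"
  let ?O = "?L \<times> ?L" and ?f = "\<lambda>w. K (fst w) (snd w)"
  let ?D = "\<Sum>s\<in>?L. (cmod (K s s))\<^sup>2"
  have m0: "m \<ge> 0" using m by simp
  have sO: "(\<Sum>s\<in>?L. \<Sum>t\<in>?L. F s t) = (\<Sum>w\<in>?O. F (fst w) (snd w))" for F :: "_ \<Rightarrow> _ \<Rightarrow> real"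
    by (simp add: sum.cartesian_product case_prod_unfold)
  have W0: "?W \<ge> 0" by (intro sum_nonneg) simp
  define l where "l w = (red m (fst (fst w) - fst (snd w)), red m (snd (fst w) - snd (snd w)))"
    for w :: "(int \<times> int) \<times> (int \<times> int)"
  have "(1 - 20 * (1/100) - 16 * (1/100)\<^sup>2) * (\<Sum>w\<in>?O. (cmod (?f w))\<^sup>2)
      \<le> (\<Sum>w\<in>?O. if l w = (0, 0) then (cmod (?f w))\<^sup>2 else 0)"
  proof (rule sector_lemma[OF m, where ?\<tau>1.0 = "map_prod (shear1 m) (shear1 m)" and ?\<tau>2.0 = "map_prod (shear2 m) (shear2 m)"])
    show "finite ?O" by simp
    show "l w \<in> ?L" for w using red_range[OF m0] by (auto simp: l_def torus_def)
    show "bij_betw (map_prod (shear1 m) (shear1 m)) ?O ?O" "bij_betw (map_prod (shear2 m) (shear2 m)) ?O ?O"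
      by (intro bij_betw_map_prod bij_shear1 bij_shear2 m0)+
    have red_lin: "red m (red m (a + b) - red m (c + d)) = red m (red m (a - c) + red m (b - d))" for a b c d
    proof -
      have rd: "red m (x - red m y) = red m (x - y)" for x y
      proof -
        obtain k where "red m y = y + k * (2 * m + 1)" by (rule red_eq)
        then have "x - red m y = (x - y) + (- k) * (2 * m + 1)" by (simp add: algebra_simps)
        then show ?thesis by (simp only: red_cong)
      qed
      have "red m (red m (a + b) - red m (c + d)) = red m (red m (a + b) + (- (c + d)))"
        by (simp only: rd add_uminus_conv_diff)
      also have "\<dots> = red m ((a - c) + (b - d))" by (simp only: red_add_red) (simp add: algebra_simps)
      also have "\<dots> = red m (red m (b - d) + (a - c))" by (simp only: red_add_red) (simp add: algebra_simps)
      also have "\<dots> = red m (red m (a - c) + red m (b - d))"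
        using red_add_red[of m "a - c" "red m (b - d)"] by (simp add: add.commute)
      finally show ?thesis .
    qed
    show "l (map_prod (shear1 m) (shear1 m) w) = shear1 m (l w)" for w
      by (simp add: l_def shear1_def red_lin)
    show "l (map_prod (shear2 m) (shear2 m) w) = shear2 m (l w)" for w
      by (simp add: l_def shear2_def red_lin)
    show "(\<Sum>w\<in>?O. (cmod (?f (map_prod (shear1 m) (shear1 m) w) - ?f w))\<^sup>2) \<le> (1/100)\<^sup>2 * (\<Sum>w\<in>?O. (cmod (?f w))\<^sup>2)"
      using inv[of 4] unfolding sO by (simp add: perm_def phase_def)
    show "(\<Sum>w\<in>?O. (cmod (?f (map_prod (shear2 m) (shear2 m) w) - ?f w))\<^sup>2) \<le> (1/100)\<^sup>2 * (\<Sum>w\<in>?O. (cmod (?f w))\<^sup>2)"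
      using inv[of 5] unfolding sO by (simp add: perm_def phase_def)
    have ch: "(cmod (chr m (red m (x - y)) - 1))\<^sup>2 * (cmod z)\<^sup>2 = (cmod (chr m x * z - z * chr m y))\<^sup>2" for x y z
    proof -
      have "chr m x = chr m (x - y) * chr m y" by (simp flip: chr_add)
      then have "chr m x * z - z * chr m y = (chr m (x - y) - 1) * chr m y * z" by (simp add: algebra_simps)
      then show ?thesis by (simp add: chr_red[OF m0] norm_mult power_mult_distrib)
    qed
    show "(\<Sum>w\<in>?O. (cmod (chr m (fst (l w)) - 1))\<^sup>2 * (cmod (?f w))\<^sup>2) \<le> (1/100)\<^sup>2 * (\<Sum>w\<in>?O. (cmod (?f w))\<^sup>2)"
      using inv[of 0] unfolding sO by (simp add: perm_def phase_def l_def ch)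
    show "(\<Sum>w\<in>?O. (cmod (chr m (snd (l w)) - 1))\<^sup>2 * (cmod (?f w))\<^sup>2) \<le> (1/100)\<^sup>2 * (\<Sum>w\<in>?O. (cmod (?f w))\<^sup>2)"
      using inv[of 1] unfolding sO by (simp add: perm_def phase_def l_def ch)
  qed simp
  also have "(\<Sum>w\<in>?O. if l w = (0, 0) then (cmod (?f w))\<^sup>2 else 0)
      = (\<Sum>s\<in>?L. \<Sum>t\<in>?L. if t = s then (cmod (K s t))\<^sup>2 else 0)"
    unfolding sO
  proof (intro sum.cong refl)
    fix w assume w: "w \<in> ?O"
    have eq: "x = y" if "red m (x - y) = 0" "x \<in> {-m..m}" "y \<in> {-m..m}" for x y
    proof -
      have "red m (red m (x - y) + y) = red m x" by (simp only: red_add_red) simp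
      then show ?thesis using that by (simp add: red_id)
    qed
    have "l w = (0, 0) \<longleftrightarrow> snd w = fst w"
    proof
      assume "l w = (0, 0)"
      then have r: "red m (fst (fst w) - fst (snd w)) = 0" "red m (snd (fst w) - snd (snd w)) = 0"
        by (simp_all add: l_def)
      have "fst (fst w) = fst (snd w)" "snd (fst w) = snd (snd w)"
        using w by (intro eq[OF r(1)] eq[OF r(2)]; force simp: torus_def)+
      then show "snd w = fst w" by (simp add: prod_eq_iff)
    next
      assume "snd w = fst w"
      then show "l w = (0, 0)" using m0 by (simp add: l_def red_id)
    qed
    then show "(if l w = (0, 0) then (cmod (?f w))\<^sup>2 else 0) = (if snd w = fst w then (cmod (?f w))\<^sup>2 else 0)"
      by simp
  qed
  also have "\<dots> = ?D" by simp
  finally have D: "?D \<ge> (79 / 100) * ?W"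
    using W0 unfolding sO[of "\<lambda>s t. (cmod (K s t))\<^sup>2", symmetric] by (simp add: power2_eq_square)
  \<comment> \<open>The diagonal carries at least 79 percent of \<open>?W\<close>, so a defect of
    \<open>?W / 100^2\<close> is less than \<open>1 / 80^2\<close> relative to it. With
    \<open>\<rho> = 1 / 80\<close> the factor is \<open>0.7475\<close>, and
    \<open>0.7475 * 0.79\<close> still exceeds \<open>1 / 2\<close>.\<close>
  have "(1 - 20 * (1/80) - 16 * (1/80)\<^sup>2) * (card ?L * ?D) \<le> (cmod (\<Sum>s\<in>?L. K s s))\<^sup>2"
  proof (rule almost_invariant_function[OF m])
    fix j :: nat assume j: "2 \<le> j" "j < 6"
    have "(\<Sum>t\<in>?L. (cmod (K (perm m j t) (perm m j t) - K t t))\<^sup>2)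
        \<le> (\<Sum>s\<in>?L. \<Sum>t\<in>?L. (cmod (phase m j s * K (perm m j s) (perm m j t) - K s t * phase m j t))\<^sup>2)"
      (is "_ \<le> (\<Sum>s\<in>?L. ?g s)")
    proof (rule sum_mono)
      fix s assume s: "s \<in> ?L"
      have "(cmod (phase m j s * K (perm m j s) (perm m j s) - K s s * phase m j s))\<^sup>2 \<le> ?g s"
        using s by (intro member_le_sum) auto
      then show "(cmod (K (perm m j s) (perm m j s) - K s s))\<^sup>2 \<le> ?g s"
        using j by (simp add: phase_def)
    qed
    also have "\<dots> \<le> (1/100)\<^sup>2 * ?W" using j by (intro inv) simp
    also have "\<dots> \<le> (1/80)\<^sup>2 * ?D" using D W0 by (simp add: power2_eq_square)
    finally show "(\<Sum>t\<in>?L. (cmod (K (perm m j t) (perm m j t) - K t t))\<^sup>2) \<le> (1/80)\<^sup>2 * ?D" .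
  qed simp
  moreover have "card ?L * ?W / 2 \<le> (1 - 20 * (1/80) - 16 * (1/80)\<^sup>2) * (card ?L * ?D)"
  proof -
    have "?W / 2 \<le> (1 - 20 * (1/80) - 16 * (1/80)\<^sup>2) * ?D" using D W0 by (simp add: power2_eq_square)
    then have "card ?L * (?W / 2) \<le> card ?L * ((1 - 20 * (1/80) - 16 * (1/80)\<^sup>2) * ?D)"
      by (intro mult_left_mono) simp_all
    then show ?thesis by (simp add: mult_ac)
  qed
  ultimately show ?thesis by simp
qed

section \<open>Almost central families of low rank\<close>

context finite_index
begin

text \<open>The outer product is factored as \<open>X \<star> Y\<close> through the single index
  \<open>o'\<close>; Cauchy-Schwarz for \<open>tr\<close> then bounds its trace norm by the product
  of the Euclidean norms.\<close>

lemma tr_unitary_rank_one: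
  assumes V: "unitary V"
  shows "cmod (tr (V \<star> (\<lambda>s t. x s * y t))) \<le> sqrt (sqnorm x) * sqrt (sqnorm y)"
proof (cases "I = {}")
  case True
  then show ?thesis unfolding tr_def sqnorm_def by simp
next
  case False
  then obtain o' where o': "o' \<in> I" by blast
  define X where "X = (\<lambda>s t. if s \<in> I \<and> t = o' then x s else 0)"
  define Y where "Y = (\<lambda>s t. if t \<in> I \<and> s = o' then y t else 0)"
  have hX: "hs X = sqnorm x" "hs (adj Y) = sqnorm y"
    using o' fin by (auto simp: hs_def sqnorm_def X_def Y_def adj_def if_distrib[of cmod] if_distrib[of "\<lambda>z. z\<^sup>2"]
        intro!: sum.cong cong: if_cong)
  have mX: "mat X" using o' by (auto simp: mat_def X_def)
  have XY: "(X \<star> Y) s t = x s * y t" if "s \<in> I" "t \<in> I" for s t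
  proof -
    have "(X \<star> Y) s t = (\<Sum>u\<in>I. if u = o' then x s * y t else 0)"
      unfolding mul_def by (intro sum.cong) (use that in \<open>auto simp: X_def Y_def\<close>)
    then show ?thesis using o' fin by simp
  qed
  have "tr (V \<star> (\<lambda>s t. x s * y t)) = tr (V \<star> (X \<star> Y))"
    unfolding tr_mul by (intro sum.cong refl) (simp add: XY)
  also have "\<dots> = tr ((V \<star> X) \<star> Y)" by (simp only: mul_assoc)
  also have "cmod \<dots> \<le> sqrt (hs (V \<star> X)) * sqrt (hs Y)" by (rule cmod_tr_mul_le)
  also have "hs (V \<star> X) = hs X" by (rule hs_unitary_left[OF V mX])
  also have "hs Y = sqnorm y" using hX hs_adj[of Y] by simp
  finally show ?thesis by (simp only: hX)
qed

lemma tr_unitary_sum_rank_one: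
  assumes V: "unitary V" and D: "\<And>s t. s \<in> I \<Longrightarrow> t \<in> I \<Longrightarrow> D s t = (\<Sum>k<(n::nat). x k s * y k t)"
  shows "cmod (tr (V \<star> D)) \<le> (\<Sum>k<n. sqrt (sqnorm (x k)) * sqrt (sqnorm (y k)))"
proof -
  have "tr (V \<star> D) = (\<Sum>s\<in>I. \<Sum>t\<in>I. \<Sum>k<n. V s t * (x k t * y k s))"
    unfolding tr_mul by (intro sum.cong refl) (simp add: D sum_distrib_left)
  also have "\<dots> = (\<Sum>k<n. \<Sum>s\<in>I. \<Sum>t\<in>I. V s t * (x k t * y k s))"
    by (simp only: sum.swap[of _ "{..<n}"])
  also have "\<dots> = (\<Sum>k<n. tr (V \<star> (\<lambda>s t. x k s * y k t)))"
    by (simp add: tr_mul)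
  also have "cmod \<dots> \<le> (\<Sum>k<n. sqrt (sqnorm (x k)) * sqrt (sqnorm (y k)))"
    by (intro sum_norm_le tr_unitary_rank_one V)
  finally show ?thesis .
qed

text \<open>The commutator of \<open>g\<close> with \<open>adj T\<close> is the adjoint of
  \<open>adj g \<star> X \<star> adj g\<close>, so its pairings with unitaries are conjugates of
  pairings of \<open>X\<close> with unitaries. The bound therefore survives averaging
  \<open>T\<close> with its adjoint.\<close>

lemma commutator_hermitian_part:
  assumes g: "unitary g" and T: "mat T" and V: "unitary V"
    and near: "\<And>V. unitary V \<Longrightarrow> cmod (tr (V \<star> (g \<star> T - T \<star> g))) \<le> c"
    and H: "\<And>s t. H s t = (T s t + cnj (T t s)) / 2"
  shows "cmod (tr (V \<star> (g \<star> H - H \<star> g))) \<le> c"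
proof -
  define X where "X = g \<star> T - T \<star> g"
  have gg: "g \<star> adj g = idm" "adj g \<star> g = idm" and mg: "mat g" "mat (adj g)" using g by (auto simp: unitary_def)
  have "H + H = T + adj T" by (auto simp: H adj_def fun_eq_iff)
  then have "tr (V \<star> (g \<star> (H + H) - (H + H) \<star> g)) = tr (V \<star> (g \<star> (T + adj T) - (T + adj T) \<star> g))" by simp
  then have "tr (V \<star> (g \<star> H - H \<star> g)) + tr (V \<star> (g \<star> H - H \<star> g))
      = tr (V \<star> X) + tr (V \<star> (g \<star> adj T - adj T \<star> g))"
    unfolding X_def by (simp only: mul_distribs tr_add tr_diff) (simp add: algebra_simps)
  moreover have "g \<star> adj T - adj T \<star> g = adj (adj g \<star> X \<star> adj g)"
  proof -
    have "adj g \<star> X \<star> adj g = (adj g \<star> g) \<star> (T \<star> adj g) - (adj g \<star> T) \<star> (g \<star> adj g)"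
      by (simp only: X_def mul_distribs mul_assoc)
    also have "\<dots> = T \<star> adj g - adj g \<star> T" using gg T mg by (simp add: mat_mul)
    finally show ?thesis by (simp add: adj_diff adj_mul)
  qed
  then have "tr (V \<star> (g \<star> adj T - adj T \<star> g)) = cnj (tr ((adj g \<star> X \<star> adj g) \<star> adj V))"
    using tr_adj[of "(adj g \<star> X \<star> adj g) \<star> adj V"] by (simp add: adj_mul)
  moreover have "tr ((adj g \<star> X \<star> adj g) \<star> adj V) = tr ((adj g \<star> adj V \<star> adj g) \<star> X)"
  proof -
    have "tr ((adj g \<star> X \<star> adj g) \<star> adj V) = tr ((adj g \<star> X) \<star> (adj g \<star> adj V))" by (simp only: mul_assoc)
    also have "\<dots> = tr ((adj g \<star> adj V) \<star> (adj g \<star> X))" by (rule tr_mul_commute)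
    finally show ?thesis by (simp only: mul_assoc)
  qed
  ultimately have "2 * tr (V \<star> (g \<star> H - H \<star> g)) = tr (V \<star> X) + cnj (tr ((adj g \<star> adj V \<star> adj g) \<star> X))"
    by simp
  then have "2 * cmod (tr (V \<star> (g \<star> H - H \<star> g))) = cmod (tr (V \<star> X) + cnj (tr ((adj g \<star> adj V \<star> adj g) \<star> X)))"
    by (metis norm_mult norm_numeral)
  also have "\<dots> \<le> cmod (tr (V \<star> X)) + cmod (tr ((adj g \<star> adj V \<star> adj g) \<star> X))"
    by (metis norm_triangle_ineq complex_mod_cnj)
  also have "\<dots> \<le> c + c" unfolding X_def
    by (intro add_mono near V unitary_mul unitary_adj g)
  finally show ?thesis by simp
qed

end

section \<open>Monomial matrices on the torus\<close>

definition monomial :: "int \<Rightarrow> nat \<Rightarrow> int \<times> int \<Rightarrow> int \<times> int \<Rightarrow> complex" where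
  "monomial m j s t = (if s \<in> torus m \<and> t = perm m j s then phase m j s else 0)"

interpretation tor: finite_index "torus m" for m
  by standard simp

lemma perm_torus: "m \<ge> 0 \<Longrightarrow> s \<in> torus m \<Longrightarrow> perm m j s \<in> torus m"
  using bij_perm[of m j] by (auto simp: bij_betw_def)

lemma perm_surj:
  assumes "m \<ge> 0" "t \<in> torus m" obtains u where "u \<in> torus m" "t = perm m j u"
proof -
  have "t \<in> perm m j ` torus m" using bij_perm[OF assms(1), of j] assms(2) by (simp add: bij_betw_def)
  then show thesis using that by blast
qed

lemma monomial_mul:
  assumes "m \<ge> 0" "s \<in> torus m"
  shows "tor.mul m (monomial m j) K s t = phase m j s * K (perm m j s) t"
proof -
  have "tor.mul m (monomial m j) K s t = (\<Sum>u\<in>torus m. if u = perm m j s then phase m j s * K u t else 0)"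
    unfolding tor.mul_def by (intro sum.cong) (use assms in \<open>auto simp: monomial_def\<close>)
  then show ?thesis using perm_torus[OF assms] by simp
qed

lemma mul_monomial:
  assumes "m \<ge> 0" "u \<in> torus m"
  shows "tor.mul m K (monomial m j) s (perm m j u) = K s u * phase m j u"
proof -
  have "tor.mul m K (monomial m j) s (perm m j u) = (\<Sum>v\<in>torus m. if v = u then K s v * phase m j v else 0)"
    unfolding tor.mul_def
  proof (intro sum.cong refl)
    fix v assume "v \<in> torus m"
    moreover have "perm m j u = perm m j v \<longleftrightarrow> v = u" if "v \<in> torus m"
      using bij_perm[OF assms(1), of j] assms(2) that by (auto simp: bij_betw_def inj_on_def)
    ultimately show "K s v * monomial m j v (perm m j u) = (if v = u then K s v * phase m j v else 0)"
      by (auto simp: monomial_def)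
  qed
  then show ?thesis using assms by simp
qed

lemma unitary_monomial:
  assumes m: "m \<ge> 0" shows "tor.unitary m (monomial m j)"
proof -
  have mat: "tor.mat m (monomial m j)"
    using perm_torus[OF m] by (auto simp: tor.mat_def monomial_def)
  have ph: "phase m j s * cnj (phase m j s) = 1" for s
    by (simp add: complex_norm_square[symmetric])
  have inj: "perm m j s = perm m j t \<longleftrightarrow> s = t" if "s \<in> torus m" "t \<in> torus m" for s t
    using bij_perm[OF m, of j] that by (auto simp: bij_betw_def inj_on_def)
  have 1: "tor.mul m (monomial m j) (tor.adj (monomial m j)) = tor.idm m"
  proof (intro ext)
    fix s t
    show "tor.mul m (monomial m j) (tor.adj (monomial m j)) s t = tor.idm m s t"
    proof (cases "s \<in> torus m")
      case True
      then show ?thesis using inj[of s t] perm_torus[OF m True]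
        by (auto simp: monomial_mul[OF m] tor.adj_def monomial_def tor.idm_def ph)
    next
      case False
      then show ?thesis by (simp add: tor.mul_def tor.idm_def monomial_def)
    qed
  qed
  have 2: "tor.mul m (tor.adj (monomial m j)) (monomial m j) = tor.idm m"
  proof (intro ext)
    fix s t
    show "tor.mul m (tor.adj (monomial m j)) (monomial m j) s t = tor.idm m s t"
    proof (cases "t \<in> torus m")
      case True
      then obtain u where u: "u \<in> torus m" "t = perm m j u"
        by (rule perm_surj[OF m])
      show ?thesis using u perm_torus[OF m u(1), of j] ph[of u]
        by (auto simp: mul_monomial[OF m] tor.adj_def monomial_def tor.idm_def mult.commute)
    next
      case False
      then show ?thesis using perm_torus[OF m] by (auto simp: tor.mul_def tor.idm_def monomial_def intro!: sum.neutral)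
    qed
  qed
  show ?thesis using mat 1 2 by (simp add: tor.unitary_def)
qed

text \<open>Two bounds for \<open>|tr K|^2\<close> meet: near-scalarity gives at least
  \<open>card (torus m) * hs K / 2\<close>, and the rank gives at most \<open>2 * R * hs K\<close>.
  The commutators may be measured against the trace of \<open>T\<close> because its real part is at
  most \<open>hs K\<close>.\<close>

lemma almost_central_low_rank:
  fixes T :: "int \<times> int \<Rightarrow> int \<times> int \<Rightarrow> complex" and \<xi> \<eta> :: "nat \<Rightarrow> int \<times> int \<Rightarrow> complex"
  assumes m: "m \<ge> 1" and T: "\<And>s t. s \<in> torus m \<Longrightarrow> t \<in> torus m \<Longrightarrow> T s t = (\<Sum>i<R. \<xi> i s * \<eta> i t)"
    and mT: "tor.mat m T" and pos: "Re (tor.tr m T) > 0"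
    and near: "\<And>j V. j < 6 \<Longrightarrow> tor.unitary m V \<Longrightarrow>
      cmod (tor.tr m (tor.mul m V (tor.mul m (monomial m j) T - tor.mul m T (monomial m j)))) \<le> (1 / 10^9) * Re (tor.tr m T)"
  shows "card (torus m) \<le> 4 * R"
proof -
  let ?e = "1 / 10^9 :: real"
  have m0: "m \<ge> 0" using m by simp
  define H where "H = (\<lambda>s t. (T s t + cnj (T t s)) / 2)"
  have mH: "tor.mat m H" using mT by (auto simp: tor.mat_def H_def)
  have aH: "tor.adj H = H" by (simp add: tor.adj_def H_def fun_eq_iff add.commute)
  have trH: "tor.tr m H = of_real (Re (tor.tr m T))"
  proof -
    have "tor.tr m H = (tor.tr m T + cnj (tor.tr m T)) / 2"
      by (simp add: tor.tr_def H_def sum_divide_distrib[symmetric] sum.distrib)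
    also have "\<dots> = of_real (Re (tor.tr m T))" by (simp add: complex_add_cnj)
    finally show ?thesis .
  qed
  obtain K F where K: "tor.mat m K" "tor.adj K = K" and KHF: "K = tor.mul m H F"
    and trK: "Re (tor.tr m H) \<le> tor.hs m K"
    and main: "\<And>g \<epsilon>. tor.unitary m g \<Longrightarrow> \<epsilon> \<ge> 0 \<Longrightarrow>
       (\<And>V. tor.unitary m V \<Longrightarrow> cmod (tor.tr m (tor.mul m V (tor.mul m g H - tor.mul m H g))) \<le> \<epsilon> * tor.hs m K)
       \<Longrightarrow> tor.hs m (tor.mul m g K - tor.mul m K g) \<le> (\<epsilon> + sqrt (2 * \<epsilon>)) * tor.hs m K"
    using tor.sqrt_abs_almost_central[OF mH aH] by metis
  have hK: "tor.hs m K > 0" using trK pos by (simp add: trH)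
  have "(cmod (\<Sum>s\<in>torus m. K s s))\<^sup>2 \<ge> card (torus m) * (\<Sum>s\<in>torus m. \<Sum>t\<in>torus m. (cmod (K s t))\<^sup>2) / 2"
  proof (rule almost_central_matrix[OF m])
    fix j :: nat assume j: "j < 6"
    let ?g = "monomial m j"
    have "tor.hs m (tor.mul m ?g K - tor.mul m K ?g) \<le> (?e + sqrt (2 * ?e)) * tor.hs m K"
    proof (rule main[OF unitary_monomial[OF m0]])
      fix V assume V: "tor.unitary m V"
      have "cmod (tor.tr m (tor.mul m V (tor.mul m ?g H - tor.mul m H ?g))) \<le> ?e * Re (tor.tr m T)"
        by (rule tor.commutator_hermitian_part[OF unitary_monomial[OF m0] mT V near[OF j]]) (simp_all add: H_def)
      also have "\<dots> \<le> ?e * tor.hs m K" using trK by (intro mult_left_mono) (simp_all add: trH)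
      finally show "cmod (tor.tr m (tor.mul m V (tor.mul m ?g H - tor.mul m H ?g))) \<le> ?e * tor.hs m K" .
    qed simp
    also have "\<dots> \<le> (1/100)\<^sup>2 * tor.hs m K"
    proof (rule mult_right_mono)
      have "sqrt (2 * ?e) \<le> 5 / 10^5" by (rule real_le_lsqrt) (simp_all add: power2_eq_square)
      then show "?e + sqrt (2 * ?e) \<le> (1/100)\<^sup>2" by (simp add: power2_eq_square)
    qed (use hK in simp)
    also have "tor.hs m (tor.mul m ?g K - tor.mul m K ?g)
       = (\<Sum>s\<in>torus m. \<Sum>t\<in>torus m. (cmod (phase m j s * K (perm m j s) (perm m j t) - K s t * phase m j t))\<^sup>2)"
      unfolding tor.hs_def
    proof (rule sum.cong[OF refl])
      fix s assume s: "s \<in> torus m"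
      have "(\<Sum>t\<in>torus m. (cmod ((tor.mul m ?g K - tor.mul m K ?g) s t))\<^sup>2)
          = (\<Sum>t\<in>torus m. (cmod ((tor.mul m ?g K - tor.mul m K ?g) s (perm m j t)))\<^sup>2)"
        by (rule sum.reindex_bij_betw[OF bij_perm[OF m0], symmetric])
      also have "\<dots> = (\<Sum>t\<in>torus m. (cmod (phase m j s * K (perm m j s) (perm m j t) - K s t * phase m j t))\<^sup>2)"
        by (intro sum.cong refl) (simp add: monomial_mul[OF m0 s] mul_monomial[OF m0])
      finally show "(\<Sum>t\<in>torus m. (cmod ((tor.mul m ?g K - tor.mul m K ?g) s t))\<^sup>2)
          = (\<Sum>t\<in>torus m. (cmod (phase m j s * K (perm m j s) (perm m j t) - K s t * phase m j t))\<^sup>2)" .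
    qed
    finally show "(\<Sum>s\<in>torus m. \<Sum>t\<in>torus m. (cmod (phase m j s * K (perm m j s) (perm m j t) - K s t * phase m j t))\<^sup>2)
      \<le> (1 / 100)\<^sup>2 * (\<Sum>s\<in>torus m. \<Sum>t\<in>torus m. (cmod (K s t))\<^sup>2)" by (simp only: tor.hs_def)
  qed
  then have lo: "card (torus m) * tor.hs m K / 2 \<le> (cmod (tor.tr m K))\<^sup>2"
    by (simp only: tor.hs_def tor.tr_def)
  \<comment> \<open>The first \<open>R\<close> terms represent one half of \<open>T\<close>, the
    remaining \<open>R\<close> one half of its adjoint.\<close>
  define \<xi>' where "\<xi>' i = (\<lambda>s. if i < R then \<xi> i s / 2 else cnj (\<eta> (i - R) s) / 2)" for i
  define \<eta>' where "\<eta>' i = (\<lambda>s. if i < R then \<eta> i s else cnj (\<xi> (i - R) s))" for i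
  have "H s t = (\<Sum>i<R + R. \<xi>' i s * \<eta>' i t)" if "s \<in> torus m" "t \<in> torus m" for s t
  proof -
    have "(\<Sum>i<R + R. \<xi>' i s * \<eta>' i t) = (\<Sum>i<R. \<xi>' i s * \<eta>' i t) + (\<Sum>i<R. \<xi>' (R + i) s * \<eta>' (R + i) t)"
      by (simp add: sum.nat_group[symmetric] lessThan_atLeast0 sum.atLeastLessThan_concat[of 0 R "R+R", symmetric]
          sum.shift_bounds_nat_ivl[of _ 0 R R, simplified] add.commute)
    then show ?thesis using that
      by (simp add: H_def T \<xi>'_def \<eta>'_def add_divide_distrib sum_divide_distrib mult.commute)
  qed
  then have "(cmod (tor.tr m K))\<^sup>2 \<le> real (R + R) * tor.hs m K"
    by (rule tor.tr_le_rank_hs[OF _ mH KHF])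
  with lo have "card (torus m) * tor.hs m K / 2 \<le> real (R + R) * tor.hs m K" by linarith
  then have "real (card (torus m)) * tor.hs m K \<le> real (4 * R) * tor.hs m K" by simp
  then show ?thesis using hK by simp
qed

text \<open>Pigeonhole over \<open>r\<close>: if no \<open>T r\<close> were almost central relative
  to its trace, summation would contradict \<open>big\<close> and \<open>small\<close>, since six
  times \<open>1 / 10^11\<close> is less than half of \<open>1 / 10^9\<close>.\<close>

lemma no_low_rank_almost_central_family:
  fixes T :: "nat \<Rightarrow> int \<times> int \<Rightarrow> int \<times> int \<Rightarrow> complex" and n :: "nat \<Rightarrow> nat"
    and x y :: "nat \<Rightarrow> nat \<Rightarrow> nat \<Rightarrow> int \<times> int \<Rightarrow> complex"
  assumes m: "m \<ge> 1" and R: "card (torus m) > 4 * R" and J: "finite J"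
    and T: "\<And>r s t. T r s t = (\<Sum>i<R. \<xi> i r s * \<eta> i r t)"
    and big: "(\<Sum>r\<in>J. Re (\<Sum>s\<in>torus m. T r s s)) \<ge> card (torus m) / 2"
    and comm: "\<And>j r s t. j < 6 \<Longrightarrow> r \<in> J \<Longrightarrow> s \<in> torus m \<Longrightarrow> t \<in> torus m \<Longrightarrow>
       phase m j s * T r (perm m j s) (perm m j t) - T r s t * phase m j t = (\<Sum>k<n j. x j k r s * y j k r (perm m j t))"
    and small: "\<And>j. j < 6 \<Longrightarrow> (\<Sum>r\<in>J. \<Sum>k<n j. sqrt (\<Sum>s\<in>torus m. (cmod (x j k r s))\<^sup>2) * sqrt (\<Sum>s\<in>torus m. (cmod (y j k r s))\<^sup>2))
       \<le> (1 / 10^11) * card (torus m)"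
  shows False
proof -
  let ?L = "torus m"
  have m0: "m \<ge> 0" using m by simp
  have N: "card ?L > 0" using R by simp
  define f where "f j r = (\<Sum>k<n j. sqrt (\<Sum>s\<in>?L. (cmod (x j k r s))\<^sup>2) * sqrt (\<Sum>s\<in>?L. (cmod (y j k r s))\<^sup>2))" for j r
  have f0: "f j r \<ge> 0" for j r unfolding f_def by (intro sum_nonneg mult_nonneg_nonneg real_sqrt_ge_zero) auto
  have "\<exists>r\<in>J. (\<Sum>j<6. f j r) < (1 / 10^9) * Re (\<Sum>s\<in>?L. T r s s)"
  proof (rule ccontr)
    assume "\<not> ?thesis"
    then have "(\<Sum>r\<in>J. (1 / 10^9) * Re (\<Sum>s\<in>?L. T r s s)) \<le> (\<Sum>r\<in>J. \<Sum>j<6. f j r)"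
      by (intro sum_mono) (simp add: not_less)
    also have "\<dots> = (\<Sum>j<6. \<Sum>r\<in>J. f j r)" by (rule sum.swap)
    also have "\<dots> \<le> (\<Sum>j<6::nat. (1 / 10^11) * real (card ?L))"
      using small by (intro sum_mono) (simp add: f_def)
    also have "\<dots> = 6 / 10^11 * card ?L" by simp
    finally have "(1 / 10^9) * (\<Sum>r\<in>J. Re (\<Sum>s\<in>?L. T r s s)) \<le> 6 / 10^11 * card ?L"
      by (simp only: sum_distrib_left)
    with big N show False by simp
  qed
  then obtain r where r: "r \<in> J" and lt: "(\<Sum>j<6. f j r) < (1 / 10^9) * Re (\<Sum>s\<in>?L. T r s s)" by blast
  define T' where "T' = (\<lambda>s t. if s \<in> ?L \<and> t \<in> ?L then T r s t else 0)"
  have trT: "tor.tr m T' = (\<Sum>s\<in>?L. T r s s)" by (simp add: tor.tr_def T'_def)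
  have fj: "f j r \<le> (1 / 10^9) * Re (tor.tr m T')" if "j < 6" for j
  proof -
    have "f j r \<le> (\<Sum>j<6. f j r)" using that f0 by (intro member_le_sum) auto
    then show ?thesis using lt by (simp add: trT)
  qed
  have "card ?L \<le> 4 * R"
  proof (rule almost_central_low_rank[OF m])
    show "T' s t = (\<Sum>i<R. \<xi> i r s * \<eta> i r t)" if "s \<in> ?L" "t \<in> ?L" for s t using that by (simp add: T'_def T)
    show "tor.mat m T'" by (auto simp: tor.mat_def T'_def)
    have "(\<Sum>j<6. f j r) \<ge> 0" using f0 by (intro sum_nonneg) auto
    then show "Re (tor.tr m T') > 0" using lt by (simp add: trT)
    fix j V assume j: "j < (6::nat)" and V: "tor.unitary m V"
    have "cmod (tor.tr m (tor.mul m V (tor.mul m (monomial m j) T' - tor.mul m T' (monomial m j)))) \<le> f j r"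
      unfolding f_def tor.sqnorm_def[symmetric]
    proof (rule tor.tr_unitary_sum_rank_one[OF V])
      fix s t assume s: "s \<in> ?L" and "t \<in> ?L"
      then obtain u where u: "u \<in> ?L" "t = perm m j u"
        by (blast intro: perm_surj[OF m0])
      show "(tor.mul m (monomial m j) T' - tor.mul m T' (monomial m j)) s t = (\<Sum>k<n j. x j k r s * y j k r t)"
        using comm[OF j r s u(1)] s u perm_torus[OF m0, of _ j]
        by (simp add: monomial_mul[OF m0 s] mul_monomial[OF m0 u(1)] T'_def)
    qed
    then show "cmod (tor.tr m (tor.mul m V (tor.mul m (monomial m j) T' - tor.mul m T' (monomial m j))))
        \<le> (1 / 10^9) * Re (tor.tr m T')" using fj[OF j] by linarith
  qed
  with R show False by simp
qed

section \<open>Khinchine's inequality and tensor products\<close>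

text \<open>Rademacher signs: \<open>Pow L\<close> is the probability space, and expectations are
  sums over it divided by \<open>2 ^ card L\<close>.\<close>

definition sign :: "'a set \<Rightarrow> 'a \<Rightarrow> complex" where
  "sign S s = (if s \<in> S then 1 else -1)"

lemma norm_sign [simp]: "cmod (sign S s) = 1"
  by (simp add: sign_def)

lemma sum_Pow_insert:
  assumes "finite L" "a \<notin> L"
  shows "(\<Sum>S\<in>Pow (insert a L). F S) = (\<Sum>S\<in>Pow L. F S + F (insert a S) :: real)"
proof -
  have "(\<Sum>S\<in>Pow (insert a L). F S) = (\<Sum>S\<in>Pow L. F S) + (\<Sum>S\<in>insert a ` Pow L. F S)"
    unfolding Pow_insert using assms by (intro sum.union_disjoint) auto
  also have "(\<Sum>S\<in>insert a ` Pow L. F S) = (\<Sum>S\<in>Pow L. F (insert a S))"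
    using assms by (subst sum.reindex) (auto simp: inj_on_def)
  finally show ?thesis by (simp add: sum.distrib)
qed

lemma sign_sum_insert:
  assumes "finite L" "a \<notin> L" "S \<subseteq> L"
  shows "(\<Sum>s\<in>insert a L. sign S s * c s) = (\<Sum>s\<in>L. sign S s * c s) - c a"
    and "(\<Sum>s\<in>insert a L. sign (insert a S) s * c s) = (\<Sum>s\<in>L. sign S s * c s) + c a"
proof -
  have "(\<Sum>s\<in>L. sign (insert a S) s * c s) = (\<Sum>s\<in>L. sign S s * c s)"
    using assms by (intro sum.cong) (auto simp: sign_def)
  then show "(\<Sum>s\<in>insert a L. sign (insert a S) s * c s) = (\<Sum>s\<in>L. sign S s * c s) + c a"
    using assms by (simp add: sign_def)
  show "(\<Sum>s\<in>insert a L. sign S s * c s) = (\<Sum>s\<in>L. sign S s * c s) - c a"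
    using assms by (auto simp: sign_def)
qed

lemma parallelogram_2: "(cmod (z - c))\<^sup>2 + (cmod (z + c))\<^sup>2 = 2 * ((cmod z)\<^sup>2 + (cmod c)\<^sup>2)"
  by (simp add: cmod_power2) (simp add: power2_eq_square algebra_simps)

text \<open>The squared moduli are \<open>p - q\<close> and \<open>p + q\<close>, so terms odd in
  \<open>q\<close> cancel, and \<open>q\<close> is bounded by Cauchy-Schwarz. This is the induction
  step for the fourth moment.\<close>

lemma parallelogram_4:
  "(cmod (z - c))^4 + (cmod (z + c))^4 \<le> 2 * ((cmod z)^4 + 6 * (cmod z)\<^sup>2 * (cmod c)\<^sup>2 + (cmod c)^4)"
proof -
  define p where "p = (cmod z)\<^sup>2 + (cmod c)\<^sup>2"
  define q where "q = 2 * (Re z * Re c + Im z * Im c)"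
  have a: "(cmod (z - c))\<^sup>2 = p - q" "(cmod (z + c))\<^sup>2 = p + q"
    unfolding p_def q_def cmod_power2 by (simp_all add: power2_eq_square algebra_simps)
  have "\<bar>q\<bar> \<le> 2 * (cmod z * cmod c)"
    using abs_Re_le_cmod[of "z * cnj c"] by (simp add: q_def norm_mult)
  then have "q\<^sup>2 \<le> (2 * (cmod z * cmod c))\<^sup>2"
    by (metis abs_ge_zero power2_abs power_mono)
  then have q: "q\<^sup>2 \<le> 4 * (cmod z)\<^sup>2 * (cmod c)\<^sup>2" by (simp add: power_mult_distrib)
  have "(cmod w)^4 = ((cmod w)\<^sup>2)\<^sup>2" for w by (simp flip: power_mult)
  then have "(cmod (z - c))^4 + (cmod (z + c))^4 = 2 * (p\<^sup>2 + q\<^sup>2)"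
    by (simp only: a) (simp add: power2_eq_square algebra_simps)
  also have "\<dots> \<le> 2 * (p\<^sup>2 + 4 * (cmod z)\<^sup>2 * (cmod c)\<^sup>2)" using q by (simp add: mult_ac)
  also have "\<dots> = 2 * ((cmod z)^4 + 6 * (cmod z)\<^sup>2 * (cmod c)\<^sup>2 + (cmod c)^4)"
    unfolding p_def by (simp add: power2_eq_square power4_eq_xxxx algebra_simps)
  finally show ?thesis .
qed

lemma sign_second_moment:
  assumes "finite L"
  shows "(\<Sum>S\<in>Pow L. (cmod (\<Sum>s\<in>L. sign S s * c s))\<^sup>2) = 2 ^ card L * (\<Sum>s\<in>L. (cmod (c s))\<^sup>2)"
  using assms
proof induction
  case empty
  then show ?case by simp
next
  case (insert a L)
  have "(\<Sum>S\<in>Pow (insert a L). (cmod (\<Sum>s\<in>insert a L. sign S s * c s))\<^sup>2)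
      = (\<Sum>S\<in>Pow L. 2 * ((cmod (\<Sum>s\<in>L. sign S s * c s))\<^sup>2 + (cmod (c a))\<^sup>2))"
    unfolding sum_Pow_insert[OF insert.hyps]
  proof (rule sum.cong[OF refl])
    fix S assume "S \<in> Pow L"
    then show "(cmod (\<Sum>s\<in>insert a L. sign S s * c s))\<^sup>2 + (cmod (\<Sum>s\<in>insert a L. sign (insert a S) s * c s))\<^sup>2
        = 2 * ((cmod (\<Sum>s\<in>L. sign S s * c s))\<^sup>2 + (cmod (c a))\<^sup>2)"
      by (simp only: sign_sum_insert[OF insert.hyps] Pow_iff parallelogram_2)
  qed
  also have "\<dots> = 2 * (2 ^ card L * (\<Sum>s\<in>L. (cmod (c s))\<^sup>2) + 2 ^ card L * (cmod (c a))\<^sup>2)"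
    using insert by (simp add: sum.distrib card_Pow flip: sum_distrib_left)
  finally show ?case using insert by (simp add: algebra_simps)
qed

text \<open>The factor 3, the fourth moment of a standard real Gaussian, reproduces itself under
  induction: the cross term \<open>6 * u * k\<close> is exactly that of
  \<open>3 * (u + k)^2\<close>.\<close>

lemma sign_fourth_moment:
  assumes "finite L"
  shows "(\<Sum>S\<in>Pow L. (cmod (\<Sum>s\<in>L. sign S s * c s))^4) \<le> 2 ^ card L * (3 * (\<Sum>s\<in>L. (cmod (c s))\<^sup>2)\<^sup>2)"
  using assms
proof induction
  case empty
  then show ?case by simp
next
  case (insert a L)
  let ?X = "\<lambda>S. \<Sum>s\<in>L. sign S s * c s" and ?u = "\<Sum>s\<in>L. (cmod (c s))\<^sup>2" and ?k = "(cmod (c a))\<^sup>2"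
  have "(\<Sum>S\<in>Pow (insert a L). (cmod (\<Sum>s\<in>insert a L. sign S s * c s))^4)
      \<le> (\<Sum>S\<in>Pow L. 2 * ((cmod (?X S))^4 + 6 * (cmod (?X S))\<^sup>2 * ?k + (cmod (c a))^4))"
    unfolding sum_Pow_insert[OF insert.hyps]
  proof (rule sum_mono)
    fix S assume "S \<in> Pow L"
    then show "(cmod (\<Sum>s\<in>insert a L. sign S s * c s))^4 + (cmod (\<Sum>s\<in>insert a L. sign (insert a S) s * c s))^4
        \<le> 2 * ((cmod (?X S))^4 + 6 * (cmod (?X S))\<^sup>2 * ?k + (cmod (c a))^4)"
      by (simp only: sign_sum_insert[OF insert.hyps] Pow_iff parallelogram_4)
  qed
  also have "\<dots> = 2 * (\<Sum>S\<in>Pow L. (cmod (?X S))^4) + 12 * ?k * (\<Sum>S\<in>Pow L. (cmod (?X S))\<^sup>2) + 2 * 2 ^ card L * (cmod (c a))^4"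
    using insert by (simp add: sum.distrib card_Pow sum_distrib_left algebra_simps)
  also have "\<dots> \<le> 2 * (2 ^ card L * (3 * ?u\<^sup>2)) + 12 * ?k * (2 ^ card L * ?u) + 2 * 2 ^ card L * (3 * ?k\<^sup>2)"
  proof -
    have "(cmod (c a))^4 \<le> 3 * ?k\<^sup>2" by (simp flip: power_mult)
    then have "2 * 2 ^ card L * (cmod (c a))^4 \<le> 2 * 2 ^ card L * (3 * ?k\<^sup>2)" by (intro mult_left_mono) auto
    with insert.IH show ?thesis unfolding sign_second_moment[OF insert.hyps(1)] by linarith
  qed
  also have "\<dots> = 2 ^ card (insert a L) * (3 * (\<Sum>s\<in>insert a L. (cmod (c s))\<^sup>2)\<^sup>2)"
    using insert.hyps by (simp add: power2_eq_square algebra_simps)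
  finally show ?case .
qed

(* x >= (3/4) x^2 - x^4/16 for x >= 0, since x^3 - 12 x + 16 = (x - 2)^2 (x + 4). *)
lemma khinchine:
  assumes L: "finite L"
  shows "2 ^ card L * sqrt (\<Sum>s\<in>L. (cmod (c s))\<^sup>2) \<le> 2 * (\<Sum>S\<in>Pow L. cmod (\<Sum>s\<in>L. sign S s * c s))"
proof -
  define u where "u = (\<Sum>s\<in>L. (cmod (c s))\<^sup>2)"
  have u0: "u \<ge> 0" unfolding u_def by (intro sum_nonneg) simp
  show ?thesis
  proof (cases "u = 0")
    case True
    then show ?thesis by (auto simp: u_def intro!: sum_nonneg)
  next
    case False
    define l where "l = sqrt u"
    have l: "l > 0" "l\<^sup>2 = u" "l^4 = u\<^sup>2"
      using False u0 by (auto simp: l_def power2_eq_square power4_eq_xxxx)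
    have ineq: "y \<ge> 3 / (4 * l) * y\<^sup>2 - 1 / (16 * l^3) * y^4" if "y \<ge> 0" for y
    proof -
      define x where "x = y / l"
      have x: "x \<ge> 0" "y = l * x" using l that by (auto simp: x_def)
      have "x / 16 * ((x - 2)\<^sup>2 * (x + 4)) \<ge> 0" using x by simp
      then have "x \<ge> 3 / 4 * x\<^sup>2 - 1 / 16 * x^4"
        by (simp add: power2_eq_square power4_eq_xxxx algebra_simps)
      then have "l * x \<ge> l * (3 / 4 * x\<^sup>2 - 1 / 16 * x^4)" using l by (intro mult_left_mono) auto
      also have "l * (3 / 4 * x\<^sup>2 - 1 / 16 * x^4) = 3 / (4 * l) * (l * x)\<^sup>2 - 1 / (16 * l^3) * (l * x)^4"
        using l(1) by (simp add: field_simps power2_eq_square power3_eq_cube power4_eq_xxxx)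
      finally show ?thesis by (simp add: x)
    qed
    let ?X = "\<lambda>S. cmod (\<Sum>s\<in>L. sign S s * c s)"
    have "(\<Sum>S\<in>Pow L. 3 / (4 * l) * (?X S)\<^sup>2 - 1 / (16 * l^3) * (?X S)^4) \<le> (\<Sum>S\<in>Pow L. ?X S)"
      by (intro sum_mono ineq) simp
    moreover have "(\<Sum>S\<in>Pow L. 3 / (4 * l) * (?X S)\<^sup>2 - 1 / (16 * l^3) * (?X S)^4)
        = 3 / (4 * l) * (2 ^ card L * u) - 1 / (16 * l^3) * (\<Sum>S\<in>Pow L. (?X S)^4)"
      by (simp only: sum_subtractf sum_distrib_left[symmetric] sign_second_moment[OF L] u_def)
    moreover have "1 / (16 * l^3) * (\<Sum>S\<in>Pow L. (?X S)^4) \<le> 1 / (16 * l^3) * (2 ^ card L * (3 * u\<^sup>2))"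
      using sign_fourth_moment[OF L, of c] l by (intro mult_left_mono) (auto simp: u_def)
    moreover have "3 / (4 * l) * (2 ^ card L * u) - 1 / (16 * l^3) * (2 ^ card L * (3 * u\<^sup>2)) = 9 / 16 * (2 ^ card L * l)"
      unfolding l(2,3)[symmetric] using l(1) by (simp add: field_simps power2_eq_square power3_eq_cube power4_eq_xxxx)
    \<comment> \<open>\<open>3 / 4 - 3 / 16 = 9 / 16\<close>, a little more than the
      \<open>1 / 2\<close> that is claimed.\<close>
    ultimately have "9 / 16 * (2 ^ card L * l) \<le> (\<Sum>S\<in>Pow L. ?X S)" by linarith
    moreover have "2 ^ card L * l \<ge> 0" using l by simp
    ultimately show ?thesis unfolding l_def u_def by linarith
  qed
qed

text \<open>Rows and columns receive independent signs, so a product of two averages becomes an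
  average over pairs of signs, each bounded by \<open>B\<close>. The factor 4 is the square of the
  constant in \<open>khinchine\<close>.\<close>

lemma khinchine_bilinear:
  fixes \<alpha> :: "'a \<Rightarrow> 'r \<Rightarrow> complex" and \<beta> :: "'r \<Rightarrow> 'a \<Rightarrow> complex"
  assumes L: "finite L"
    and B: "\<And>S S'. (\<Sum>r\<in>J. cmod (\<Sum>s\<in>L. sign S s * \<alpha> s r) * cmod (\<Sum>t\<in>L. sign S' t * \<beta> r t)) \<le> B"
  shows "(\<Sum>r\<in>J. sqrt (\<Sum>s\<in>L. (cmod (\<alpha> s r))\<^sup>2) * sqrt (\<Sum>t\<in>L. (cmod (\<beta> r t))\<^sup>2)) \<le> 4 * B"
proof -
  let ?k = "2 ^ card L :: real"
  let ?x = "\<lambda>r S. cmod (\<Sum>s\<in>L. sign S s * \<alpha> s r)" and ?y = "\<lambda>r S. cmod (\<Sum>t\<in>L. sign S t * \<beta> r t)"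
  have "(?k * ?k) * (\<Sum>r\<in>J. sqrt (\<Sum>s\<in>L. (cmod (\<alpha> s r))\<^sup>2) * sqrt (\<Sum>t\<in>L. (cmod (\<beta> r t))\<^sup>2))
      = (\<Sum>r\<in>J. (?k * sqrt (\<Sum>s\<in>L. (cmod (\<alpha> s r))\<^sup>2)) * (?k * sqrt (\<Sum>t\<in>L. (cmod (\<beta> r t))\<^sup>2)))"
    by (simp add: sum_distrib_left mult_ac)
  also have "\<dots> \<le> (\<Sum>r\<in>J. (2 * (\<Sum>S\<in>Pow L. ?x r S)) * (2 * (\<Sum>S\<in>Pow L. ?y r S)))"
    by (intro sum_mono mult_mono khinchine L) (auto intro!: sum_nonneg mult_nonneg_nonneg)
  also have "\<dots> = (\<Sum>r\<in>J. \<Sum>S\<in>Pow L. \<Sum>S'\<in>Pow L. 4 * (?x r S * ?y r S'))"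
  proof (rule sum.cong[OF refl])
    fix r
    have "(2 * (\<Sum>S\<in>Pow L. ?x r S)) * (2 * (\<Sum>S\<in>Pow L. ?y r S)) = 4 * ((\<Sum>S\<in>Pow L. ?x r S) * (\<Sum>S\<in>Pow L. ?y r S))"
      by simp
    also have "\<dots> = 4 * (\<Sum>S\<in>Pow L. \<Sum>S'\<in>Pow L. ?x r S * ?y r S')" by (simp only: sum_product)
    finally show "(2 * (\<Sum>S\<in>Pow L. ?x r S)) * (2 * (\<Sum>S\<in>Pow L. ?y r S)) = (\<Sum>S\<in>Pow L. \<Sum>S'\<in>Pow L. 4 * (?x r S * ?y r S'))"
      by (simp only: sum_distrib_left)
  qed
  also have "\<dots> = (\<Sum>S\<in>Pow L. \<Sum>r\<in>J. \<Sum>S'\<in>Pow L. 4 * (?x r S * ?y r S'))" by (rule sum.swap)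
  also have "\<dots> = (\<Sum>S\<in>Pow L. \<Sum>S'\<in>Pow L. \<Sum>r\<in>J. 4 * (?x r S * ?y r S'))"
    by (rule sum.cong[OF refl]) (rule sum.swap)
  also have "\<dots> \<le> (\<Sum>S\<in>Pow L. \<Sum>S'\<in>Pow L. 4 * B)"
    unfolding sum_distrib_left[symmetric] by (intro sum_mono mult_left_mono B) auto
  also have "\<dots> = (?k * ?k) * (4 * B)" using L by (simp add: card_Pow)
  finally show ?thesis by simp
qed

section \<open>Bilinear functionals on the tensor product\<close>

definition pairing :: "('a \<Rightarrow> 'a \<Rightarrow> complex) \<Rightarrow> ('a \<times> 'a \<Rightarrow>\<^sub>0 complex) \<Rightarrow> complex" where
  "pairing \<phi> f = (\<Sum>k\<in>Poly_Mapping.keys f. Poly_Mapping.lookup f k * \<phi> (fst k) (snd k))"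

lemma pairing_superset:
  assumes "finite S" "Poly_Mapping.keys f \<subseteq> S"
  shows "pairing \<phi> f = (\<Sum>k\<in>S. Poly_Mapping.lookup f k * \<phi> (fst k) (snd k))"
  unfolding pairing_def by (rule sum.mono_neutral_left) (use assms in \<open>auto simp: in_keys_iff\<close>)

lemma pairing_add: "pairing \<phi> (f + g) = pairing \<phi> f + pairing \<phi> g"
proof -
  let ?S = "Poly_Mapping.keys f \<union> Poly_Mapping.keys g"
  have "pairing \<phi> (f + g) = (\<Sum>k\<in>?S. Poly_Mapping.lookup (f + g) k * \<phi> (fst k) (snd k))"
    by (rule pairing_superset) (auto dest: set_mp[OF Poly_Mapping.keys_add])
  also have "\<dots> = pairing \<phi> f + pairing \<phi> g"
    by (simp add: pairing_superset[of ?S] lookup_add distrib_right sum.distrib)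
  finally show ?thesis .
qed

lemma pairing_scale: "pairing \<phi> (free_scale c f) = c * pairing \<phi> f"
proof -
  have "pairing \<phi> (free_scale c f) = (\<Sum>k\<in>Poly_Mapping.keys f. Poly_Mapping.lookup (free_scale c f) k * \<phi> (fst k) (snd k))"
    by (rule pairing_superset) (auto simp: in_keys_iff lookup_free_scale)
  then show ?thesis by (simp add: lookup_free_scale pairing_def sum_distrib_left mult.assoc)
qed

lemma pairing_diff: "pairing \<phi> (f - g) = pairing \<phi> f - pairing \<phi> g"
  using pairing_add[of \<phi> "f - g" g] by simp

lemma pairing_zero [simp]: "pairing \<phi> 0 = 0"
  by (simp add: pairing_def)

lemma pairing_single [simp]: "pairing \<phi> (Poly_Mapping.single (a, b) c) = c * \<phi> a b"
  by (simp add: pairing_def)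

lemma pairing_sum: "pairing \<phi> (\<Sum>i\<in>S. f i) = (\<Sum>i\<in>S. pairing \<phi> (f i))"
  by (induction S rule: infinite_finite_induct) (simp_all add: pairing_add)

interpretation free: vector_space free_scale
  by (rule vector_space_free_scale)

lemma subspace_tensor_null: "free.subspace (tensor_null A)"
  unfolding tensor_null_def by (rule free.subspace_span)

text \<open>Relations in the tensor product become scalar identities under every functional that is
  bilinear on the carrier; this is the only way in which the quotient is exploited.\<close>

lemma pairing_tensor_null:
  assumes add: "\<And>a a' b. a \<in> carrier A \<Longrightarrow> a' \<in> carrier A \<Longrightarrow> b \<in> carrier A \<Longrightarrow> \<phi> (a \<oplus>\<^bsub>A\<^esub> a') b = \<phi> a b + \<phi> a' b"
    and add': "\<And>a b b'. a \<in> carrier A \<Longrightarrow> b \<in> carrier A \<Longrightarrow> b' \<in> carrier A \<Longrightarrow> \<phi> a (b \<oplus>\<^bsub>A\<^esub> b') = \<phi> a b + \<phi> a b'"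
    and sc: "\<And>c a b. a \<in> carrier A \<Longrightarrow> b \<in> carrier A \<Longrightarrow> \<phi> (c \<odot>\<^bsub>A\<^esub> a) b = c * \<phi> a b"
    and sc': "\<And>c a b. a \<in> carrier A \<Longrightarrow> b \<in> carrier A \<Longrightarrow> \<phi> a (c \<odot>\<^bsub>A\<^esub> b) = c * \<phi> a b"
    and f: "f \<in> tensor_null A"
  shows "pairing \<phi> f = 0"
proof -
  have "free.span (bilinear_relations A) \<subseteq> {f. pairing \<phi> f = 0}"
  proof (rule free.span_minimal)
    show "bilinear_relations A \<subseteq> {f. pairing \<phi> f = 0}"
      unfolding bilinear_relations_def using add add' sc sc'
      by (auto simp: pairing_diff pairing_scale)
    show "free.subspace {f. pairing \<phi> f = 0}"
      by (auto simp: free.subspace_def pairing_add pairing_scale)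
  qed
  with f show ?thesis by (auto simp: tensor_null_def)
qed

lemma tensor_class_eqD: "tensor_class A f = tensor_class A g \<Longrightarrow> f - g \<in> tensor_null A"
proof -
  assume "tensor_class A f = tensor_class A g"
  moreover have "f \<in> tensor_class A f"
    using free.subspace_0[OF subspace_tensor_null] by (simp add: tensor_class_def)
  ultimately show ?thesis by (simp add: tensor_class_def)
qed

lemma tensor_class_eqI: "f - g \<in> tensor_null A \<Longrightarrow> tensor_class A f = tensor_class A g"
proof -
  assume fg: "f - g \<in> tensor_null A"
  have "h - f \<in> tensor_null A \<longleftrightarrow> h - g \<in> tensor_null A" for h
    using free.subspace_add[OF subspace_tensor_null _ fg, of "h - f"]
      free.subspace_diff[OF subspace_tensor_null _ fg, of "h - g"] by auto
  then show ?thesis by (auto simp: tensor_class_def)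
qed

text \<open>The representation by \<open>a0\<close> and \<open>b0\<close> guarantees that the
  infimum is not taken over the empty set, so that some competitor lies below
  \<open>c\<close>.\<close>

lemma proj_norm_lessD:
  assumes "proj_norm A (tensor_class A f) < c"
    and rep: "\<forall>i<(r0::nat). a0 i \<in> carrier A \<and> b0 i \<in> carrier A"
      "tensor_class A f = tensor_class A (\<Sum>i<r0. pair (a0 i) (b0 i))"
  shows "\<exists>(r::nat) a b. (\<forall>i<r. a i \<in> carrier A \<and> b i \<in> carrier A) \<and>
    f - (\<Sum>i<r. pair (a i) (b i)) \<in> tensor_null A \<and> (\<Sum>i<r. anorm A (a i) * anorm A (b i)) < c"
proof -
  let ?S = "{(\<Sum>i<r. anorm A (a i) * anorm A (b i)) | (r::nat) a b.
     (\<forall>i<r. a i \<in> carrier A \<and> b i \<in> carrier A) \<and> tensor_class A f = tensor_class A (\<Sum>i<r. pair (a i) (b i))}"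
  have ne: "?S \<noteq> {}" using rep by blast
  have "Inf ?S < c" using assms(1) by (simp add: proj_norm_def)
  from cInf_lessD[OF ne this] obtain r :: nat and a b where
    "\<forall>i<r. a i \<in> carrier A \<and> b i \<in> carrier A" "tensor_class A f = tensor_class A (\<Sum>i<r. pair (a i) (b i))"
    "(\<Sum>i<r. anorm A (a i) * anorm A (b i)) < c" by blast
  then show ?thesis by (intro exI[of _ r] exI[of _ a] exI[of _ b]) (simp add: tensor_class_eqD)
qed

text \<open>Carries the sum formed with the addition of the algebra over to complex numbers; it is
  applied to diagonal entries of the equation that the products add up to the unit.\<close>

lemma (in abelian_monoid) additive_finsum:
  fixes e :: "'a \<Rightarrow> complex"
  assumes "finite S" "\<And>i. i \<in> S \<Longrightarrow> f i \<in> carrier G"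
    and e: "\<And>a b. a \<in> carrier G \<Longrightarrow> b \<in> carrier G \<Longrightarrow> e (a \<oplus> b) = e a + e b" "e \<zero> = 0"
  shows "e (finsum G f S) = (\<Sum>i\<in>S. e (f i))"
  using assms(1,2)
proof induction
  case empty
  then show ?case by (simp add: e)
next
  case (insert i S)
  then have "finsum G f (insert i S) = f i \<oplus> finsum G f S" by (intro finsum_insert) auto
  then show ?case using insert by (simp add: e finsum_closed Pi_def)
qed

text \<open>
  \<open>\<alpha>\<close> and \<open>\<beta>\<close> are rectangular blocks of (a discretisation of) the matrices of the left and
  right tensor factors: rows, respectively columns, indexed by the torus and summed over \<open>J\<close>;
  \<open>ev s\<close> is the diagonal entry at \<open>s\<close>.
\<close>

definition block_system where
  "block_system A x m B \<delta> J \<alpha> \<beta> ev \<longleftrightarrow> finite (J :: nat set) \<and>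
     (\<forall>a\<in>carrier A. \<forall>a'\<in>carrier A. \<forall>s r. \<alpha> (a \<oplus>\<^bsub>A\<^esub> a') s r = \<alpha> a s r + \<alpha> a' s r) \<and>
     (\<forall>a\<in>carrier A. \<forall>c s r. \<alpha> (c \<odot>\<^bsub>A\<^esub> a) s r = c * \<alpha> a s r) \<and>
     (\<forall>a\<in>carrier A. \<forall>a'\<in>carrier A. \<forall>r t. \<beta> (a \<oplus>\<^bsub>A\<^esub> a') r t = \<beta> a r t + \<beta> a' r t) \<and>
     (\<forall>a\<in>carrier A. \<forall>c r t. \<beta> (c \<odot>\<^bsub>A\<^esub> a) r t = c * \<beta> a r t) \<and>
     (\<forall>j<6. \<forall>a\<in>carrier A. \<forall>s\<in>torus m. \<forall>r. \<alpha> (x j \<otimes>\<^bsub>A\<^esub> a) s r = phase m j s * \<alpha> a (perm m j s) r) \<and>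
     (\<forall>j<6. \<forall>b\<in>carrier A. \<forall>t\<in>torus m. \<forall>r. \<beta> (b \<otimes>\<^bsub>A\<^esub> x j) r (perm m j t) = \<beta> b r t * phase m j t) \<and>
     (\<forall>a\<in>carrier A. \<forall>b\<in>carrier A.
        (\<Sum>r\<in>J. sqrt (\<Sum>s\<in>torus m. (cmod (\<alpha> a s r))\<^sup>2) * sqrt (\<Sum>t\<in>torus m. (cmod (\<beta> b r t))\<^sup>2))
          \<le> 4 * (card (torus m) * (anorm A a * anorm A b))) \<and>
     (\<forall>a\<in>carrier A. \<forall>a'\<in>carrier A. \<forall>s\<in>torus m. ev s (a \<oplus>\<^bsub>A\<^esub> a') = ev s a + ev s a') \<and>
     (\<forall>s\<in>torus m. ev s \<zero>\<^bsub>A\<^esub> = 0 \<and> ev s \<one>\<^bsub>A\<^esub> = 1) \<and>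
     (\<forall>(a,b)\<in>B. \<forall>s\<in>torus m. cmod (ev s (a \<otimes>\<^bsub>A\<^esub> b) - (\<Sum>r\<in>J. \<alpha> a s r * \<beta> b r s)) \<le> (\<delta>::real))"

text \<open>The interface between the algebras and the matrix argument. The order of quantifiers
  matters: the elements \<open>x\<close> are fixed, while \<open>m\<close>, \<open>B\<close> and
  \<open>\<delta>\<close> may depend on the approximate diagonal found for them.\<close>

theorem not_amenableI:
  fixes A :: "('a, 'm) normed_algebra_scheme" and x :: "nat \<Rightarrow> 'a"
  assumes ab: "abelian_monoid A"
    and mult: "\<And>a b. a \<in> carrier A \<Longrightarrow> b \<in> carrier A \<Longrightarrow> a \<otimes>\<^bsub>A\<^esub> b \<in> carrier A"
    and smult: "\<And>c a. a \<in> carrier A \<Longrightarrow> c \<odot>\<^bsub>A\<^esub> a \<in> carrier A"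
    and x: "\<And>j. j < 6 \<Longrightarrow> x j \<in> carrier A"
    and block: "\<And>m B \<delta>. m \<ge> 1 \<Longrightarrow> finite B \<Longrightarrow> B \<subseteq> carrier A \<times> carrier A \<Longrightarrow> \<delta> > 0 \<Longrightarrow>
      \<exists>J \<alpha> \<beta> ev. block_system A x m B \<delta> J \<alpha> \<beta> ev"
  shows "\<not> amenable A"
proof
  interpret abelian_monoid A by (rule ab)
  assume "amenable A"
  then obtain C where C: "\<forall>F \<epsilon>. finite F \<and> F \<subseteq> carrier A \<and> \<epsilon> > 0 \<longrightarrow>
       (\<exists>(r::nat) a b. (\<forall>i<r. a i \<in> carrier A \<and> b i \<in> carrier A) \<and>
          (\<Oplus>\<^bsub>A\<^esub> i \<in> {..<r}. a i \<otimes>\<^bsub>A\<^esub> b i) = \<one>\<^bsub>A\<^esub> \<and>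
          (\<forall>x\<in>F. proj_norm A (tensor_class A
              ((\<Sum>i<r. pair (x \<otimes>\<^bsub>A\<^esub> a i) (b i)) - (\<Sum>i<r. pair (a i) (b i \<otimes>\<^bsub>A\<^esub> x)))) \<le> \<epsilon>) \<and>
          proj_norm A (tensor_class A (\<Sum>i<r. pair (a i) (b i))) \<le> C)"
    unfolding amenable_def by blast
  \<comment> \<open>Doubled to make the inequality strict and multiplied by the factor 4 from
    \<open>block_system\<close>, this tolerance stays below the \<open>1 / 10^11\<close> asked of
    the family.\<close>
  have "finite (x ` {..<6}) \<and> x ` {..<6} \<subseteq> carrier A \<and> (1 / 10^12 :: real) > 0" using x by auto
  with C[THEN spec, THEN spec, of "x ` {..<6}" "1 / 10^12"] obtain R :: nat and a b where
    D: "\<forall>i<R. a i \<in> carrier A \<and> b i \<in> carrier A" "(\<Oplus>\<^bsub>A\<^esub> i \<in> {..<R}. a i \<otimes>\<^bsub>A\<^esub> b i) = \<one>\<^bsub>A\<^esub>"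
      "\<forall>y\<in>x ` {..<6}. proj_norm A (tensor_class A
              ((\<Sum>i<R. pair (y \<otimes>\<^bsub>A\<^esub> a i) (b i)) - (\<Sum>i<R. pair (a i) (b i \<otimes>\<^bsub>A\<^esub> y)))) \<le> 1 / 10^12"
    by blast
  have ca: "\<And>i. i < R \<Longrightarrow> a i \<in> carrier A" and cb: "\<And>i. i < R \<Longrightarrow> b i \<in> carrier A"
    using D(1) by auto
  note one = D(2)
  have near: "proj_norm A (tensor_class A
              ((\<Sum>i<R. pair (x j \<otimes>\<^bsub>A\<^esub> a i) (b i)) - (\<Sum>i<R. pair (a i) (b i \<otimes>\<^bsub>A\<^esub> x j)))) \<le> 1 / 10^12"
    if "j < 6" for j using D(3) that by blast
  \<comment> \<open>The torus then has \<open>(4 * R + 3)^2\<close> points, more than the bound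
    \<open>4 * R\<close>.\<close>
  define m where "m = int (2 * R + 1)"
  have m: "m \<ge> 1" by (simp add: m_def)
  have card: "card (torus m) > 4 * R"
  proof -
    have "4 * R < 4 * R + 3" by simp
    also have "\<dots> \<le> (4 * R + 3)\<^sup>2" by (simp add: power2_eq_square)
    also have "\<dots> = card (torus m)" using m by (simp add: card_torus m_def nat_add_distrib)
    finally show ?thesis .
  qed
  \<comment> \<open>With \<open>R\<close> products, an error of \<open>?\<delta>\<close> each keeps
    every diagonal sum within \<open>1 / 2\<close> of \<open>1\<close>.\<close>
  let ?B = "(\<lambda>i. (a i, b i)) ` {..<R}" and ?\<delta> = "1 / (2 * (real R + 1))"
  have "?\<delta> > 0" by simp
  with block[OF m, of ?B ?\<delta>] ca cb obtain J \<alpha> \<beta> ev where bs: "block_system A x m ?B ?\<delta> J \<alpha> \<beta> ev"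
    by blast
  then have J: "finite J"
    and \<alpha>a: "\<And>a a' s r. a \<in> carrier A \<Longrightarrow> a' \<in> carrier A \<Longrightarrow> \<alpha> (a \<oplus>\<^bsub>A\<^esub> a') s r = \<alpha> a s r + \<alpha> a' s r"
    and \<alpha>c: "\<And>a c s r. a \<in> carrier A \<Longrightarrow> \<alpha> (c \<odot>\<^bsub>A\<^esub> a) s r = c * \<alpha> a s r"
    and \<beta>a: "\<And>a a' r t. a \<in> carrier A \<Longrightarrow> a' \<in> carrier A \<Longrightarrow> \<beta> (a \<oplus>\<^bsub>A\<^esub> a') r t = \<beta> a r t + \<beta> a' r t"
    and \<beta>c: "\<And>a c r t. a \<in> carrier A \<Longrightarrow> \<beta> (c \<odot>\<^bsub>A\<^esub> a) r t = c * \<beta> a r t"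
    and \<alpha>x: "\<And>j a s r. j < 6 \<Longrightarrow> a \<in> carrier A \<Longrightarrow> s \<in> torus m \<Longrightarrow> \<alpha> (x j \<otimes>\<^bsub>A\<^esub> a) s r = phase m j s * \<alpha> a (perm m j s) r"
    and \<beta>x: "\<And>j b t r. j < 6 \<Longrightarrow> b \<in> carrier A \<Longrightarrow> t \<in> torus m \<Longrightarrow> \<beta> (b \<otimes>\<^bsub>A\<^esub> x j) r (perm m j t) = \<beta> b r t * phase m j t"
    and bd: "\<And>a b. a \<in> carrier A \<Longrightarrow> b \<in> carrier A \<Longrightarrow>
        (\<Sum>r\<in>J. sqrt (\<Sum>s\<in>torus m. (cmod (\<alpha> a s r))\<^sup>2) * sqrt (\<Sum>t\<in>torus m. (cmod (\<beta> b r t))\<^sup>2))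
          \<le> 4 * (card (torus m) * (anorm A a * anorm A b))"
    and ev: "\<And>a a' s. a \<in> carrier A \<Longrightarrow> a' \<in> carrier A \<Longrightarrow> s \<in> torus m \<Longrightarrow> ev s (a \<oplus>\<^bsub>A\<^esub> a') = ev s a + ev s a'"
      "\<And>s. s \<in> torus m \<Longrightarrow> ev s \<zero>\<^bsub>A\<^esub> = 0" "\<And>s. s \<in> torus m \<Longrightarrow> ev s \<one>\<^bsub>A\<^esub> = 1"
    and close: "\<And>i s. i < R \<Longrightarrow> s \<in> torus m \<Longrightarrow> cmod (ev s (a i \<otimes>\<^bsub>A\<^esub> b i) - (\<Sum>r\<in>J. \<alpha> (a i) s r * \<beta> (b i) r s)) \<le> ?\<delta>"
    unfolding block_system_def by auto
  define P where "P j n a' b' \<longleftrightarrow> (\<forall>k<(n::nat). a' k \<in> carrier A \<and> b' k \<in> carrier A) \<and>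
      (\<Sum>i<R. pair (x j \<otimes>\<^bsub>A\<^esub> a i) (b i)) - (\<Sum>i<R. pair (a i) (b i \<otimes>\<^bsub>A\<^esub> x j)) - (\<Sum>k<n. pair (a' k) (b' k)) \<in> tensor_null A \<and>
      (\<Sum>k<n. anorm A (a' k) * anorm A (b' k)) < 2 / 10^12" for j n a' b'
  have "\<exists>n a' b'. P j n a' b'" if j: "j < 6" for j
  proof -
    let ?f = "(\<Sum>i<R. pair (x j \<otimes>\<^bsub>A\<^esub> a i) (b i)) - (\<Sum>i<R. pair (a i) (b i \<otimes>\<^bsub>A\<^esub> x j))"
    \<comment> \<open>A difference of sums is turned into one sum of elementary tensors by absorbing
      the sign into the left factors of the last \<open>R\<close> terms;
      \<open>proj_norm_lessD\<close> asks for such a representation.\<close>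
    define a0 where "a0 i = (if i < R then x j \<otimes>\<^bsub>A\<^esub> a i else (-1) \<odot>\<^bsub>A\<^esub> a (i - R))" for i
    define b0 where "b0 i = (if i < R then b i else b (i - R) \<otimes>\<^bsub>A\<^esub> x j)" for i
    have c0: "\<forall>i<R + R. a0 i \<in> carrier A \<and> b0 i \<in> carrier A"
      using ca cb x[OF j] by (auto simp: a0_def b0_def mult smult)
    have spl: "(\<Sum>i<R + R. g i) = (\<Sum>i<R. g i) + (\<Sum>i<R. g (R + i))" for g :: "nat \<Rightarrow> ('a \<times> 'a \<Rightarrow>\<^sub>0 complex)"
      by (simp add: lessThan_atLeast0 sum.atLeastLessThan_concat[of 0 R "R+R", symmetric]
          sum.shift_bounds_nat_ivl[of _ 0 R R, simplified] add.commute)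
    have "?f - (\<Sum>i<R + R. pair (a0 i) (b0 i)) = (\<Sum>i<R. - (pair ((-1) \<odot>\<^bsub>A\<^esub> a i) (b i \<otimes>\<^bsub>A\<^esub> x j) - free_scale (-1) (pair (a i) (b i \<otimes>\<^bsub>A\<^esub> x j))))"
    proof -
      have "free_scale (-1) f = - f" for f :: "'a \<times> 'a \<Rightarrow>\<^sub>0 complex"
        by (rule poly_mapping_eqI) (simp add: lookup_free_scale)
      then show ?thesis unfolding spl by (simp add: a0_def b0_def sum_negf sum.distrib sum_subtractf)
    qed
    also have "\<dots> \<in> tensor_null A"
    proof (intro free.subspace_sum[OF subspace_tensor_null] free.subspace_neg[OF subspace_tensor_null])
      fix i assume "i \<in> {..<R}"
      then have "pair ((-1) \<odot>\<^bsub>A\<^esub> a i) (b i \<otimes>\<^bsub>A\<^esub> x j) - free_scale (-1) (pair (a i) (b i \<otimes>\<^bsub>A\<^esub> x j)) \<in> bilinear_relations A"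
        unfolding bilinear_relations_def using ca cb x[OF j] mult by blast
      then show "pair ((-1) \<odot>\<^bsub>A\<^esub> a i) (b i \<otimes>\<^bsub>A\<^esub> x j) - free_scale (-1) (pair (a i) (b i \<otimes>\<^bsub>A\<^esub> x j)) \<in> tensor_null A"
        unfolding tensor_null_def by (rule free.span_base)
    qed
    finally have "tensor_class A ?f = tensor_class A (\<Sum>i<R + R. pair (a0 i) (b0 i))" by (rule tensor_class_eqI)
    moreover have "proj_norm A (tensor_class A ?f) < 2 / 10^12" using near[OF j] by simp
    ultimately show ?thesis unfolding P_def by (intro proj_norm_lessD[OF _ c0])
  qed
  then have "\<exists>n a' b'. \<forall>j<6. P j (n j) (a' j) (b' j)" by metis
  then obtain n a' b' where P: "\<And>j. j < 6 \<Longrightarrow> P j (n j) (a' j) (b' j)" by blast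
  then have ca': "\<And>j k. j < 6 \<Longrightarrow> k < n j \<Longrightarrow> a' j k \<in> carrier A" and cb': "\<And>j k. j < 6 \<Longrightarrow> k < n j \<Longrightarrow> b' j k \<in> carrier A"
    and nul: "\<And>j. j < 6 \<Longrightarrow> (\<Sum>i<R. pair (x j \<otimes>\<^bsub>A\<^esub> a i) (b i)) - (\<Sum>i<R. pair (a i) (b i \<otimes>\<^bsub>A\<^esub> x j))
        - (\<Sum>k<n j. pair (a' j k) (b' j k)) \<in> tensor_null A"
    and sml: "\<And>j. j < (6::nat) \<Longrightarrow> (\<Sum>k<n j. anorm A (a' j k) * anorm A (b' j k)) < 2 / 10^12"
    unfolding P_def by blast+
  show False
  proof (rule no_low_rank_almost_central_family[OF m card J, where n = n and \<xi> = "\<lambda>i r s. \<alpha> (a i) s r" and \<eta> = "\<lambda>i r t. \<beta> (b i) r t"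
        and x = "\<lambda>j k r s. \<alpha> (a' j k) s r" and y = "\<lambda>j k r t. \<beta> (b' j k) r t"])
    let ?T = "\<lambda>r s t. \<Sum>i<R. \<alpha> (a i) s r * \<beta> (b i) r t"
    show "?T r s t = (\<Sum>i<R. \<alpha> (a i) s r * \<beta> (b i) r t)" for r s t ..
    have "1 / 2 \<le> Re (\<Sum>r\<in>J. ?T r s s)" if s: "s \<in> torus m" for s
    proof -
      have "1 = ev s (\<Oplus>\<^bsub>A\<^esub> i \<in> {..<R}. a i \<otimes>\<^bsub>A\<^esub> b i)" using ev s one by simp
      also have "\<dots> = (\<Sum>i<R. ev s (a i \<otimes>\<^bsub>A\<^esub> b i))"
        by (rule additive_finsum) (use ca cb mult ev s in auto)
      finally have 1: "(\<Sum>i<R. ev s (a i \<otimes>\<^bsub>A\<^esub> b i)) = 1" by simp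
      have "(\<Sum>r\<in>J. ?T r s s) = (\<Sum>i<R. \<Sum>r\<in>J. \<alpha> (a i) s r * \<beta> (b i) r s)" by (rule sum.swap)
      then have "1 - (\<Sum>r\<in>J. ?T r s s) = (\<Sum>i<R. ev s (a i \<otimes>\<^bsub>A\<^esub> b i) - (\<Sum>r\<in>J. \<alpha> (a i) s r * \<beta> (b i) r s))"
        by (simp add: sum_subtractf 1)
      also have "cmod \<dots> \<le> (\<Sum>i<R. ?\<delta>)" by (intro sum_norm_le) (use close s in auto)
      also have "\<dots> = R * ?\<delta>" by simp
      also have "\<dots> \<le> 1 / 2" by (simp add: field_simps)
      finally have "Re (1 - (\<Sum>r\<in>J. ?T r s s)) \<le> 1 / 2" using complex_Re_le_cmod order_trans by blast
      then show ?thesis by (simp del: Re_sum)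
    qed
    then have "(\<Sum>s\<in>torus m. 1 / 2) \<le> (\<Sum>s\<in>torus m. Re (\<Sum>r\<in>J. ?T r s s))" by (rule sum_mono)
    also have "\<dots> = (\<Sum>r\<in>J. Re (\<Sum>s\<in>torus m. ?T r s s))" by (simp only: Re_sum) (rule sum.swap)
    finally show "card (torus m) / 2 \<le> (\<Sum>r\<in>J. Re (\<Sum>s\<in>torus m. ?T r s s))" by simp
    fix j :: nat assume j: "j < 6"
    show "phase m j s * ?T r (perm m j s) (perm m j t) - ?T r s t * phase m j t
        = (\<Sum>k<n j. \<alpha> (a' j k) s r * \<beta> (b' j k) r (perm m j t))"
      if "r \<in> J" "s \<in> torus m" "t \<in> torus m" for r s t
    proof -
      \<comment> \<open>Reading off one entry on each side is bilinear; applied to the relation, it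
        gives the entry of the commutator of \<open>?T r\<close> in row \<open>s\<close> and column
        \<open>perm m j t\<close>.\<close>
      let ?p = "pairing (\<lambda>u v. \<alpha> u s r * \<beta> v r (perm m j t))"
      have "?p ((\<Sum>i<R. pair (x j \<otimes>\<^bsub>A\<^esub> a i) (b i)) - (\<Sum>i<R. pair (a i) (b i \<otimes>\<^bsub>A\<^esub> x j)) - (\<Sum>k<n j. pair (a' j k) (b' j k))) = 0"
        by (rule pairing_tensor_null[OF _ _ _ _ nul[OF j]]) (simp_all add: \<alpha>a \<alpha>c \<beta>a \<beta>c algebra_simps)
      then have "(\<Sum>i<R. \<alpha> (x j \<otimes>\<^bsub>A\<^esub> a i) s r * \<beta> (b i) r (perm m j t)) - (\<Sum>i<R. \<alpha> (a i) s r * \<beta> (b i \<otimes>\<^bsub>A\<^esub> x j) r (perm m j t))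
          = (\<Sum>k<n j. \<alpha> (a' j k) s r * \<beta> (b' j k) r (perm m j t))"
        by (simp add: pairing_diff pairing_sum)
      moreover have "(\<Sum>i<R. \<alpha> (x j \<otimes>\<^bsub>A\<^esub> a i) s r * \<beta> (b i) r (perm m j t)) = phase m j s * ?T r (perm m j s) (perm m j t)"
        unfolding sum_distrib_left by (intro sum.cong refl) (simp add: \<alpha>x[OF j] ca that)
      moreover have "(\<Sum>i<R. \<alpha> (a i) s r * \<beta> (b i \<otimes>\<^bsub>A\<^esub> x j) r (perm m j t)) = ?T r s t * phase m j t"
        unfolding sum_distrib_right by (intro sum.cong refl) (simp add: \<beta>x[OF j] cb that)
      ultimately show ?thesis by simp
    qed
    have "(\<Sum>r\<in>J. \<Sum>k<n j. sqrt (\<Sum>s\<in>torus m. (cmod (\<alpha> (a' j k) s r))\<^sup>2) * sqrt (\<Sum>s\<in>torus m. (cmod (\<beta> (b' j k) r s))\<^sup>2))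
        = (\<Sum>k<n j. \<Sum>r\<in>J. sqrt (\<Sum>s\<in>torus m. (cmod (\<alpha> (a' j k) s r))\<^sup>2) * sqrt (\<Sum>s\<in>torus m. (cmod (\<beta> (b' j k) r s))\<^sup>2))"
      by (rule sum.swap)
    also have "\<dots> \<le> (\<Sum>k<n j. 4 * (card (torus m) * (anorm A (a' j k) * anorm A (b' j k))))"
      by (intro sum_mono bd) (use ca' cb' j in auto)
    also have "\<dots> = 4 * card (torus m) * (\<Sum>k<n j. anorm A (a' j k) * anorm A (b' j k))"
      by (simp add: sum_distrib_left mult_ac)
    also have "\<dots> \<le> 4 * card (torus m) * (2 / 10^12)"
      using sml[OF j] by (intro mult_left_mono) auto
    also have "\<dots> \<le> (1 / 10^11) * card (torus m)" by simp
    finally show "(\<Sum>r\<in>J. \<Sum>k<n j. sqrt (\<Sum>s\<in>torus m. (cmod (\<alpha> (a' j k) s r))\<^sup>2) * sqrt (\<Sum>s\<in>torus m. (cmod (\<beta> (b' j k) r s))\<^sup>2))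
        \<le> (1 / 10^11) * card (torus m)" .
  qed
qed

section \<open>Sequence spaces\<close>

definition unit_seq :: "nat \<Rightarrow> nat \<Rightarrow> complex" where
  "unit_seq j = (\<lambda>k. if k = j then 1 else 0)"

definition ind_seq :: "nat set \<Rightarrow> nat \<Rightarrow> complex" where
  "ind_seq P = (\<lambda>k. if k \<in> P then 1 else 0)"

text \<open>The common properties of \<open>lp\<close> and its finite sections. The factor 4 in
  \<open>N_add\<close> comes from an elementary estimate of powers and only serves to keep sums of
  operators bounded. \<open>hoelder\<close> says that a unimodular vector on \<open>L\<close> and
  its dual norm multiply to \<open>card L\<close>. \<open>approx\<close> replaces vectors by step
  functions with values at finitely many indices; this cuts the inner sum of a matrix product down
  to finitely many terms.\<close>

locale seq_space =
  fixes V :: "(nat \<Rightarrow> complex) set" and N :: "(nat \<Rightarrow> complex) \<Rightarrow> real"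
  assumes zero: "(\<lambda>i. 0) \<in> V"
    and add: "x \<in> V \<Longrightarrow> y \<in> V \<Longrightarrow> (\<lambda>i. x i + y i) \<in> V"
    and scale: "x \<in> V \<Longrightarrow> (\<lambda>i. c * x i) \<in> V"
    and N_scale: "x \<in> V \<Longrightarrow> N (\<lambda>i. c * x i) = cmod c * N x"
    and N_add: "x \<in> V \<Longrightarrow> y \<in> V \<Longrightarrow> N (\<lambda>i. x i + y i) \<le> 4 * (N x + N y)"
    and coord: "x \<in> V \<Longrightarrow> cmod (x i) \<le> N x"
    and solid: "x \<in> V \<Longrightarrow> (\<And>i. cmod (y i) \<le> cmod (x i)) \<Longrightarrow> y \<in> V"
    and N_mono: "x \<in> V \<Longrightarrow> (\<And>i. cmod (y i) \<le> cmod (x i)) \<Longrightarrow> N y \<le> N x"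
    and permute: "inj \<pi> \<Longrightarrow> (\<And>i. unit_seq (\<pi> i) \<in> V \<Longrightarrow> unit_seq i \<in> V) \<Longrightarrow> x \<in> V \<Longrightarrow> (\<lambda>i. x (\<pi> i)) \<in> V"
    and N_permute: "inj \<pi> \<Longrightarrow> (\<And>i. unit_seq (\<pi> i) \<in> V \<Longrightarrow> unit_seq i \<in> V) \<Longrightarrow> x \<in> V \<Longrightarrow> N (\<lambda>i. x (\<pi> i)) \<le> N x"
    and hoelder: "finite L \<Longrightarrow> (\<And>i. i \<in> L \<Longrightarrow> unit_seq i \<in> V) \<Longrightarrow> (\<And>i. i \<in> L \<Longrightarrow> cmod (u i) = 1) \<Longrightarrow>
      (\<And>i. i \<notin> L \<Longrightarrow> u i = 0) \<Longrightarrow> x \<in> V \<Longrightarrow> N u * (\<Sum>i\<in>L. cmod (x i)) \<le> card L * N x"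
    and approx: "finite Y \<Longrightarrow> Y \<subseteq> V \<Longrightarrow> \<delta> > 0 \<Longrightarrow> \<exists>J P. finite (J :: nat set) \<and> (\<forall>r\<in>J. ind_seq (P r) \<in> V) \<and>
      (\<forall>z\<in>V. \<forall>\<theta>. (\<forall>r\<in>J. cmod (\<theta> r) \<le> cmod (z r)) \<longrightarrow> N (\<lambda>i. \<Sum>r\<in>J. \<theta> r * ind_seq (P r) i) \<le> N z) \<and>
      (\<forall>y\<in>Y. N (\<lambda>i. y i - (\<Sum>r\<in>J. y r * ind_seq (P r) i)) \<le> (\<delta> :: real))"
begin

abbreviation "ops \<equiv> bounded_ops V N"
abbreviation "A \<equiv> op_algebra V N"

lemma N_nonneg: "x \<in> V \<Longrightarrow> N x \<ge> 0"
  using coord[of x 0] norm_ge_zero order_trans by blast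

lemma N_eq_0: "x \<in> V \<Longrightarrow> N x = 0 \<Longrightarrow> x = (\<lambda>i. 0)"
  using coord[of x] by auto

lemma N_zero: "N (\<lambda>i. 0) = 0"
  using N_scale[OF zero, of 0] by simp

lemma sum_V: "(\<And>k. k \<in> K \<Longrightarrow> f k \<in> V) \<Longrightarrow> (\<lambda>i. \<Sum>k\<in>K. c k * f k i) \<in> V"
  by (induction K rule: infinite_finite_induct) (simp_all add: zero add scale)

lemma opsD:
  assumes "T \<in> ops"
  shows "x \<in> V \<Longrightarrow> T x \<in> V" and "x \<notin> V \<Longrightarrow> T x = undefined"
    and "x \<in> V \<Longrightarrow> y \<in> V \<Longrightarrow> T (\<lambda>i. x i + y i) = (\<lambda>i. T x i + T y i)"
    and "x \<in> V \<Longrightarrow> T (\<lambda>i. c * x i) = (\<lambda>i. c * T x i)"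
  using assms unfolding bounded_ops_def by (auto simp: PiE_iff extensional_def)

lemma ops_bound:
  assumes "T \<in> ops" obtains K where "K \<ge> 0" "\<And>x. x \<in> V \<Longrightarrow> N (T x) \<le> K * N x"
proof -
  obtain K where K: "\<forall>x\<in>V. N (T x) \<le> K * N x" using assms unfolding bounded_ops_def by blast
  show thesis
  proof (rule that[of "max K 0"])
    fix x assume x: "x \<in> V"
    then have "N (T x) \<le> K * N x" using K by blast
    also have "\<dots> \<le> max K 0 * N x" using N_nonneg[OF x] by (intro mult_right_mono) auto
    finally show "N (T x) \<le> max K 0 * N x" .
  qed simp
qed

lemma opsI:
  assumes "\<And>x. x \<in> V \<Longrightarrow> T x \<in> V" "\<And>x. x \<notin> V \<Longrightarrow> T x = undefined"
    and "\<And>x y. x \<in> V \<Longrightarrow> y \<in> V \<Longrightarrow> T (\<lambda>i. x i + y i) = (\<lambda>i. T x i + T y i)"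
    and "\<And>x c. x \<in> V \<Longrightarrow> T (\<lambda>i. c * x i) = (\<lambda>i. c * T x i)"
    and "\<And>x. x \<in> V \<Longrightarrow> N (T x) \<le> K * N x"
  shows "T \<in> ops"
proof -
  have "\<exists>K. \<forall>x\<in>V. N (T x) \<le> K * N x" using assms(5) by blast
  then show ?thesis unfolding bounded_ops_def using assms(1-4) by (auto simp: PiE_iff extensional_def)
qed

lemma ops_zero: assumes "T \<in> ops" shows "T (\<lambda>i. 0) = (\<lambda>i. 0)"
  using opsD(4)[OF assms zero, of 0] by simp

lemma ops_sum:
  assumes T: "T \<in> ops" and f: "\<And>k. k \<in> K \<Longrightarrow> f k \<in> V"
  shows "T (\<lambda>i. \<Sum>k\<in>K. c k * f k i) = (\<lambda>i. \<Sum>k\<in>K. c k * T (f k) i)"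
  using f
proof (induction K rule: infinite_finite_induct)
  case (insert a K)
  have "T (\<lambda>i. c a * f a i + (\<Sum>k\<in>K. c k * f k i)) = (\<lambda>i. T (\<lambda>i. c a * f a i) i + T (\<lambda>i. \<Sum>k\<in>K. c k * f k i) i)"
    by (rule opsD(3)[OF T]) (use insert in \<open>auto intro: scale sum_V\<close>)
  then show ?case using insert by (simp add: opsD(4)[OF T])
qed (simp_all add: ops_zero[OF T])

lemma ops_diff:
  assumes T: "T \<in> ops" and "x \<in> V" "y \<in> V"
  shows "(\<lambda>i. x i - y i) \<in> V" "T (\<lambda>i. x i - y i) = (\<lambda>i. T x i - T y i)"
proof -
  have "(\<lambda>i. (-1) * y i) \<in> V" using assms by (intro scale)
  then show "(\<lambda>i. x i - y i) \<in> V" "T (\<lambda>i. x i - y i) = (\<lambda>i. T x i - T y i)"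
    using add[OF assms(2), of "\<lambda>i. (-1) * y i"] opsD(3)[OF T assms(2), of "\<lambda>i. (-1) * y i"]
      opsD(4)[OF T assms(3), of "-1"] by simp_all
qed

lemma op_norm_bdd: assumes "T \<in> ops" shows "bdd_above ((\<lambda>x. N (T x)) ` {x \<in> V. N x \<le> 1})"
proof -
  obtain K where K: "K \<ge> 0" "\<And>x. x \<in> V \<Longrightarrow> N (T x) \<le> K * N x" using ops_bound[OF assms] by blast
  have "N (T x) \<le> K" if "x \<in> V" "N x \<le> 1" for x
    using K(2)[OF that(1)] mult_left_mono[OF that(2) K(1)] by simp
  then show ?thesis by (intro bdd_aboveI[of _ K]) auto
qed

lemma op_norm_nonneg: assumes "T \<in> ops" shows "op_norm V N T \<ge> 0"
proof -
  have "N (T (\<lambda>i. 0)) \<le> op_norm V N T" unfolding op_norm_def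
    by (rule cSUP_upper[OF _ op_norm_bdd[OF assms]]) (simp add: zero N_zero)
  then show ?thesis by (simp add: ops_zero[OF assms] N_zero)
qed

lemma op_norm_bound: assumes T: "T \<in> ops" and x: "x \<in> V" shows "N (T x) \<le> op_norm V N T * N x"
proof (cases "N x = 0")
  case True
  then show ?thesis using N_eq_0[OF x] by (simp add: ops_zero[OF T] N_zero)
next
  case False
  then have pos: "N x > 0" using N_nonneg[OF x] by simp
  let ?c = "complex_of_real (1 / N x)"
  let ?y = "\<lambda>i. ?c * x i"
  have cn: "cmod ?c = 1 / N x" using pos by (simp only: norm_of_real) simp
  have y: "?y \<in> V" "N ?y = 1" using x pos by (simp_all only: scale N_scale cn) simp
  have "N (T ?y) \<le> op_norm V N T" unfolding op_norm_def
    by (rule cSUP_upper[OF _ op_norm_bdd[OF T]]) (use y in simp)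
  moreover have "N (T ?y) = 1 / N x * N (T x)"
    by (simp only: opsD(4)[OF T x] N_scale[OF opsD(1)[OF T x]] cn)
  ultimately have "1 / N x * N (T x) \<le> op_norm V N T" by (simp only:)
  then show ?thesis using pos by (simp add: field_simps)
qed

lemma op_norm_le:
  assumes "K \<ge> 0" "\<And>x. x \<in> V \<Longrightarrow> N (T x) \<le> K * N x" shows "op_norm V N T \<le> K"
  unfolding op_norm_def
proof (rule cSUP_least)
  show "{x \<in> V. N x \<le> 1} \<noteq> {}" using zero N_zero by (auto intro!: exI[of _ "\<lambda>i. 0"])
  fix x assume x: "x \<in> {x \<in> V. N x \<le> 1}"
  then show "N (T x) \<le> K" using assms(2)[of x] mult_left_mono[of "N x" 1 K] assms(1) by auto
qed

lemma mult_ops: assumes S: "S \<in> ops" and T: "T \<in> ops"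
  shows "compose V S T \<in> ops" "op_norm V N (compose V S T) \<le> op_norm V N S * op_norm V N T"
proof -
  have b: "N (compose V S T x) \<le> (op_norm V N S * op_norm V N T) * N x" if x: "x \<in> V" for x
  proof -
    have "N (S (T x)) \<le> op_norm V N S * N (T x)" by (rule op_norm_bound[OF S opsD(1)[OF T x]])
    also have "\<dots> \<le> op_norm V N S * (op_norm V N T * N x)"
      by (intro mult_left_mono op_norm_bound T x op_norm_nonneg S)
    finally show ?thesis using x by (simp add: compose_eq mult.assoc)
  qed
  show "compose V S T \<in> ops"
    by (rule opsI[OF _ _ _ _ b]) (auto simp: compose_def opsD[OF S] opsD[OF T] add scale)
  show "op_norm V N (compose V S T) \<le> op_norm V N S * op_norm V N T"
    by (rule op_norm_le[OF _ b]) (auto intro: mult_nonneg_nonneg op_norm_nonneg S T)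
qed

lemma add_ops: assumes S: "S \<in> ops" and T: "T \<in> ops"
  shows "(\<lambda>x\<in>V. \<lambda>i. S x i + T x i) \<in> ops"
    "op_norm V N (\<lambda>x\<in>V. \<lambda>i. S x i + T x i) \<le> 4 * (op_norm V N S + op_norm V N T)"
proof -
  let ?U = "\<lambda>x\<in>V. \<lambda>i. S x i + T x i"
  have b: "N (?U x) \<le> (4 * (op_norm V N S + op_norm V N T)) * N x" if x: "x \<in> V" for x
  proof -
    have "N (?U x) \<le> 4 * (N (S x) + N (T x))" using N_add[OF opsD(1)[OF S x] opsD(1)[OF T x]] x by simp
    also have "\<dots> \<le> 4 * (op_norm V N S * N x + op_norm V N T * N x)"
      using op_norm_bound[OF S x] op_norm_bound[OF T x] by simp
    finally show ?thesis by (simp add: algebra_simps)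
  qed
  show "?U \<in> ops"
    by (rule opsI[OF _ _ _ _ b]) (auto simp: opsD[OF S] opsD[OF T] add scale fun_eq_iff algebra_simps)
  show "op_norm V N ?U \<le> 4 * (op_norm V N S + op_norm V N T)"
    by (rule op_norm_le[OF _ b]) (auto simp: op_norm_nonneg S T)
qed

lemma smult_ops: assumes T: "T \<in> ops"
  shows "(\<lambda>x\<in>V. \<lambda>i. c * T x i) \<in> ops" "op_norm V N (\<lambda>x\<in>V. \<lambda>i. c * T x i) \<le> cmod c * op_norm V N T"
proof -
  let ?U = "\<lambda>x\<in>V. \<lambda>i. c * T x i"
  have b: "N (?U x) \<le> (cmod c * op_norm V N T) * N x" if x: "x \<in> V" for x
    using x mult_left_mono[OF op_norm_bound[OF T x], of "cmod c"]
    by (simp add: N_scale opsD[OF T] mult.assoc)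
  show "?U \<in> ops"
    by (rule opsI[OF _ _ _ _ b]) (auto simp: opsD[OF T] add scale fun_eq_iff algebra_simps)
  show "op_norm V N ?U \<le> cmod c * op_norm V N T"
    by (rule op_norm_le[OF _ b]) (auto simp: op_norm_nonneg T)
qed

lemma zero_ops: "(\<lambda>x\<in>V. \<lambda>i. 0) \<in> ops" "op_norm V N (\<lambda>x\<in>V. \<lambda>i. 0) \<le> 0"
proof -
  show "(\<lambda>x\<in>V. \<lambda>i. 0) \<in> ops"
    by (rule opsI[where K = 0]) (auto simp: zero N_zero add scale)
  show "op_norm V N (\<lambda>x\<in>V. \<lambda>i. 0) \<le> 0" by (rule op_norm_le) (auto simp: N_zero)
qed

definition weighted_perm :: "(nat \<Rightarrow> complex) \<Rightarrow> (nat \<Rightarrow> nat) \<Rightarrow> seq_op" where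
  "weighted_perm c \<pi> = (\<lambda>x\<in>V. \<lambda>i. c i * x (\<pi> i))"

text \<open>The second condition says that an index outside a finite section is not moved into it,
  so the permuted sequence still vanishes there.\<close>

lemma weighted_perm_ops:
  assumes pi: "inj \<pi>" "\<And>i. unit_seq (\<pi> i) \<in> V \<Longrightarrow> unit_seq i \<in> V" and c: "\<And>i. cmod (c i) = 1"
  shows "weighted_perm c \<pi> \<in> ops" "op_norm V N (weighted_perm c \<pi>) \<le> 1"
proof -
  have le: "cmod (c i * y) \<le> cmod y" for i y by (simp add: norm_mult c)
  have m: "(\<lambda>i. c i * x (\<pi> i)) \<in> V" if "x \<in> V" for x
    by (rule solid[OF permute[OF pi that] le])
  have b: "N (weighted_perm c \<pi> x) \<le> 1 * N x" if x: "x \<in> V" for x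
  proof -
    have "N (\<lambda>i. c i * x (\<pi> i)) \<le> N (\<lambda>i. x (\<pi> i))"
      by (rule N_mono[OF permute[OF pi x] le])
    also have "\<dots> \<le> N x" by (rule N_permute[OF pi x])
    finally show ?thesis using x by (simp add: weighted_perm_def)
  qed
  show "weighted_perm c \<pi> \<in> ops"
    by (rule opsI[OF _ _ _ _ b]) (auto simp: weighted_perm_def m add scale fun_eq_iff algebra_simps)
  show "op_norm V N (weighted_perm c \<pi>) \<le> 1" by (rule op_norm_le[OF _ b]) auto
qed

lemma carrier_A [simp]: "carrier A = ops"
  by (simp add: op_algebra_def)

lemma abelian_monoid_A: "abelian_monoid A"
proof (rule abelian_monoidI)
  fix S T U assume S: "S \<in> carrier A" and T: "T \<in> carrier A" and U: "U \<in> carrier A"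
  show "S \<oplus>\<^bsub>A\<^esub> T \<in> carrier A" using S T by (simp add: op_algebra_def add_ops)
  show "(S \<oplus>\<^bsub>A\<^esub> T) \<oplus>\<^bsub>A\<^esub> U = S \<oplus>\<^bsub>A\<^esub> (T \<oplus>\<^bsub>A\<^esub> U)"
    by (simp add: op_algebra_def fun_eq_iff restrict_def add.assoc)
  show "S \<oplus>\<^bsub>A\<^esub> T = T \<oplus>\<^bsub>A\<^esub> S"
    by (simp add: op_algebra_def fun_eq_iff restrict_def add.commute)
next
  show "\<zero>\<^bsub>A\<^esub> \<in> carrier A" by (simp add: op_algebra_def zero_ops)
  fix S assume S: "S \<in> carrier A"
  show "\<zero>\<^bsub>A\<^esub> \<oplus>\<^bsub>A\<^esub> S = S"
    using S by (auto simp: op_algebra_def fun_eq_iff opsD(2))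
qed

text \<open>For fixed signs the phases \<open>\<theta>\<close> align all terms, so the sum over
  \<open>r\<close> becomes the pairing of \<open>a y\<close> with a sign vector.
  \<open>hoelder\<close> bounds \<open>N u\<close> times this by \<open>card (torus m)\<close> times
  both operator norms times \<open>N u\<close>; the cancellation of \<open>N u\<close> removes every
  trace of the exponent.\<close>

lemma block_estimate:
  fixes e :: "int \<times> int \<Rightarrow> nat"
  assumes m: "m \<ge> 1" and e: "inj_on e (torus m)" "\<And>s. s \<in> torus m \<Longrightarrow> unit_seq (e s) \<in> V"
    and J: "finite J" "\<And>r. r \<in> J \<Longrightarrow> ind_seq (P r) \<in> V"
      "\<And>z \<theta>. z \<in> V \<Longrightarrow> (\<And>r. r \<in> J \<Longrightarrow> cmod (\<theta> r) \<le> cmod (z r)) \<Longrightarrow> N (\<lambda>i. \<Sum>r\<in>J. \<theta> r * ind_seq (P r) i) \<le> N z"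
    and a: "a \<in> ops" and b: "b \<in> ops"
  shows "(\<Sum>r\<in>J. sqrt (\<Sum>s\<in>torus m. (cmod (a (ind_seq (P r)) (e s)))\<^sup>2) * sqrt (\<Sum>t\<in>torus m. (cmod (b (unit_seq (e t)) r))\<^sup>2))
     \<le> 4 * (card (torus m) * (op_norm V N a * op_norm V N b))"
proof (rule khinchine_bilinear[where \<alpha> = "\<lambda>s r. a (ind_seq (P r)) (e s)" and \<beta> = "\<lambda>r t. b (unit_seq (e t)) r"])
  fix S S'
  let ?L = "torus m"
  define u where "u = (\<lambda>i. \<Sum>t\<in>?L. sign S' t * unit_seq (e t) i)"
  have uV: "u \<in> V" unfolding u_def by (rule sum_V) (rule e)
  have u1: "u (e t) = sign S' t" if "t \<in> ?L" for t
  proof -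
    have "u (e t) = (\<Sum>t'\<in>?L. if t' = t then sign S' t' else 0)"
      unfolding u_def by (intro sum.cong) (use that e(1) in \<open>auto simp: unit_seq_def inj_on_def\<close>)
    then show ?thesis using that by simp
  qed
  have u0: "u i = 0" if "i \<notin> e ` ?L" for i
    unfolding u_def by (intro sum.neutral) (use that in \<open>auto simp: unit_seq_def\<close>)
  have "(0,0) \<in> ?L" using m by (simp add: torus_def)
  \<comment> \<open>Positivity of \<open>N u\<close> permits the final cancellation.\<close>
  then have Nu: "N u \<ge> 1" using coord[OF uV, of "e (0,0)"] u1[of "(0,0)"] by simp
  define z where "z = b u"
  have zV: "z \<in> V" using opsD(1)[OF b uV] by (simp add: z_def)
  have z: "z r = (\<Sum>t\<in>?L. sign S' t * b (unit_seq (e t)) r)" for r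
    unfolding z_def u_def by (subst ops_sum[OF b]) (use e in auto)
  define w where "w r = (\<Sum>s\<in>?L. sign S s * a (ind_seq (P r)) (e s))" for r
  \<comment> \<open>\<open>cnj (sgn (w r))\<close> rotates \<open>w r\<close> to the positive axis,
    and keeping the modulus of \<open>z r\<close> lets \<open>J(3)\<close> bound the step function
    \<open>y\<close> by \<open>z\<close>.\<close>
  define \<theta> where "\<theta> r = of_real (cmod (z r)) * cnj (sgn (w r))" for r
  have th: "cmod (\<theta> r) \<le> cmod (z r)" for r by (simp add: \<theta>_def norm_mult norm_sgn)
  have tw: "\<theta> r * w r = of_real (cmod (w r) * cmod (z r))" for r
  proof -
    have "cnj (sgn (w r)) * w r = of_real (cmod (w r))"
    proof (cases "w r = 0")
      case False
      have "cnj (sgn (w r)) * w r = of_real ((cmod (w r))\<^sup>2) / of_real (cmod (w r))"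
        unfolding complex_norm_square by (simp add: sgn_eq mult.commute)
      then show ?thesis using False by (simp add: power2_eq_square)
    qed simp
    then show ?thesis by (simp add: \<theta>_def mult.assoc)
  qed
  define y where "y = (\<lambda>i. \<Sum>r\<in>J. \<theta> r * ind_seq (P r) i)"
  have yV: "y \<in> V" unfolding y_def by (rule sum_V) (rule J)
  have Ny: "N y \<le> N z" unfolding y_def by (rule J(3)[OF zV th])
  have ay: "a y (e s) = (\<Sum>r\<in>J. \<theta> r * a (ind_seq (P r)) (e s))" for s
    unfolding y_def by (subst ops_sum[OF a]) (use J in auto)
  have "complex_of_real (\<Sum>r\<in>J. cmod (w r) * cmod (z r)) = (\<Sum>r\<in>J. \<Sum>s\<in>?L. \<theta> r * (sign S s * a (ind_seq (P r)) (e s)))"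
    by (simp only: of_real_sum tw[symmetric]) (simp only: w_def sum_distrib_left)
  also have "\<dots> = (\<Sum>s\<in>?L. sign S s * a y (e s))"
    by (subst sum.swap) (simp add: ay sum_distrib_left mult_ac)
  finally have eq: "complex_of_real (\<Sum>r\<in>J. cmod (w r) * cmod (z r)) = (\<Sum>s\<in>?L. sign S s * a y (e s))" .
  have "\<bar>\<Sum>r\<in>J. cmod (w r) * cmod (z r)\<bar> = cmod (\<Sum>s\<in>?L. sign S s * a y (e s))"
    unfolding eq[symmetric] by (simp only: norm_of_real)
  also have "\<dots> \<le> (\<Sum>s\<in>?L. cmod (a y (e s)))" by (rule sum_norm_le) (simp add: norm_mult)
  also have "\<dots> = (\<Sum>i\<in>e ` ?L. cmod (a y i))" by (simp add: sum.reindex e(1))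
  finally have 1: "(\<Sum>r\<in>J. cmod (w r) * cmod (z r)) \<le> (\<Sum>i\<in>e ` ?L. cmod (a y i))" by simp
  have "N u * (\<Sum>i\<in>e ` ?L. cmod (a y i)) \<le> card (e ` ?L) * N (a y)"
    by (rule hoelder) (use e u1 u0 opsD(1)[OF a yV] in auto)
  also have "\<dots> = card ?L * N (a y)" by (simp add: card_image e(1))
  also have "\<dots> \<le> card ?L * (op_norm V N a * (op_norm V N b * N u))"
  proof (intro mult_left_mono)
    have "N (a y) \<le> op_norm V N a * N y" by (rule op_norm_bound[OF a yV])
    also have "\<dots> \<le> op_norm V N a * (op_norm V N b * N u)"
      using Ny op_norm_bound[OF b uV] op_norm_nonneg[OF a] by (intro mult_left_mono) (auto simp: z_def)
    finally show "N (a y) \<le> op_norm V N a * (op_norm V N b * N u)" .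
  qed simp
  finally have "N u * (\<Sum>i\<in>e ` ?L. cmod (a y i)) \<le> N u * (card ?L * (op_norm V N a * op_norm V N b))"
    by (simp add: mult_ac)
  then have "(\<Sum>i\<in>e ` ?L. cmod (a y i)) \<le> card ?L * (op_norm V N a * op_norm V N b)"
    using Nu by (simp only: mult_le_cancel_left_pos)
  with 1 have "(\<Sum>r\<in>J. cmod (w r) * cmod (z r)) \<le> card ?L * (op_norm V N a * op_norm V N b)" by linarith
  then show "(\<Sum>r\<in>J. cmod (\<Sum>s\<in>?L. sign S s * a (ind_seq (P r)) (e s)) * cmod (\<Sum>t\<in>?L. sign S' t * b (unit_seq (e t)) r))
      \<le> card ?L * (op_norm V N a * op_norm V N b)"
    by (simp only: w_def z)
qed simp

text \<open>\<open>h\<close> is the identity for algebras on \<open>lp\<close> and the projection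
  onto a factor for the product. Outer indices are the coordinates \<open>e s\<close>; the inner
  index runs over the finitely many classes from \<open>approx\<close>, which replace the infinite
  sum in a matrix product.\<close>

lemma block_system_exists:
  fixes C :: "('b, 'm) normed_algebra_scheme" and e :: "int \<times> int \<Rightarrow> nat" and h :: "'b \<Rightarrow> seq_op"
  assumes m: "m \<ge> 1" and B: "finite B" "B \<subseteq> carrier C \<times> carrier C" and d: "\<delta> > 0"
    and e: "inj_on e (torus m)" "\<And>s. s \<in> torus m \<Longrightarrow> unit_seq (e s) \<in> V"
    and h: "\<And>a. a \<in> carrier C \<Longrightarrow> h a \<in> ops"
      "\<And>a b. a \<in> carrier C \<Longrightarrow> b \<in> carrier C \<Longrightarrow> h (a \<oplus>\<^bsub>C\<^esub> b) = h a \<oplus>\<^bsub>A\<^esub> h b"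
      "\<And>a b. a \<in> carrier C \<Longrightarrow> b \<in> carrier C \<Longrightarrow> h (a \<otimes>\<^bsub>C\<^esub> b) = h a \<otimes>\<^bsub>A\<^esub> h b"
      "\<And>c a. a \<in> carrier C \<Longrightarrow> h (c \<odot>\<^bsub>C\<^esub> a) = c \<odot>\<^bsub>A\<^esub> h a"
      "h \<zero>\<^bsub>C\<^esub> = \<zero>\<^bsub>A\<^esub>" "h \<one>\<^bsub>C\<^esub> = \<one>\<^bsub>A\<^esub>"
    and hn: "\<And>a. a \<in> carrier C \<Longrightarrow> op_norm V N (h a) \<le> anorm C a"
    and xc: "\<And>j. j < 6 \<Longrightarrow> x j \<in> carrier C"
    and hx: "\<And>j. j < 6 \<Longrightarrow> h (x j) = weighted_perm (c j) (\<pi> j)"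
    and pi: "\<And>j s. j < 6 \<Longrightarrow> s \<in> torus m \<Longrightarrow> \<pi> j (e s) = e (perm m j s)" "\<And>j. j < 6 \<Longrightarrow> inj (\<pi> j)"
    and c: "\<And>j s. j < 6 \<Longrightarrow> s \<in> torus m \<Longrightarrow> c j (e s) = phase m j s"
  shows "\<exists>J \<alpha> \<beta> ev. block_system C x m B \<delta> J \<alpha> \<beta> ev"
proof -
  let ?L = "torus m"
  have m0: "m \<ge> 0" using m by simp
  \<comment> \<open>\<open>K\<close> dominates the norms of all left factors in \<open>B\<close>;
    the summand \<open>1\<close> makes it safe to divide by.\<close>
  define K where "K = 1 + (\<Sum>(a,b)\<in>B. op_norm V N (h a))"
  have aK: "op_norm V N (h a) \<le> K" if "(a, b) \<in> B" for a b
  proof -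
    have "op_norm V N (h a) \<le> (\<Sum>(a,b)\<in>B. op_norm V N (h a))"
    proof -
      have "0 \<le> (\<lambda>(a,b). op_norm V N (h a)) q" if "q \<in> B - {(a,b)}" for q
        using that B h(1) op_norm_nonneg by auto
      then show ?thesis using member_le_sum[of "(a,b)" B "\<lambda>(a,b). op_norm V N (h a)"] that B(1) by simp
    qed
    then show ?thesis by (simp add: K_def)
  qed
  have K0: "K > 0" unfolding K_def
  proof (rule add_pos_nonneg)
    show "0 \<le> (\<Sum>(a,b)\<in>B. op_norm V N (h a))"
      by (rule sum_nonneg) (use B h op_norm_nonneg in auto)
  qed simp
  \<comment> \<open>Only the columns of the right factors have to be approximated; a left factor
    then enlarges the error by at most \<open>K\<close>.\<close>
  let ?Y = "(\<lambda>(p, s). h (snd p) (unit_seq (e s))) ` (B \<times> ?L)"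
  have "finite ?Y" "?Y \<subseteq> V" "\<delta> / K > 0" using B e h opsD(1) d K0 by auto
  from approx[OF this] obtain J P where J': "finite J" "\<forall>r\<in>J. ind_seq (P r) \<in> V"
      "\<forall>z\<in>V. \<forall>\<theta>. (\<forall>r\<in>J. cmod (\<theta> r) \<le> cmod (z r)) \<longrightarrow> N (\<lambda>i. \<Sum>r\<in>J. \<theta> r * ind_seq (P r) i) \<le> N z"
      "\<forall>y\<in>?Y. N (\<lambda>i. y i - (\<Sum>r\<in>J. y r * ind_seq (P r) i)) \<le> \<delta> / K"
    by (elim exE conjE) (rule that)
  have J: "finite J" "\<And>r. r \<in> J \<Longrightarrow> ind_seq (P r) \<in> V"
      "\<And>z \<theta>. z \<in> V \<Longrightarrow> (\<And>r. r \<in> J \<Longrightarrow> cmod (\<theta> r) \<le> cmod (z r)) \<Longrightarrow> N (\<lambda>i. \<Sum>r\<in>J. \<theta> r * ind_seq (P r) i) \<le> N z"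
      "\<And>y. y \<in> ?Y \<Longrightarrow> N (\<lambda>i. y i - (\<Sum>r\<in>J. y r * ind_seq (P r) i)) \<le> \<delta> / K"
    using J' by (blast, blast, simp, blast)
  \<comment> \<open>\<open>block_system\<close> requires linearity for every \<open>r\<close>, also
    outside \<open>J\<close>, where the empty set yields the zero sequence.\<close>
  define P' where "P' r = (if r \<in> J then P r else {})" for r
  have P'V: "ind_seq (P' r) \<in> V" for r using J(2) zero by (auto simp: P'_def ind_seq_def[of "{}"])
  have uV: "unit_seq (e s) \<in> V" if "s \<in> ?L" for s using e that by blast
  define \<alpha> where "\<alpha> a s r = (if s \<in> ?L then h a (ind_seq (P' r)) (e s) else 0)" for a s r
  define \<beta> where "\<beta> b r t = (if t \<in> ?L then h b (unit_seq (e t)) r else 0)" for b t r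
  define ev where "ev s a = h a (unit_seq (e s)) (e s)" for s a
  have ad: "(S \<oplus>\<^bsub>A\<^esub> T) y i = S y i + T y i" "(k \<odot>\<^bsub>A\<^esub> T) y i = k * T y i" "(S \<otimes>\<^bsub>A\<^esub> T) y = S (T y)"
    if "y \<in> V" for S T y i k using that by (simp_all add: op_algebra_def compose_eq)
  have "block_system C x m B \<delta> J \<alpha> \<beta> ev"
    unfolding block_system_def
  proof (intro conjI ballI allI impI; (clarify)?)
    show "finite J" by (rule J)
  next
    fix a a' s r assume "a \<in> carrier C" "a' \<in> carrier C"
    then show "\<alpha> (a \<oplus>\<^bsub>C\<^esub> a') s r = \<alpha> a s r + \<alpha> a' s r" by (simp add: \<alpha>_def h ad[OF P'V])
  next
    fix a k s r assume "a \<in> carrier C"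
    then show "\<alpha> (k \<odot>\<^bsub>C\<^esub> a) s r = k * \<alpha> a s r" by (simp add: \<alpha>_def h ad[OF P'V])
  next
    fix a a' r t assume "a \<in> carrier C" "a' \<in> carrier C"
    then show "\<beta> (a \<oplus>\<^bsub>C\<^esub> a') r t = \<beta> a r t + \<beta> a' r t" by (simp add: \<beta>_def h ad[OF uV])
  next
    fix a k r t assume "a \<in> carrier C"
    then show "\<beta> (k \<odot>\<^bsub>C\<^esub> a) r t = k * \<beta> a r t" by (simp add: \<beta>_def h ad[OF uV])
  next
    fix j a s r assume "j < (6::nat)" "a \<in> carrier C" "s \<in> torus m"
    then show "\<alpha> (x j \<otimes>\<^bsub>C\<^esub> a) s r = phase m j s * \<alpha> a (perm m j s) r"
      by (simp add: \<alpha>_def h xc ad[OF P'V] hx weighted_perm_def opsD(1)[OF h(1) P'V] perm_torus[OF m0] pi c)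
  next
    fix j b t r assume j: "j < (6::nat)" and b: "b \<in> carrier C" and t: "t \<in> torus m"
    \<comment> \<open>As a composition operator the generator moves basis vectors against
      \<open>perm\<close>, from \<open>perm m j t\<close> back to \<open>t\<close>.\<close>
    have "h (x j) (unit_seq (e (perm m j t))) = (\<lambda>i. phase m j t * unit_seq (e t) i)"
    proof
      fix i
      have "\<pi> j i = e (perm m j t) \<longleftrightarrow> i = e t"
        using pi(1)[OF j t] pi(2)[OF j] by (auto simp: inj_def)
      then show "h (x j) (unit_seq (e (perm m j t))) i = phase m j t * unit_seq (e t) i"
        using uV[OF perm_torus[OF m0 t], of j] c[OF j t] by (simp add: hx[OF j] weighted_perm_def unit_seq_def)
    qed
    then show "\<beta> (b \<otimes>\<^bsub>C\<^esub> x j) r (perm m j t) = \<beta> b r t * phase m j t"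
      using t b j by (simp add: \<beta>_def h xc perm_torus[OF m0] ad[OF uV] opsD(4)[OF h(1)[OF b] uV[OF t]])
  next
    fix a b assume a: "a \<in> carrier C" and b: "b \<in> carrier C"
    have "(\<Sum>r\<in>J. sqrt (\<Sum>s\<in>?L. (cmod (\<alpha> a s r))\<^sup>2) * sqrt (\<Sum>t\<in>?L. (cmod (\<beta> b r t))\<^sup>2))
      = (\<Sum>r\<in>J. sqrt (\<Sum>s\<in>?L. (cmod (h a (ind_seq (P r)) (e s)))\<^sup>2) * sqrt (\<Sum>t\<in>?L. (cmod (h b (unit_seq (e t)) r))\<^sup>2))"
      by (intro sum.cong refl) (simp add: \<alpha>_def \<beta>_def P'_def)
    also have "\<dots> \<le> 4 * (card ?L * (op_norm V N (h a) * op_norm V N (h b)))"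
      by (rule block_estimate[OF m e J(1,2,3)]) (use a b h in auto)
    also have "\<dots> \<le> 4 * (card ?L * (anorm C a * anorm C b))"
    proof -
      have "op_norm V N (h a) * op_norm V N (h b) \<le> anorm C a * anorm C b"
        using hn[OF a] hn[OF b] op_norm_nonneg[OF h(1)[OF a]] op_norm_nonneg[OF h(1)[OF b]]
        by (intro mult_mono) auto
      then show ?thesis by (simp add: mult_left_mono)
    qed
    finally show "(\<Sum>r\<in>J. sqrt (\<Sum>s\<in>?L. (cmod (\<alpha> a s r))\<^sup>2) * sqrt (\<Sum>t\<in>?L. (cmod (\<beta> b r t))\<^sup>2))
        \<le> 4 * (card ?L * (anorm C a * anorm C b))" .
  next
    fix a a' s assume "a \<in> carrier C" "a' \<in> carrier C" "s \<in> ?L"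
    then show "ev s (a \<oplus>\<^bsub>C\<^esub> a') = ev s a + ev s a'" by (simp add: ev_def h ad[OF uV])
  next
    fix s assume "s \<in> ?L"
    then show "ev s \<zero>\<^bsub>C\<^esub> = 0" "ev s \<one>\<^bsub>C\<^esub> = 1"
      using uV by (simp_all add: ev_def h op_algebra_def) (simp add: unit_seq_def)
  next
    fix a b s assume ab: "(a, b) \<in> B" and s: "s \<in> ?L"
    then have ca: "a \<in> carrier C" "b \<in> carrier C" using B by auto
    define y where "y = h b (unit_seq (e s))"
    have yY: "y \<in> ?Y" unfolding y_def by (rule image_eqI[of _ _ "((a,b),s)"]) (use ab s in auto)
    have yV: "y \<in> V" unfolding y_def by (rule opsD(1)[OF h(1)[OF ca(2)] uV[OF s]])
    let ?g = "\<lambda>i. \<Sum>r\<in>J. y r * ind_seq (P r) i"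
    have gV: "?g \<in> V" by (rule sum_V) (rule J)
    have "(\<Sum>r\<in>J. \<alpha> a s r * \<beta> b r s) = h a ?g (e s)"
    proof -
      have "h a ?g = (\<lambda>i. \<Sum>r\<in>J. y r * h a (ind_seq (P r)) i)"
        by (rule ops_sum[OF h(1)[OF ca(1)]]) (rule J(2))
      then show ?thesis using s
        by (simp only:) (intro sum.cong refl, simp add: \<alpha>_def \<beta>_def P'_def y_def)
    qed
    moreover have "ev s (a \<otimes>\<^bsub>C\<^esub> b) = h a y (e s)"
      using ca s by (simp add: ev_def h ad[OF uV] y_def)
    ultimately have "ev s (a \<otimes>\<^bsub>C\<^esub> b) - (\<Sum>r\<in>J. \<alpha> a s r * \<beta> b r s) = h a (\<lambda>i. y i - ?g i) (e s)"
      by (simp add: ops_diff(2)[OF h(1)[OF ca(1)] yV gV])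
    also have "cmod \<dots> \<le> N (h a (\<lambda>i. y i - ?g i))"
      by (intro coord opsD(1)[OF h(1)[OF ca(1)]] ops_diff(1)[OF h(1)[OF ca(1)] yV gV])
    also have "\<dots> \<le> op_norm V N (h a) * N (\<lambda>i. y i - ?g i)"
      by (intro op_norm_bound h ca ops_diff(1)[OF h(1)[OF ca(1)] yV gV])
    also have "\<dots> \<le> K * (\<delta> / K)"
      using aK[OF ab] J(4)[OF yY] K0 N_nonneg[OF ops_diff(1)[OF h(1)[OF ca(1)] yV gV]]
      by (intro mult_mono) auto
    also have "\<dots> = \<delta>" using K0 by simp
    finally show "cmod (ev s (a \<otimes>\<^bsub>C\<^esub> b) - (\<Sum>r\<in>J. \<alpha> a s r * \<beta> b r s)) \<le> \<delta>" .
  qed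
  then show ?thesis by blast
qed

end

text \<open>
  A generator is a single element of the algebra that works for all sizes \<open>m\<close>; it therefore acts on
  a disjoint union \<open>K\<close> of tori, embedded in the natural numbers by \<open>e\<close>.
\<close>

definition torus_perm :: "(int \<times> int \<times> int) set \<Rightarrow> (int \<times> int \<times> int \<Rightarrow> nat) \<Rightarrow> nat \<Rightarrow> nat \<Rightarrow> nat" where
  "torus_perm K e j n = (if n \<in> e ` K then case inv_into K e n of (m, s) \<Rightarrow> e (m, perm m j s) else n)"

definition torus_phase :: "(int \<times> int \<times> int) set \<Rightarrow> (int \<times> int \<times> int \<Rightarrow> nat) \<Rightarrow> nat \<Rightarrow> nat \<Rightarrow> complex" where
  "torus_phase K e j n = (if n \<in> e ` K then case inv_into K e n of (m, s) \<Rightarrow> phase m j s else 1)"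

lemma norm_torus_phase [simp]: "cmod (torus_phase K e j n) = 1"
  by (simp add: torus_phase_def case_prod_unfold)

lemma torus_perm_apply: "inj_on e K \<Longrightarrow> (m, s) \<in> K \<Longrightarrow> torus_perm K e j (e (m, s)) = e (m, perm m j s)"
  by (auto simp: torus_perm_def)

lemma torus_phase_apply: "inj_on e K \<Longrightarrow> (m, s) \<in> K \<Longrightarrow> torus_phase K e j (e (m, s)) = phase m j s"
  by (auto simp: torus_phase_def)

text \<open>Each torus of the union is permuted and all other indices are fixed, so injectivity can
  be checked separately on \<open>e\<close> followed by \<open>K\<close> and on the complement of
  that image.\<close>

lemma inj_torus_perm:
  assumes e: "inj_on e K" and K: "K = Sigma M torus" and M: "\<And>m. m \<in> M \<Longrightarrow> m \<ge> 0"
  shows "inj (torus_perm K e j)"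
proof (rule injI)
  fix x y assume eq: "torus_perm K e j x = torus_perm K e j y"
  have im: "torus_perm K e j n \<in> e ` K \<longleftrightarrow> n \<in> e ` K" for n
  proof (cases "n \<in> e ` K")
    case True
    then obtain m s where n: "n = e (m, s)" "(m, s) \<in> K" by auto
    then have "(m, perm m j s) \<in> K" using perm_torus M by (auto simp: K)
    then show ?thesis using True n by (auto simp: torus_perm_apply[OF e])
  next
    case False
    then show ?thesis by (simp add: torus_perm_def)
  qed
  show "x = y"
  proof (cases "x \<in> e ` K")
    case True
    then have "y \<in> e ` K" using im[of x] im[of y] eq by simp
    with True obtain m s m' s' where xy: "x = e (m, s)" "(m, s) \<in> K" "y = e (m', s')" "(m', s') \<in> K" by auto
    then have pk: "(m, perm m j s) \<in> K" "(m', perm m' j s') \<in> K" using perm_torus M by (auto simp: K)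
    have "e (m, perm m j s) = e (m', perm m' j s')"
      using eq xy by (simp add: torus_perm_apply[OF e])
    then have eqp: "(m, perm m j s) = (m', perm m' j s')" by (rule inj_onD[OF e _ pk])
    have mm: "m = m'" using arg_cong[OF eqp, of fst] by (simp only: fst_conv)
    have "perm m j s = perm m j s'" using arg_cong[OF eqp, of snd] by (simp only: snd_conv mm)
    moreover have "inj_on (perm m j) (torus m)" using bij_perm M xy by (auto simp: bij_betw_def K)
    ultimately have "s = s'" using xy mm by (auto simp: K dest: inj_onD)
    then show ?thesis using xy mm by simp
  next
    case False
    then have "y \<notin> e ` K" using im[of x] im[of y] eq by simp
    then show ?thesis using False eq by (simp add: torus_perm_def)
  qed
qed

section \<open>The spaces of p-summable sequences\<close>

lemma lp_ereal: "lp (ereal P) = {x. summable (\<lambda>i. cmod (x i) powr P)}"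
  by (simp add: lp_def)

lemma lp_norm_ereal: "lp_norm (ereal P) x = suminf (\<lambda>i. cmod (x i) powr P) powr (1 / P)"
  by (simp add: lp_norm_def)

text \<open>Jensen's inequality for the strictly positive terms. Restoring the zero terms costs a
  power \<open>1 / P\<close> of the ratio of cardinalities, which is at most the ratio itself
  because that is at least \<open>1\<close>.\<close>

lemma power_mean:
  fixes x :: "'a \<Rightarrow> real"
  assumes L: "finite L" and P: "P \<ge> 1" and x: "\<And>i. i \<in> L \<Longrightarrow> x i \<ge> 0"
  shows "real (card L) powr (1 / P) * (\<Sum>i\<in>L. x i) \<le> card L * (\<Sum>i\<in>L. x i powr P) powr (1 / P)"
proof -
  let ?M = "{i \<in> L. x i > 0}"
  let ?c = "real (card L)" and ?d = "real (card ?M)"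
  have M: "finite ?M" using L by simp
  have s1: "(\<Sum>i\<in>L. x i) = (\<Sum>i\<in>?M. x i)"
    by (rule sum.mono_neutral_right) (use L x in \<open>auto simp: less_eq_real_def\<close>)
  have s2: "(\<Sum>i\<in>L. x i powr P) = (\<Sum>i\<in>?M. x i powr P)" (is "_ = ?S")
    by (rule sum.mono_neutral_right) (use L x in \<open>auto simp: less_eq_real_def\<close>)
  have S0: "?S \<ge> 0" by (intro sum_nonneg) simp
  have cd: "?d \<le> ?c" using L by (simp add: card_mono)
  show ?thesis
  proof (cases "?M = {}")
    case True
    then have "(\<Sum>i\<in>L. x i) = 0" unfolding s1 by (simp only: sum.empty)
    then show ?thesis by simp
  next
    case False
    then have d: "?d > 0" using M by (simp add: card_gt_0_iff)
    have "(\<Sum>i\<in>?M. (1 / ?d) *\<^sub>R x i) powr P \<le> (\<Sum>i\<in>?M. (1 / ?d) * (x i powr P))"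
      by (rule convex_on_sum[OF M False powr_convex[OF P]]) (use d in auto)
    then have "((\<Sum>i\<in>?M. x i) / ?d) powr P \<le> ?S / ?d" by (simp flip: sum_divide_distrib)
    then have "(((\<Sum>i\<in>?M. x i) / ?d) powr P) powr (1 / P) \<le> (?S / ?d) powr (1 / P)"
      using P by (intro powr_mono2) auto
    moreover have "(\<Sum>i\<in>?M. x i) \<ge> 0" by (intro sum_nonneg) auto
    ultimately have "(\<Sum>i\<in>?M. x i) / ?d \<le> (?S / ?d) powr (1 / P)"
      using P by (simp add: powr_powr powr_one)
    also have "\<dots> = ?S powr (1 / P) / ?d powr (1 / P)"
      using S0 d by (simp add: powr_divide)
    finally have "?d powr (1 / P) * (\<Sum>i\<in>?M. x i) \<le> ?d * ?S powr (1 / P)"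
      using d by (simp add: field_simps)
    then have "(?c / ?d) powr (1 / P) * (?d powr (1 / P) * (\<Sum>i\<in>?M. x i)) \<le> (?c / ?d) powr (1 / P) * (?d * ?S powr (1 / P))"
      by (rule mult_left_mono) simp
    moreover have "(?c / ?d) powr (1 / P) * (?d powr (1 / P) * (\<Sum>i\<in>?M. x i)) = ?c powr (1 / P) * (\<Sum>i\<in>?M. x i)"
      using d by (simp add: powr_divide)
    moreover have "(?c / ?d) powr (1 / P) \<le> ?c / ?d"
    proof -
      have "(?c / ?d) powr (1 / P) \<le> (?c / ?d) powr 1"
        using cd d P by (intro powr_mono) auto
      then show ?thesis using d by simp
    qed
    then have "(?c / ?d) powr (1 / P) * (?d * ?S powr (1 / P)) \<le> (?c / ?d) * (?d * ?S powr (1 / P))"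
      using d by (intro mult_right_mono) auto
    ultimately show ?thesis unfolding s1 s2 using d by simp
  qed
qed

lemma powr_add_le:
  fixes a b P :: real
  assumes "a \<ge> 0" "b \<ge> 0" "P \<ge> 1"
  shows "(a + b) powr P \<le> 2 powr P * (a powr P + b powr P)"
proof -
  have "(a + b) powr P \<le> (2 * max a b) powr P" using assms by (intro powr_mono2) auto
  also have "\<dots> = 2 powr P * (max a b powr P)" by (simp add: powr_mult)
  also have "\<dots> \<le> 2 powr P * (a powr P + b powr P)" by (intro mult_left_mono) (auto simp: max_def)
  finally show ?thesis .
qed

lemma seq_space_lp_finite:
  assumes P: "P \<ge> 1" shows "seq_space (lp (ereal P)) (lp_norm (ereal P))"
proof -
  let ?V = "lp (ereal P)" and ?N = "lp_norm (ereal P)"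
  let ?s = "\<lambda>x i. cmod (x i) powr P"
  have V: "x \<in> ?V \<longleftrightarrow> summable (?s x)" for x by (simp add: lp_ereal)
  have N: "?N x = suminf (?s x) powr (1 / P)" for x by (rule lp_norm_ereal)
  have S0: "suminf (?s x) \<ge> 0" if "x \<in> ?V" for x using that by (intro suminf_nonneg) (auto simp: V)
  have NP: "?N x powr P = suminf (?s x)" if "x \<in> ?V" for x
    using S0[OF that] P by (simp add: N powr_powr)
  have sc: "?s (\<lambda>i. c * x i) = (\<lambda>i. cmod c powr P * ?s x i)" for c x
    by (simp add: norm_mult powr_mult)
  have so: "y \<in> ?V" if "x \<in> ?V" "\<And>i. cmod (y i) \<le> cmod (x i)" for x y
  proof -
    have "summable (?s y)"
      by (rule summable_comparison_test[OF _ that(1)[unfolded V]])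
        (use P that(2) in \<open>auto intro!: exI[of _ 0] powr_mono2\<close>)
    then show ?thesis by (simp add: V)
  qed
  have mo: "?N y \<le> ?N x" if "x \<in> ?V" "\<And>i. cmod (y i) \<le> cmod (x i)" for x y
  proof -
    have "suminf (?s y) \<le> suminf (?s x)"
      by (rule suminf_le) (use P that so[OF that] in \<open>auto simp: V intro!: powr_mono2\<close>)
    then show ?thesis unfolding N using P S0[OF so[OF that]] by (intro powr_mono2) auto
  qed
  have ad: "summable (?s (\<lambda>i. x i + y i))" "suminf (?s (\<lambda>i. x i + y i)) \<le> 2 powr P * (suminf (?s x) + suminf (?s y))"
    if "x \<in> ?V" "y \<in> ?V" for x y
  proof -
    have le: "?s (\<lambda>i. x i + y i) i \<le> 2 powr P * (?s x i + ?s y i)" for i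
    proof -
      have "?s (\<lambda>i. x i + y i) i \<le> (cmod (x i) + cmod (y i)) powr P"
        using P norm_triangle_ineq by (intro powr_mono2) auto
      also have "\<dots> \<le> 2 powr P * (?s x i + ?s y i)" using P by (intro powr_add_le) auto
      finally show ?thesis .
    qed
    have sm: "summable (\<lambda>i. 2 powr P * (?s x i + ?s y i))"
      using that by (intro summable_mult summable_add) (auto simp: V)
    show 1: "summable (?s (\<lambda>i. x i + y i))"
      by (rule summable_comparison_test[OF _ sm]) (use le in \<open>auto intro!: exI[of _ 0]\<close>)
    have "suminf (?s (\<lambda>i. x i + y i)) \<le> suminf (\<lambda>i. 2 powr P * (?s x i + ?s y i))"
      by (rule suminf_le[OF le 1 sm])
    also have "\<dots> = 2 powr P * (suminf (?s x) + suminf (?s y))"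
      using that by (subst suminf_mult) (auto simp: V summable_add suminf_add)
    finally show "suminf (?s (\<lambda>i. x i + y i)) \<le> 2 powr P * (suminf (?s x) + suminf (?s y))" .
  qed
  have ind: "unit_seq i \<in> ?V" for i
    unfolding V by (rule summable_finite[of "{i}"]) (auto simp: unit_seq_def)
  show ?thesis
  proof
    show "(\<lambda>i. 0) \<in> ?V" by (simp add: V)
    fix x y c assume x: "x \<in> ?V"
    show "(\<lambda>i. c * x i) \<in> ?V" using x unfolding V sc by (rule summable_mult)
    show "?N (\<lambda>i. c * x i) = cmod c * ?N x"
      unfolding N sc using x P S0[OF x] by (simp add: suminf_mult V powr_mult powr_powr)
    {
      assume y: "y \<in> ?V"
      show "(\<lambda>i. x i + y i) \<in> ?V" using ad(1)[OF x y] by (simp add: V)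
      have M: "?N x \<ge> 0" "?N y \<ge> 0" by (simp_all add: N)
      have "suminf (?s (\<lambda>i. x i + y i)) \<le> 2 powr P * (?N x powr P + ?N y powr P)"
        using ad(2)[OF x y] by (simp add: NP x y)
      \<comment> \<open>Both powers are bounded by the power of the larger norm; the two factors 2
        combine to the 4 of the locale.\<close>
      also have "\<dots> \<le> 2 powr P * (2 powr P * max (?N x) (?N y) powr P)"
      proof (rule mult_left_mono)
        have "?N x powr P \<le> max (?N x) (?N y) powr P" "?N y powr P \<le> max (?N x) (?N y) powr P"
          using M P by (auto intro!: powr_mono2)
        moreover have "(2::real) \<le> 2 powr P" using P powr_mono[of 1 P 2] by simp
        then have "2 * max (?N x) (?N y) powr P \<le> 2 powr P * max (?N x) (?N y) powr P"
          by (rule mult_right_mono) simp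
        ultimately show "?N x powr P + ?N y powr P \<le> 2 powr P * max (?N x) (?N y) powr P" by linarith
      qed simp
      also have "\<dots> = (4 * max (?N x) (?N y)) powr P"
        using powr_mult[of 2 2 P] by (simp add: powr_mult)
      finally have "suminf (?s (\<lambda>i. x i + y i)) powr (1 / P) \<le> ((4 * max (?N x) (?N y)) powr P) powr (1 / P)"
        using P suminf_nonneg[OF ad(1)[OF x y]] by (intro powr_mono2) auto
      also have "\<dots> = 4 * max (?N x) (?N y)" using P M by (simp add: powr_powr)
      also have "\<dots> \<le> 4 * (?N x + ?N y)" using M by auto
      finally show "?N (\<lambda>i. x i + y i) \<le> 4 * (?N x + ?N y)" by (simp add: N)
    }
    show "cmod (x i) \<le> ?N x" for i
    proof -
      have "?s x i \<le> suminf (?s x)" using sum_le_suminf[of "?s x" "{i}"] x by (simp add: V)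
      then have "(?s x i) powr (1 / P) \<le> ?N x" unfolding N using P by (intro powr_mono2) auto
      then show ?thesis using P by (simp add: powr_powr)
    qed
    show "y \<in> ?V" if "\<And>i. cmod (y i) \<le> cmod (x i)" using so[OF x that] .
    show "?N y \<le> ?N x" if "\<And>i. cmod (y i) \<le> cmod (x i)" using mo[OF x that] .
    show "(\<lambda>i. x (\<pi> i)) \<in> ?V" if "inj \<pi>" for \<pi>
      using summable_reindex[of "?s x" \<pi>] x that by (simp add: V o_def)
    show "?N (\<lambda>i. x (\<pi> i)) \<le> ?N x" if "inj \<pi>" for \<pi>
    proof -
      have s: "summable (?s (\<lambda>i. x (\<pi> i)))" using summable_reindex[of "?s x" \<pi>] x that by (simp add: V o_def)
      have "suminf (?s (\<lambda>i. x (\<pi> i))) \<le> suminf (?s x)"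
        using suminf_reindex_mono[of "?s x" \<pi>] x that by (simp add: V o_def)
      then show ?thesis unfolding N using P suminf_nonneg[OF s] by (intro powr_mono2) auto
    qed
    fix L :: "nat set" and u :: "nat \<Rightarrow> complex"
    assume L: "finite L" and u1: "\<And>i. i \<in> L \<Longrightarrow> cmod (u i) = 1" and u0: "\<And>i. i \<notin> L \<Longrightarrow> u i = 0"
    have "suminf (?s u) = (\<Sum>i\<in>L. ?s u i)" by (rule suminf_finite[OF L]) (simp add: u0)
    then have "suminf (?s u) = card L" by (simp add: u1)
    then have "?N u * (\<Sum>i\<in>L. cmod (x i)) = real (card L) powr (1 / P) * (\<Sum>i\<in>L. cmod (x i))" by (simp add: N)
    also have "\<dots> \<le> card L * (\<Sum>i\<in>L. ?s x i) powr (1 / P)" by (rule power_mean[OF L P]) simp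
    also have "\<dots> \<le> card L * ?N x"
    proof (rule mult_left_mono)
      have "(\<Sum>i\<in>L. ?s x i) \<le> suminf (?s x)" by (rule sum_le_suminf) (use x L in \<open>auto simp: V\<close>)
      then show "(\<Sum>i\<in>L. ?s x i) powr (1 / P) \<le> ?N x" unfolding N using P by (intro powr_mono2 sum_nonneg) auto
    qed simp
    finally show "?N u * (\<Sum>i\<in>L. cmod (x i)) \<le> card L * ?N x" .
  next
    fix Y :: "(nat \<Rightarrow> complex) set" and \<delta> :: real
    assume Y: "finite Y" "Y \<subseteq> ?V" and d: "\<delta> > 0"
    \<comment> \<open>For a finite exponent truncation is enough: the tails of finitely many
      sequences are uniformly small, and the classes are singletons.\<close>
    have "\<exists>n. \<forall>k\<ge>n. norm (suminf (\<lambda>i. ?s y (i + k))) < \<delta> powr P" if "y \<in> Y" for y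
      using that Y d by (intro suminf_exist_split) (auto simp: V[symmetric])
    then obtain n where n: "\<And>y k. y \<in> Y \<Longrightarrow> k \<ge> n y \<Longrightarrow> norm (suminf (\<lambda>i. ?s y (i + k))) < \<delta> powr P"
      by metis
    define M where "M = (\<Sum>y\<in>Y. n y)"
    have nM: "n y \<le> M" if "y \<in> Y" for y unfolding M_def using Y that by (intro member_le_sum) auto
    have cut: "(\<Sum>r\<in>{..<M}. \<theta> r * ind_seq {r} i) = (if i < M then \<theta> i else 0)" for \<theta> i
    proof -
      have "(\<Sum>r\<in>{..<M}. \<theta> r * ind_seq {r} i) = (\<Sum>r\<in>{..<M}. if r = i then \<theta> i else 0)"
        by (intro sum.cong) (auto simp: ind_seq_def)
      then show ?thesis by simp
    qed
    show "\<exists>J Q. finite (J :: nat set) \<and> (\<forall>r\<in>J. ind_seq (Q r) \<in> ?V) \<and>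
      (\<forall>z\<in>?V. \<forall>\<theta>. (\<forall>r\<in>J. cmod (\<theta> r) \<le> cmod (z r)) \<longrightarrow> ?N (\<lambda>i. \<Sum>r\<in>J. \<theta> r * ind_seq (Q r) i) \<le> ?N z) \<and>
      (\<forall>y\<in>Y. ?N (\<lambda>i. y i - (\<Sum>r\<in>J. y r * ind_seq (Q r) i)) \<le> \<delta>)"
    proof (rule exI[of _ "{..<M}"], rule exI[of _ "\<lambda>r. {r}"], intro conjI ballI allI impI)
      show "finite {..<M}" by simp
      show "ind_seq {r} \<in> ?V" for r using ind[of r] by (simp add: ind_seq_def unit_seq_def)
      show "?N (\<lambda>i. \<Sum>r\<in>{..<M}. \<theta> r * ind_seq {r} i) \<le> ?N z"
        if "z \<in> ?V" "\<forall>r\<in>{..<M}. cmod (\<theta> r) \<le> cmod (z r)" for z \<theta>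
        unfolding cut by (rule mo[OF that(1)]) (use that(2) in auto)
      fix y assume y: "y \<in> Y"
      let ?t = "\<lambda>i. if i < M then 0 else y i"
      have "summable (?s ?t)" using so[of y ?t] y Y by (auto simp: V[symmetric])
      then have "suminf (?s ?t) = suminf (\<lambda>i. ?s ?t (i + M)) + (\<Sum>i<M. ?s ?t i)"
        by (rule suminf_split_initial_segment)
      also have "\<dots> = suminf (\<lambda>i. ?s y (i + M))" by simp
      also have "\<dots> \<le> \<delta> powr P" using n[OF y nM[OF y]] by simp
      finally have "suminf (?s ?t) powr (1 / P) \<le> (\<delta> powr P) powr (1 / P)"
        using P suminf_nonneg[OF \<open>summable (?s ?t)\<close>] by (intro powr_mono2) auto
      then have "?N ?t \<le> \<delta>" using P d by (simp add: N powr_powr)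
      moreover have "(\<lambda>i. y i - (\<Sum>r\<in>{..<M}. y r * ind_seq {r} i)) = ?t" unfolding cut by auto
      ultimately show "?N (\<lambda>i. y i - (\<Sum>r\<in>{..<M}. y r * ind_seq {r} i)) \<le> \<delta>" by simp
    qed
  qed
qed

text \<open>Truncation fails for bounded sequences, so \<open>approx\<close> is obtained by
  quantisation: values are rounded to a grid, and indices at which all sequences of \<open>Y\<close>
  round alike form a class.\<close>

lemma seq_space_lp_infinity: "seq_space (lp \<infinity>) (lp_norm \<infinity>)"
proof -
  let ?V = "lp \<infinity>" and ?N = "lp_norm \<infinity>"
  have V: "x \<in> ?V \<longleftrightarrow> bdd_above (range (\<lambda>i. cmod (x i)))" for x by (simp add: lp_def)
  have N: "?N x = (SUP i. cmod (x i))" for x by (simp add: lp_norm_def)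
  have co: "cmod (x i) \<le> ?N x" if "x \<in> ?V" for x i
    unfolding N using that by (intro cSUP_upper) (auto simp: V)
  have VI: "x \<in> ?V" if "\<And>i. cmod (x i) \<le> B" for x B
    unfolding V using that by (intro bdd_aboveI[of _ B]) auto
  have NI: "?N x \<le> B" if "\<And>i. cmod (x i) \<le> B" for x B
    unfolding N using that by (intro cSUP_least) auto
  have N0: "?N x \<ge> 0" if "x \<in> ?V" for x using co[OF that, of 0] norm_ge_zero order_trans by blast
  have scl: "(\<lambda>i. c * x i) \<in> ?V" "?N (\<lambda>i. c * x i) \<le> cmod c * ?N x" if "x \<in> ?V" for c x
  proof -
    have b: "cmod (c * x i) \<le> cmod c * ?N x" for i using co[OF that] by (simp add: norm_mult mult_left_mono)
    show "(\<lambda>i. c * x i) \<in> ?V" by (rule VI[OF b])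
    show "?N (\<lambda>i. c * x i) \<le> cmod c * ?N x" by (rule NI[OF b])
  qed
  show ?thesis
  proof
    show "(\<lambda>i. 0) \<in> ?V" by (rule VI[of _ 0]) simp
    fix x y c assume x: "x \<in> ?V"
    show "(\<lambda>i. c * x i) \<in> ?V" by (rule scl(1)[OF x])
    show "?N (\<lambda>i. c * x i) = cmod c * ?N x"
    proof (cases "c = 0")
      case True
      have "?N (\<lambda>i. 0) = 0" using NI[of "\<lambda>i. 0" 0] N0[OF VI[of "\<lambda>i. 0" 0]] by simp
      then show ?thesis using True by simp
    next
      case False
      have "?N (\<lambda>i. (1 / c) * (c * x i)) \<le> cmod (1 / c) * ?N (\<lambda>i. c * x i)"
        by (rule scl(2)[OF scl(1)[OF x]])
      moreover have "(\<lambda>i. (1 / c) * (c * x i)) = x" using False by simp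
      ultimately have "cmod c * ?N x \<le> ?N (\<lambda>i. c * x i)" using False by (simp add: norm_divide field_simps)
      then show ?thesis using scl(2)[OF x, of c] by simp
    qed
    {
      assume y: "y \<in> ?V"
      have b: "cmod (x i + y i) \<le> ?N x + ?N y" for i
        using norm_triangle_ineq[of "x i" "y i"] co[OF x, of i] co[OF y, of i] by linarith
      show "(\<lambda>i. x i + y i) \<in> ?V" by (rule VI[OF b])
      have "?N (\<lambda>i. x i + y i) \<le> ?N x + ?N y" by (rule NI[OF b])
      also have "\<dots> \<le> 4 * (?N x + ?N y)" using N0[OF x] N0[OF y] by simp
      finally show "?N (\<lambda>i. x i + y i) \<le> 4 * (?N x + ?N y)" .
    }
    show "cmod (x i) \<le> ?N x" for i by (rule co[OF x])
    {
      assume "\<And>i. cmod (y i) \<le> cmod (x i)"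
      then have b: "cmod (y i) \<le> ?N x" for i using co[OF x] order_trans by blast
      show "y \<in> ?V" by (rule VI[OF b])
      show "?N y \<le> ?N x" by (rule NI[OF b])
    }
    show "(\<lambda>i. x (\<pi> i)) \<in> ?V" for \<pi> by (rule VI[OF co[OF x]])
    show "?N (\<lambda>i. x (\<pi> i)) \<le> ?N x" for \<pi> by (rule NI[OF co[OF x]])
    fix L :: "nat set" and u :: "nat \<Rightarrow> complex"
    assume L: "finite L" and u1: "\<And>i. i \<in> L \<Longrightarrow> cmod (u i) = 1" and u0: "\<And>i. i \<notin> L \<Longrightarrow> u i = 0"
    have u: "cmod (u i) \<le> 1" for i using u1 u0 by (cases "i \<in> L") auto
    have "?N u \<le> 1" by (rule NI[OF u])
    then have "?N u * (\<Sum>i\<in>L. cmod (x i)) \<le> 1 * (\<Sum>i\<in>L. cmod (x i))"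
      by (rule mult_right_mono) (simp add: sum_nonneg)
    also have "\<dots> \<le> card L * ?N x" using sum_bounded_above[of L "\<lambda>i. cmod (x i)" "?N x"] co[OF x] by simp
    finally show "?N u * (\<Sum>i\<in>L. cmod (x i)) \<le> card L * ?N x" .
  next
    fix Y :: "(nat \<Rightarrow> complex) set" and \<delta> :: real
    assume Y: "finite Y" "Y \<subseteq> ?V" and d: "\<delta> > 0"
    \<comment> \<open>Cells of side \<open>\<delta> / 2\<close> in the real and the imaginary
      direction: two values in one cell differ by at most \<open>\<delta>\<close>.\<close>
    define c where "c y n = (\<lfloor>Re (y n) * (2 / \<delta>)\<rfloor>, \<lfloor>Im (y n) * (2 / \<delta>)\<rfloor>)" for y :: "nat \<Rightarrow> complex" and n
    define F where "F n = restrict (\<lambda>y. c y n) Y" for n :: nat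
    have "finite (range (c y))" if "y \<in> Y" for y
    proof -
      let ?B = "?N y * (2 / \<delta>)"
      have "range (c y) \<subseteq> {\<lfloor>- ?B\<rfloor>..\<lfloor>?B\<rfloor>} \<times> {\<lfloor>- ?B\<rfloor>..\<lfloor>?B\<rfloor>}"
      proof (rule image_subsetI)
        fix n
        have m: "\<lfloor>- ?B\<rfloor> \<le> \<lfloor>t * (2 / \<delta>)\<rfloor> \<and> \<lfloor>t * (2 / \<delta>)\<rfloor> \<le> \<lfloor>?B\<rfloor>" if "\<bar>t\<bar> \<le> ?N y" for t
        proof -
          have "- ?N y * (2 / \<delta>) \<le> t * (2 / \<delta>)" "t * (2 / \<delta>) \<le> ?N y * (2 / \<delta>)"
            using that d by (intro mult_right_mono; simp)+
          then show ?thesis by (intro conjI floor_mono) simp_all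
        qed
        have "\<bar>Re (y n)\<bar> \<le> ?N y" "\<bar>Im (y n)\<bar> \<le> ?N y"
          using abs_Re_le_cmod[of "y n"] abs_Im_le_cmod[of "y n"] co[of y n] that Y by auto
        from m[OF this(1)] m[OF this(2)]
        show "c y n \<in> {\<lfloor>- ?B\<rfloor>..\<lfloor>?B\<rfloor>} \<times> {\<lfloor>- ?B\<rfloor>..\<lfloor>?B\<rfloor>}" by (simp add: c_def)
      qed
      then show ?thesis by (rule finite_subset) simp
    qed
    then have "finite (PiE Y (\<lambda>y. range (c y)))" using Y(1) by (intro finite_PiE)
    moreover have "range F \<subseteq> PiE Y (\<lambda>y. range (c y))" by (auto simp: F_def)
    ultimately have fF: "finite (range F)" by (rule finite_subset[rotated])
    \<comment> \<open>Each class is represented by its least index, so a step function only takes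
      values prescribed at representatives and its supremum norm cannot exceed that of a dominating
      \<open>z\<close>.\<close>
    define rep where "rep n = (LEAST k. F k = F n)" for n
    have Fr: "F (rep n) = F n" for n unfolding rep_def by (rule LeastI[of _ n]) simp
    define J where "J = range rep"
    have "J = (\<lambda>v. LEAST k. F k = v) ` range F" by (auto simp: J_def rep_def image_image)
    then have J: "finite J" using fF by simp
    have rJ: "rep n \<in> J" for n by (simp add: J_def)
    have cut: "(\<Sum>r\<in>J. \<theta> r * ind_seq {i. rep i = r} i) = \<theta> (rep i)" for \<theta> i
    proof -
      have "(\<Sum>r\<in>J. \<theta> r * ind_seq {i. rep i = r} i) = (\<Sum>r\<in>J. if r = rep i then \<theta> r else 0)"
        by (intro sum.cong) (auto simp: ind_seq_def)
      then show ?thesis using J rJ by simp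
    qed
    show "\<exists>J Q. finite (J :: nat set) \<and> (\<forall>r\<in>J. ind_seq (Q r) \<in> ?V) \<and>
      (\<forall>z\<in>?V. \<forall>\<theta>. (\<forall>r\<in>J. cmod (\<theta> r) \<le> cmod (z r)) \<longrightarrow> ?N (\<lambda>i. \<Sum>r\<in>J. \<theta> r * ind_seq (Q r) i) \<le> ?N z) \<and>
      (\<forall>y\<in>Y. ?N (\<lambda>i. y i - (\<Sum>r\<in>J. y r * ind_seq (Q r) i)) \<le> \<delta>)"
    proof (rule exI[of _ J], rule exI[of _ "\<lambda>r. {i. rep i = r}"], intro conjI ballI allI impI)
      show "finite J" by (rule J)
      show "ind_seq {i. rep i = r} \<in> ?V" for r by (rule VI[of _ 1]) (simp add: ind_seq_def)
      show "?N (\<lambda>i. \<Sum>r\<in>J. \<theta> r * ind_seq {i. rep i = r} i) \<le> ?N z"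
        if "z \<in> ?V" "\<forall>r\<in>J. cmod (\<theta> r) \<le> cmod (z r)" for z \<theta>
        unfolding cut by (rule NI) (use that(2) rJ co[OF that(1)] order_trans in blast)
      fix y assume y: "y \<in> Y"
      show "?N (\<lambda>i. y i - (\<Sum>r\<in>J. y r * ind_seq {i. rep i = r} i)) \<le> \<delta>"
        unfolding cut
      proof (rule NI)
        fix i
        have fl: "\<bar>s - t\<bar> \<le> \<delta> / 2" if "\<lfloor>s * (2 / \<delta>)\<rfloor> = \<lfloor>t * (2 / \<delta>)\<rfloor>" for s t
        proof -
          have "\<bar>s * (2 / \<delta>) - t * (2 / \<delta>)\<bar> \<le> 1" using that by linarith
          moreover have "s * (2 / \<delta>) - t * (2 / \<delta>) = (s - t) * (2 / \<delta>)" by (simp only: left_diff_distrib)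
          ultimately have "\<bar>(s - t) * (2 / \<delta>)\<bar> \<le> 1" by (simp only:)
          moreover have "\<bar>2 / \<delta>\<bar> = 2 / \<delta>" using d by simp
          ultimately have "\<bar>s - t\<bar> * (2 / \<delta>) \<le> 1" by (simp only: abs_mult)
          then show ?thesis using d by (simp add: field_simps)
        qed
        have "c y (rep i) = c y i" using fun_cong[OF Fr[of i], of y] y by (simp add: F_def)
        then have "\<bar>Re (y i - y (rep i))\<bar> \<le> \<delta> / 2" "\<bar>Im (y i - y (rep i))\<bar> \<le> \<delta> / 2"
          using fl by (simp_all add: c_def)
        then show "cmod (y i - y (rep i)) \<le> \<delta>" using cmod_le[of "y i - y (rep i)"] by linarith
      qed
    qed
  qed
qed

lemma seq_space_lp: assumes "1 \<le> p" shows "seq_space (lp p) (lp_norm p)"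
proof (cases p)
  case (real r)
  then show ?thesis using seq_space_lp_finite[of r] assms by simp
next
  case PInf
  then show ?thesis by (simp add: seq_space_lp_infinity)
next
  case MInf
  then show ?thesis using assms by simp
qed

lemma lp_fin_subset: assumes "1 \<le> p" shows "lp_fin n \<subseteq> lp p"
proof
  interpret seq_space "lp p" "lp_norm p" by (rule seq_space_lp[OF assms])
  fix x assume x: "x \<in> lp_fin n"
  have u: "unit_seq k \<in> lp p" for k
  proof -
    obtain r where "p = ereal r \<or> p = \<infinity>" using assms by (cases p) auto
    then show ?thesis
    proof
      assume "p = ereal r"
      moreover have "summable (\<lambda>i. cmod (unit_seq k i) powr r)"
        by (rule summable_finite[of "{k}"]) (auto simp: unit_seq_def)
      ultimately show ?thesis by (simp add: lp_ereal)
    next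
      assume "p = \<infinity>"
      then show ?thesis by (auto simp: lp_def unit_seq_def intro!: bdd_aboveI[of _ 1])
    qed
  qed
  have "x = (\<lambda>i. \<Sum>k<n. x k * unit_seq k i)"
  proof
    fix i
    have "(\<Sum>k<n. x k * unit_seq k i) = (\<Sum>k<n. if k = i then x i else 0)"
      by (intro sum.cong) (auto simp: unit_seq_def)
    then show "x i = (\<Sum>k<n. x k * unit_seq k i)" using x by (simp add: lp_fin_def)
  qed
  also have "\<dots> \<in> lp p" by (rule sum_V) (rule u)
  finally show "x \<in> lp p" .
qed

lemma unit_seq_lp_fin: "unit_seq k \<in> lp_fin n \<longleftrightarrow> k < n"
  by (auto simp: lp_fin_def unit_seq_def not_le)

lemma unit_seq_lp: "1 \<le> p \<Longrightarrow> unit_seq k \<in> lp p"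
  using lp_fin_subset[of p "Suc k"] unit_seq_lp_fin[of k "Suc k"] by blast

text \<open>Norm estimates are inherited from \<open>lp\<close>; \<open>approx\<close> holds without
  error, as singletons reproduce a finitely supported sequence.\<close>

lemma seq_space_lp_fin: assumes "1 \<le> p" shows "seq_space (lp_fin n) (lp_norm p)"
proof -
  interpret l: seq_space "lp p" "lp_norm p" by (rule seq_space_lp[OF assms])
  have sub: "x \<in> lp p" if "x \<in> lp_fin n" for x using lp_fin_subset[OF assms] that by blast
  have cut: "(\<Sum>r\<in>{..<n}. \<theta> r * ind_seq {r} i) = (if i < n then \<theta> i else 0)" for \<theta> i
  proof -
    have "(\<Sum>r\<in>{..<n}. \<theta> r * ind_seq {r} i) = (\<Sum>r\<in>{..<n}. if r = i then \<theta> i else 0)"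
      by (intro sum.cong) (auto simp: ind_seq_def)
    then show ?thesis by simp
  qed
  show ?thesis
  proof
    show "(\<lambda>i. 0) \<in> lp_fin n" by (simp add: lp_fin_def)
    fix x y c assume x: "x \<in> lp_fin n"
    show "(\<lambda>i. c * x i) \<in> lp_fin n" using x by (simp add: lp_fin_def)
    show "lp_norm p (\<lambda>i. c * x i) = cmod c * lp_norm p x" by (rule l.N_scale[OF sub[OF x]])
    show "cmod (x i) \<le> lp_norm p x" for i by (rule l.coord[OF sub[OF x]])
    {
      assume y: "y \<in> lp_fin n"
      show "(\<lambda>i. x i + y i) \<in> lp_fin n" using x y by (simp add: lp_fin_def)
      show "lp_norm p (\<lambda>i. x i + y i) \<le> 4 * (lp_norm p x + lp_norm p y)" by (rule l.N_add[OF sub[OF x] sub[OF y]])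
    }
    {
      assume le: "\<And>i. cmod (y i) \<le> cmod (x i)"
      have "y i = 0" if "i \<ge> n" for i using le[of i] x that by (simp add: lp_fin_def)
      then show "y \<in> lp_fin n" by (simp add: lp_fin_def)
      show "lp_norm p y \<le> lp_norm p x" by (rule l.N_mono[OF sub[OF x] le])
    }
    {
      fix \<pi> assume pi: "inj \<pi>" "\<And>i. unit_seq (\<pi> i) \<in> lp_fin n \<Longrightarrow> unit_seq i \<in> lp_fin n"
      show "(\<lambda>i. x (\<pi> i)) \<in> lp_fin n"
      proof -
        have "x (\<pi> i) = 0" if "i \<ge> n" for i
        proof -
          have "\<not> \<pi> i < n" using pi(2)[of i] that unfolding unit_seq_lp_fin by linarith
          then show ?thesis using x by (simp add: lp_fin_def)
        qed
        then show ?thesis by (simp add: lp_fin_def)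
      qed
      show "lp_norm p (\<lambda>i. x (\<pi> i)) \<le> lp_norm p x"
        by (rule l.N_permute[OF pi(1) _ sub[OF x]]) (rule unit_seq_lp[OF assms])
    }
    fix L :: "nat set" and u :: "nat \<Rightarrow> complex"
    assume "finite L" "\<And>i. i \<in> L \<Longrightarrow> cmod (u i) = 1" "\<And>i. i \<notin> L \<Longrightarrow> u i = 0"
    then show "lp_norm p u * (\<Sum>i\<in>L. cmod (x i)) \<le> card L * lp_norm p x"
      by (intro l.hoelder unit_seq_lp assms sub x)
  next
    fix Y :: "(nat \<Rightarrow> complex) set" and \<delta> :: real
    assume Y: "finite Y" "Y \<subseteq> lp_fin n" and d: "\<delta> > 0"
    show "\<exists>J Q. finite (J :: nat set) \<and> (\<forall>r\<in>J. ind_seq (Q r) \<in> lp_fin n) \<and>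
      (\<forall>z\<in>lp_fin n. \<forall>\<theta>. (\<forall>r\<in>J. cmod (\<theta> r) \<le> cmod (z r)) \<longrightarrow> lp_norm p (\<lambda>i. \<Sum>r\<in>J. \<theta> r * ind_seq (Q r) i) \<le> lp_norm p z) \<and>
      (\<forall>y\<in>Y. lp_norm p (\<lambda>i. y i - (\<Sum>r\<in>J. y r * ind_seq (Q r) i)) \<le> \<delta>)"
    proof (rule exI[of _ "{..<n}"], rule exI[of _ "\<lambda>r. {r}"], intro conjI ballI allI impI)
      show "finite {..<n}" by simp
      show "ind_seq {r} \<in> lp_fin n" if "r \<in> {..<n}" for r using that by (auto simp: ind_seq_def lp_fin_def)
      show "lp_norm p (\<lambda>i. \<Sum>r\<in>{..<n}. \<theta> r * ind_seq {r} i) \<le> lp_norm p z"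
        if "z \<in> lp_fin n" "\<forall>r\<in>{..<n}. cmod (\<theta> r) \<le> cmod (z r)" for z \<theta>
        unfolding cut by (rule l.N_mono[OF sub[OF that(1)]]) (use that(2) in auto)
      fix y assume y: "y \<in> Y"
      have "y i = 0" if "i \<ge> n" for i using subsetD[OF Y(2) y] that by (simp add: lp_fin_def)
      then have "(\<lambda>i. y i - (\<Sum>r\<in>{..<n}. y r * ind_seq {r} i)) = (\<lambda>i. 0)"
        unfolding cut by (simp add: fun_eq_iff)
      then show "lp_norm p (\<lambda>i. y i - (\<Sum>r\<in>{..<n}. y r * ind_seq {r} i)) \<le> \<delta>"
        using d by (simp add: l.N_zero)
    qed
  qed
qed

section \<open>Non-amenability\<close>

lemma infsum_eq_suminf:
  fixes f :: "nat \<Rightarrow> 'a :: banach"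
  assumes "summable (\<lambda>n. norm (f n))" shows "infsum f UNIV = suminf f"
  using norm_summable_imp_has_sum[OF assms summable_sums[OF summable_norm_cancel[OF assms]]]
  by (rule infsumI)

text \<open>Fubini's theorem for series: the exchange takes place for unordered sums over pairs, and
  absolute summability of rows, columns and outer sums allows the passage back to
  \<open>suminf\<close>.\<close>

lemma suminf_swap:
  fixes g :: "nat \<Rightarrow> nat \<Rightarrow> complex"
  assumes g1: "\<And>k. summable (\<lambda>j. cmod (g k j))" and g2: "summable (\<lambda>k. suminf (\<lambda>j. cmod (g k j)))"
  shows "summable (\<lambda>k. cmod (g k j))" "summable (\<lambda>j. suminf (\<lambda>k. cmod (g k j)))"
    "suminf (\<lambda>j. suminf (\<lambda>k. cmod (g k j))) = suminf (\<lambda>k. suminf (\<lambda>j. cmod (g k j)))"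
    "suminf (\<lambda>j. suminf (\<lambda>k. g k j)) = suminf (\<lambda>k. suminf (\<lambda>j. g k j))"
proof -
  have row: "infsum (\<lambda>j. cmod (g k j)) UNIV = suminf (\<lambda>j. cmod (g k j))" for k
    using infsum_eq_suminf[of "\<lambda>j. cmod (g k j)"] g1 by simp
  have s0: "suminf (\<lambda>j. cmod (g k j)) \<ge> 0" for k using g1 by (intro suminf_nonneg) auto
  have "(\<lambda>z. norm ((\<lambda>(k, j). g k j) z)) summable_on (UNIV \<times> UNIV)"
    unfolding Infinite_Sum.abs_summable_on_Sigma_iff
  proof (intro conjI ballI)
    show "(\<lambda>y. norm (case (k, y) of (k, j) \<Rightarrow> g k j)) summable_on UNIV" for k
      using g1[of k] by (simp add: summable_on_UNIV_nonneg_real_iff)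
    show "(\<lambda>x. norm (infsum (\<lambda>y. norm (case (x, y) of (k, j) \<Rightarrow> g k j)) UNIV)) summable_on UNIV"
      using g2 s0 by (simp add: row summable_on_UNIV_nonneg_real_iff)
  qed
  then have A: "(\<lambda>(k, j). cmod (g k j)) summable_on (UNIV \<times> UNIV)" by (simp add: case_prod_unfold)
  then have B: "(\<lambda>(j, k). cmod (g k j)) summable_on (UNIV \<times> UNIV)"
    by (subst summable_on_swap) (simp add: case_prod_unfold)
  then have "(\<lambda>z. norm ((\<lambda>(j, k). g k j) z)) summable_on (UNIV \<times> UNIV)" by (simp add: case_prod_unfold)
  then have C: "(\<lambda>k. cmod (g k j)) summable_on UNIV"
    "(\<lambda>j. norm (infsum (\<lambda>k. cmod (g k j)) UNIV)) summable_on UNIV" for j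
    unfolding Infinite_Sum.abs_summable_on_Sigma_iff by simp_all
  show c1: "summable (\<lambda>k. cmod (g k j))" for j using C(1)[of j] by (simp add: summable_on_UNIV_nonneg_real_iff)
  have col: "infsum (\<lambda>k. cmod (g k j)) UNIV = suminf (\<lambda>k. cmod (g k j))" for j
    using infsum_eq_suminf[of "\<lambda>k. cmod (g k j)"] c1 by simp
  have t0: "suminf (\<lambda>k. cmod (g k j)) \<ge> 0" for j using c1 by (intro suminf_nonneg) auto
  show c2: "summable (\<lambda>j. suminf (\<lambda>k. cmod (g k j)))"
    using C(2) t0 by (simp add: col summable_on_UNIV_nonneg_real_iff)
  show "suminf (\<lambda>j. suminf (\<lambda>k. cmod (g k j))) = suminf (\<lambda>k. suminf (\<lambda>j. cmod (g k j)))"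
  proof -
    have "infsum (\<lambda>k. suminf (\<lambda>j. cmod (g k j))) UNIV = suminf (\<lambda>k. suminf (\<lambda>j. cmod (g k j)))"
      by (rule infsum_eq_suminf) (use g2 s0 in simp)
    moreover have "infsum (\<lambda>j. suminf (\<lambda>k. cmod (g k j))) UNIV = suminf (\<lambda>j. suminf (\<lambda>k. cmod (g k j)))"
      by (rule infsum_eq_suminf) (use c2 t0 in simp)
    ultimately show ?thesis using infsum_swap_banach[OF A] unfolding row col by simp
  qed
  have S: "(\<lambda>(k, j). g k j) summable_on (UNIV \<times> UNIV)"
    by (rule abs_summable_summable) (use A in \<open>simp add: case_prod_unfold\<close>)
  have r: "infsum (\<lambda>j. g k j) UNIV = suminf (\<lambda>j. g k j)" "infsum (\<lambda>k. g k j) UNIV = suminf (\<lambda>k. g k j)" for j k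
    by (rule infsum_eq_suminf[OF g1], rule infsum_eq_suminf[OF c1])
  have r1: "summable (\<lambda>k. cmod (suminf (\<lambda>j. g k j)))"
    by (rule summable_comparison_test[OF _ g2]) (use summable_norm[OF g1] in auto)
  have r2: "summable (\<lambda>j. cmod (suminf (\<lambda>k. g k j)))"
    by (rule summable_comparison_test[OF _ c2]) (use summable_norm[OF c1] in auto)
  show "suminf (\<lambda>j. suminf (\<lambda>k. g k j)) = suminf (\<lambda>k. suminf (\<lambda>j. g k j))"
    using infsum_swap_banach[OF S] unfolding r infsum_eq_suminf[OF r1] infsum_eq_suminf[OF r2] by simp
qed

section \<open>Algebras of operators on \<open>lp\<close>\<close>

definition generator :: "ereal \<Rightarrow> nat \<Rightarrow> seq_op" where
  "generator p j = seq_space.weighted_perm (lp p)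
     (torus_phase (Sigma {0..} torus) to_nat j) (torus_perm (Sigma {0..} torus) to_nat j)"

lemma inj_torus_perm_to_nat: "inj (torus_perm (Sigma {0..} torus) to_nat j)"
  by (rule inj_torus_perm) (auto intro: inj_on_subset[OF inj_to_nat])

text \<open>Serves the full algebra and the regular operators alike: the bilinear estimate holds for
  the operator norm and passes to any norm above it, as expressed by \<open>nrm\<close>.\<close>

lemma not_amenable_subalgebra:
  assumes p: "1 \<le> p" and X: "X \<subseteq> bounded_ops (lp p) (lp_norm p)"
    and zero: "\<zero>\<^bsub>B_lp p\<^esub> \<in> X"
    and add: "\<And>S T. S \<in> X \<Longrightarrow> T \<in> X \<Longrightarrow> S \<oplus>\<^bsub>B_lp p\<^esub> T \<in> X"
    and mult: "\<And>S T. S \<in> X \<Longrightarrow> T \<in> X \<Longrightarrow> S \<otimes>\<^bsub>B_lp p\<^esub> T \<in> X"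
    and smult: "\<And>c T. T \<in> X \<Longrightarrow> c \<odot>\<^bsub>B_lp p\<^esub> T \<in> X"
    and gen: "\<And>j. generator p j \<in> X"
    and nrm: "\<And>T. T \<in> X \<Longrightarrow> op_norm (lp p) (lp_norm p) T \<le> n T"
  shows "\<not> amenable ((B_lp p)\<lparr>carrier := X, anorm := n\<rparr>)"
proof -
  interpret l: seq_space "lp p" "lp_norm p" by (rule seq_space_lp[OF p])
  let ?C = "(B_lp p)\<lparr>carrier := X, anorm := n\<rparr>" and ?K = "Sigma {0..} torus"
  have XO: "T \<in> carrier (B_lp p)" if "T \<in> X" for T using that X by (auto simp: B_lp_def)
  interpret ab: abelian_monoid "B_lp p" using l.abelian_monoid_A by (simp add: B_lp_def)
  have ab': "abelian_monoid ?C"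
  proof (rule abelian_monoidI)
    fix S T U assume "S \<in> carrier ?C" "T \<in> carrier ?C" "U \<in> carrier ?C"
    then have "S \<in> X" "T \<in> X" "U \<in> X" by simp_all
    then show "S \<oplus>\<^bsub>?C\<^esub> T \<in> carrier ?C" "(S \<oplus>\<^bsub>?C\<^esub> T) \<oplus>\<^bsub>?C\<^esub> U = S \<oplus>\<^bsub>?C\<^esub> (T \<oplus>\<^bsub>?C\<^esub> U)"
      "S \<oplus>\<^bsub>?C\<^esub> T = T \<oplus>\<^bsub>?C\<^esub> S"
      using add ab.a_assoc[OF XO XO XO, of S T U] ab.a_comm[OF XO XO, of S T] by simp_all
  qed (simp_all add: zero XO)
  have inj: "inj_on to_nat ?K" by (auto intro: inj_on_subset[OF inj_to_nat])
  show ?thesis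
  proof (rule not_amenableI[OF ab', where x = "generator p"])
    fix m :: int and B :: "(seq_op \<times> seq_op) set" and \<delta> :: real
    assume m: "m \<ge> 1" and B: "finite B" "B \<subseteq> carrier ?C \<times> carrier ?C" and d: "\<delta> > 0"
    have mK: "(m, s) \<in> ?K" if "s \<in> torus m" for s using m that by auto
    show "\<exists>J \<alpha> \<beta> ev. block_system ?C (generator p) m B \<delta> J \<alpha> \<beta> ev"
    proof (rule l.block_system_exists[OF m B d, where h = "\<lambda>T. T" and e = "\<lambda>s. to_nat (m, s)"
          and c = "\<lambda>j. torus_phase ?K to_nat j" and \<pi> = "\<lambda>j. torus_perm ?K to_nat j"])
      show "inj_on (\<lambda>s. to_nat (m, s)) (torus m)"
        by (auto simp: inj_on_def)
      show "torus_perm ?K to_nat j (to_nat (m, s)) = to_nat (m, perm m j s)" if "s \<in> torus m" for j s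
        by (rule torus_perm_apply[OF inj mK[OF that]])
      show "torus_phase ?K to_nat j (to_nat (m, s)) = phase m j s" if "s \<in> torus m" for j s
        by (rule torus_phase_apply[OF inj mK[OF that]])
    qed (use X gen nrm in \<open>auto simp: B_lp_def unit_seq_lp[OF p] generator_def inj_torus_perm_to_nat\<close>)
  qed (simp_all add: mult smult gen)
qed

lemma generator_ops: assumes "1 \<le> p" shows "generator p j \<in> bounded_ops (lp p) (lp_norm p)"
proof -
  interpret l: seq_space "lp p" "lp_norm p" by (rule seq_space_lp[OF assms])
  show ?thesis unfolding generator_def
    by (rule l.weighted_perm_ops) (simp_all add: inj_torus_perm_to_nat unit_seq_lp assms)
qed

theorem not_amenable_B_lp: assumes p: "1 \<le> p" shows "\<not> amenable (B_lp p)"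
proof -
  interpret l: seq_space "lp p" "lp_norm p" by (rule seq_space_lp[OF p])
  let ?X = "bounded_ops (lp p) (lp_norm p)"
  have "\<not> amenable ((B_lp p)\<lparr>carrier := ?X, anorm := op_norm (lp p) (lp_norm p)\<rparr>)"
    by (rule not_amenable_subalgebra[OF p order_refl])
      (simp_all add: generator_ops p B_lp_def op_algebra_def l.zero_ops l.add_ops l.mult_ops l.smult_ops)
  also have "(B_lp p)\<lparr>carrier := ?X, anorm := op_norm (lp p) (lp_norm p)\<rparr> = B_lp p"
    by (simp add: B_lp_def op_algebra_def)
  finally show ?thesis .
qed

section \<open>Regular operators and their moduli\<close>

lemma matrix_of_unit_seq: "matrix_of T i j = T (unit_seq j) i"
  by (simp add: matrix_of_def unit_seq_def)

locale regular_algebra =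
  fixes p :: ereal
  assumes p: "1 \<le> p"

sublocale regular_algebra \<subseteq> seq_space "lp p" "lp_norm p"
  by (rule seq_space_lp[OF p])

context regular_algebra
begin

definition modulus :: "seq_op \<Rightarrow> seq_op" where
  "modulus T = matrix_op p (abs_matrix (matrix_of T))"

definition absv :: "(nat \<Rightarrow> complex) \<Rightarrow> nat \<Rightarrow> complex" where
  "absv x i = complex_of_real (cmod (x i))"

lemma absv: "x \<in> lp p \<Longrightarrow> absv x \<in> lp p" "x \<in> lp p \<Longrightarrow> lp_norm p (absv x) \<le> lp_norm p x"
  by (auto simp: absv_def intro: solid N_mono)

lemma unit_lp: "unit_seq k \<in> lp p"
  by (rule unit_seq_lp[OF p])

lemma regularD:
  assumes T: "T \<in> regular_ops p"
  shows "T \<in> ops" "modulus T \<in> ops"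
    and "x \<in> lp p \<Longrightarrow> summable (\<lambda>j. cmod (matrix_of T i j) * cmod (x j))"
    and "x \<in> lp p \<Longrightarrow> T x i = suminf (\<lambda>j. matrix_of T i j * x j)"
    and "x \<in> lp p \<Longrightarrow> modulus T (absv x) i = of_real (suminf (\<lambda>j. cmod (matrix_of T i j) * cmod (x j)))"
proof -
  show "T \<in> ops" using T by (simp add: regular_ops_def B_lp_def)
  show "modulus T \<in> ops" using T by (simp add: regular_ops_def bounded_matrix_def B_lp_def modulus_def)
  have s: "summable (\<lambda>j. cmod (matrix_of T i j) * cmod (x j))" if "x \<in> lp p" for x i
    using T that by (simp add: regular_ops_def bounded_matrix_def norm_mult)
  then show "x \<in> lp p \<Longrightarrow> summable (\<lambda>j. cmod (matrix_of T i j) * cmod (x j))" .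
  have Te: "T = matrix_op p (matrix_of T)" using T by (simp add: regular_ops_def)
  show "T x i = suminf (\<lambda>j. matrix_of T i j * x j)" if "x \<in> lp p"
  proof -
    have "T x i = matrix_op p (matrix_of T) x i" by (rule fun_cong[OF fun_cong[OF Te]])
    also have "\<dots> = suminf (\<lambda>j. matrix_of T i j * x j)" using that by (simp add: matrix_op_def)
    finally show ?thesis .
  qed
  show "modulus T (absv x) i = of_real (suminf (\<lambda>j. cmod (matrix_of T i j) * cmod (x j)))" if "x \<in> lp p"
    using absv(1)[OF that] suminf_of_real[OF s[OF that, of i], where 'a = complex]
    by (simp add: modulus_def matrix_op_def abs_matrix_def absv_def)
qed

text \<open>A domination criterion: it suffices to bound the absolute row sums at \<open>x\<close>
  coordinatewise by a vector \<open>y x\<close> of controlled norm, since solidity of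
  \<open>lp\<close> then makes the modulus a bounded operator. For sums and products,
  \<open>y\<close> is built from the moduli of the given operators.\<close>

lemma regularI:
  assumes T: "T \<in> ops"
    and s: "\<And>x i. x \<in> lp p \<Longrightarrow> summable (\<lambda>j. cmod (matrix_of T i j) * cmod (x j))"
    and e: "\<And>x i. x \<in> lp p \<Longrightarrow> T x i = suminf (\<lambda>j. matrix_of T i j * x j)"
    and y: "\<And>x. x \<in> lp p \<Longrightarrow> y x \<in> lp p" "\<And>x. x \<in> lp p \<Longrightarrow> lp_norm p (y x) \<le> K * lp_norm p x"
    and le: "\<And>x i. x \<in> lp p \<Longrightarrow> suminf (\<lambda>j. cmod (matrix_of T i j) * cmod (x j)) \<le> cmod (y x i)"
  shows "T \<in> regular_ops p"
proof -
  let ?m = "matrix_of T"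
  have Te: "T = matrix_op p ?m"
    by (rule ext) (auto simp: matrix_op_def restrict_def opsD(2)[OF T] e)
  have b: "cmod (suminf (\<lambda>j. abs_matrix ?m i j * x j)) \<le> cmod (y x i)" if x: "x \<in> lp p" for x i
  proof -
    have "cmod (suminf (\<lambda>j. abs_matrix ?m i j * x j)) \<le> suminf (\<lambda>j. cmod (abs_matrix ?m i j * x j))"
      by (rule summable_norm) (use s[OF x, of i] in \<open>simp add: norm_mult abs_matrix_def\<close>)
    also have "\<dots> \<le> cmod (y x i)" using le[OF x, of i] by (simp add: norm_mult abs_matrix_def)
    finally show ?thesis .
  qed
  have sm: "summable (\<lambda>j. abs_matrix ?m i j * x j)" if x: "x \<in> lp p" for x i
    by (rule summable_norm_cancel) (use s[OF x, of i] in \<open>simp add: norm_mult abs_matrix_def\<close>)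
  have "matrix_op p (abs_matrix ?m) \<in> ops"
  proof (rule opsI[where K = K])
    fix x assume x: "x \<in> lp p"
    show "matrix_op p (abs_matrix ?m) x \<in> lp p" using solid[OF y(1)[OF x] b[OF x]] x by (simp add: matrix_op_def)
    have "lp_norm p (matrix_op p (abs_matrix ?m) x) \<le> lp_norm p (y x)"
      using N_mono[OF y(1)[OF x] b[OF x]] x by (simp add: matrix_op_def)
    then show "lp_norm p (matrix_op p (abs_matrix ?m) x) \<le> K * lp_norm p x" using y(2)[OF x] by linarith
    show "matrix_op p (abs_matrix ?m) (\<lambda>i. c * x i) = (\<lambda>i. c * matrix_op p (abs_matrix ?m) x i)" for c
      using x scale[OF x, of c] suminf_mult[OF sm[OF x], of c]
      by (simp add: matrix_op_def mult.left_commute)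
    fix z assume z: "z \<in> lp p"
    show "matrix_op p (abs_matrix ?m) (\<lambda>i. x i + z i) = (\<lambda>i. matrix_op p (abs_matrix ?m) x i + matrix_op p (abs_matrix ?m) z i)"
      using x z add[OF x z] by (simp add: matrix_op_def distrib_left suminf_add[OF sm[OF x] sm[OF z]])
  qed (simp add: matrix_op_def)
  then show ?thesis
    using T Te s by (auto simp: regular_ops_def bounded_matrix_def B_lp_def norm_mult abs_matrix_def)
qed

text \<open>\<open>T x\<close> is dominated coordinatewise by the modulus applied to
  \<open>absv x\<close>, and the norm is monotone. This supplies \<open>nrm\<close> for the regular
  operators.\<close>

lemma op_norm_le_modulus:
  assumes T: "T \<in> regular_ops p" shows "op_norm (lp p) (lp_norm p) T \<le> op_norm (lp p) (lp_norm p) (modulus T)"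
proof (rule op_norm_le)
  show "0 \<le> op_norm (lp p) (lp_norm p) (modulus T)" by (rule op_norm_nonneg[OF regularD(2)[OF T]])
  fix x assume x: "x \<in> lp p"
  have "cmod (T x i) \<le> cmod (modulus T (absv x) i)" for i
  proof -
    have "cmod (T x i) \<le> suminf (\<lambda>j. cmod (matrix_of T i j * x j))"
      unfolding regularD(4)[OF T x]
      by (rule summable_norm) (use regularD(3)[OF T x, of i] in \<open>simp add: norm_mult\<close>)
    also have "\<dots> \<le> cmod (modulus T (absv x) i)" by (simp add: regularD(5)[OF T x] norm_mult)
    finally show ?thesis .
  qed
  then have "lp_norm p (T x) \<le> lp_norm p (modulus T (absv x))"
    by (rule N_mono[OF opsD(1)[OF regularD(2)[OF T] absv(1)[OF x]]])
  also have "\<dots> \<le> op_norm (lp p) (lp_norm p) (modulus T) * lp_norm p (absv x)"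
    by (rule op_norm_bound[OF regularD(2)[OF T] absv(1)[OF x]])
  also have "\<dots> \<le> op_norm (lp p) (lp_norm p) (modulus T) * lp_norm p x"
    by (intro mult_left_mono absv x op_norm_nonneg regularD(2)[OF T])
  finally show "lp_norm p (T x) \<le> op_norm (lp p) (lp_norm p) (modulus T) * lp_norm p x" .
qed

lemma modulus_bound:
  assumes T: "T \<in> regular_ops p" and x: "x \<in> lp p"
  shows "modulus T (absv x) \<in> lp p" "lp_norm p (modulus T (absv x)) \<le> op_norm (lp p) (lp_norm p) (modulus T) * lp_norm p x"
proof -
  show "modulus T (absv x) \<in> lp p" by (rule opsD(1)[OF regularD(2)[OF T] absv(1)[OF x]])
  have "lp_norm p (modulus T (absv x)) \<le> op_norm (lp p) (lp_norm p) (modulus T) * lp_norm p (absv x)"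
    by (rule op_norm_bound[OF regularD(2)[OF T] absv(1)[OF x]])
  also have "\<dots> \<le> op_norm (lp p) (lp_norm p) (modulus T) * lp_norm p x"
    by (intro mult_left_mono absv x op_norm_nonneg regularD(2)[OF T])
  finally show "lp_norm p (modulus T (absv x)) \<le> op_norm (lp p) (lp_norm p) (modulus T) * lp_norm p x" .
qed

lemma regular_zero: "(\<lambda>x\<in>lp p. \<lambda>i. 0) \<in> regular_ops p"
  by (rule regularI[where y = "\<lambda>x i. 0" and K = 0])
    (simp_all add: zero_ops matrix_of_unit_seq unit_lp zero N_zero)

lemma regular_smult:
  assumes T: "T \<in> regular_ops p" shows "(\<lambda>x\<in>lp p. \<lambda>i. c * T x i) \<in> regular_ops p"
proof -
  have m: "matrix_of (\<lambda>x\<in>lp p. \<lambda>i. c * T x i) i j = c * matrix_of T i j" for i j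
    by (simp add: matrix_of_unit_seq unit_lp)
  let ?n = "op_norm (lp p) (lp_norm p) (modulus T)"
  show ?thesis
  proof (rule regularI[where y = "\<lambda>x i. c * modulus T (absv x) i" and K = "cmod c * ?n"])
    show "(\<lambda>x\<in>lp p. \<lambda>i. c * T x i) \<in> ops" by (rule smult_ops(1)[OF regularD(1)[OF T]])
    fix x i assume x: "x \<in> lp p"
    have s: "summable (\<lambda>j. cmod (matrix_of T i j) * cmod (x j))" by (rule regularD(3)[OF T x])
    show "summable (\<lambda>j. cmod (matrix_of (\<lambda>x\<in>lp p. \<lambda>i. c * T x i) i j) * cmod (x j))"
      using summable_mult[OF s, of "cmod c"] by (simp add: m norm_mult mult.assoc)
    have "summable (\<lambda>j. matrix_of T i j * x j)"
      by (rule summable_norm_cancel) (use s in \<open>simp add: norm_mult\<close>)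
    then show "(\<lambda>x\<in>lp p. \<lambda>i. c * T x i) x i = suminf (\<lambda>j. matrix_of (\<lambda>x\<in>lp p. \<lambda>i. c * T x i) i j * x j)"
      using x by (simp add: m regularD(4)[OF T x] mult.assoc suminf_mult)
    show "(\<lambda>i. c * modulus T (absv x) i) \<in> lp p" by (rule scale[OF modulus_bound(1)[OF T x]])
    show "lp_norm p (\<lambda>i. c * modulus T (absv x) i) \<le> cmod c * ?n * lp_norm p x"
      using mult_left_mono[OF modulus_bound(2)[OF T x], of "cmod c"]
      by (simp add: N_scale[OF modulus_bound(1)[OF T x]] mult.assoc)
    show "suminf (\<lambda>j. cmod (matrix_of (\<lambda>x\<in>lp p. \<lambda>i. c * T x i) i j) * cmod (x j)) \<le> cmod (c * modulus T (absv x) i)"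
      using suminf_nonneg[OF s] by (simp add: m norm_mult mult.assoc suminf_mult[OF s] regularD(5)[OF T x])
  qed
qed

lemma regular_add:
  assumes S: "S \<in> regular_ops p" and T: "T \<in> regular_ops p"
  shows "(\<lambda>x\<in>lp p. \<lambda>i. S x i + T x i) \<in> regular_ops p"
proof -
  let ?U = "\<lambda>x\<in>lp p. \<lambda>i. S x i + T x i"
  have m: "matrix_of ?U i j = matrix_of S i j + matrix_of T i j" for i j
    by (simp add: matrix_of_unit_seq unit_lp)
  let ?n = "\<lambda>T. op_norm (lp p) (lp_norm p) (modulus T)"
  show ?thesis
  proof (rule regularI[where y = "\<lambda>x i. modulus S (absv x) i + modulus T (absv x) i" and K = "4 * (?n S + ?n T)"])
    show "?U \<in> ops" by (rule add_ops(1)[OF regularD(1)[OF S] regularD(1)[OF T]])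
    fix x i assume x: "x \<in> lp p"
    have s: "summable (\<lambda>j. cmod (matrix_of S i j) * cmod (x j))" "summable (\<lambda>j. cmod (matrix_of T i j) * cmod (x j))"
      by (rule regularD(3)[OF S x], rule regularD(3)[OF T x])
    have le: "cmod (matrix_of ?U i j) * cmod (x j) \<le> cmod (matrix_of S i j) * cmod (x j) + cmod (matrix_of T i j) * cmod (x j)" for j
      unfolding m distrib_right[symmetric] by (intro mult_right_mono norm_triangle_ineq) simp
    show sU: "summable (\<lambda>j. cmod (matrix_of ?U i j) * cmod (x j))"
      by (rule summable_comparison_test[OF _ summable_add[OF s]]) (use le in auto)
    have "summable (\<lambda>j. matrix_of S i j * x j)" "summable (\<lambda>j. matrix_of T i j * x j)"
      by (rule summable_norm_cancel; use s in \<open>simp add: norm_mult\<close>)+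
    then show "?U x i = suminf (\<lambda>j. matrix_of ?U i j * x j)"
      using x by (simp add: m regularD(4)[OF T x] regularD(4)[OF S x] distrib_right suminf_add)
    show "(\<lambda>i. modulus S (absv x) i + modulus T (absv x) i) \<in> lp p"
      by (rule add[OF modulus_bound(1)[OF S x] modulus_bound(1)[OF T x]])
    show "lp_norm p (\<lambda>i. modulus S (absv x) i + modulus T (absv x) i) \<le> 4 * (?n S + ?n T) * lp_norm p x"
      using N_add[OF modulus_bound(1)[OF S x] modulus_bound(1)[OF T x]] modulus_bound(2)[OF S x] modulus_bound(2)[OF T x]
      by (simp add: algebra_simps)
    have "suminf (\<lambda>j. cmod (matrix_of ?U i j) * cmod (x j))
       \<le> suminf (\<lambda>j. cmod (matrix_of S i j) * cmod (x j) + cmod (matrix_of T i j) * cmod (x j))"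
      by (rule suminf_le[OF le sU summable_add[OF s]])
    also have "\<dots> = suminf (\<lambda>j. cmod (matrix_of S i j) * cmod (x j)) + suminf (\<lambda>j. cmod (matrix_of T i j) * cmod (x j))"
      by (rule suminf_add[OF s, symmetric])
    also have "\<dots> \<le> cmod (modulus S (absv x) i + modulus T (absv x) i)"
      by (simp add: regularD(5)[OF S x] regularD(5)[OF T x] flip: of_real_add)
    finally show "suminf (\<lambda>j. cmod (matrix_of ?U i j) * cmod (x j)) \<le> cmod (modulus S (absv x) i + modulus T (absv x) i)" .
  qed
qed

text \<open>The modulus of a product is dominated by the product of the moduli. That composites have
  the matrix product as matrix is an interchange of sums of \<open>g\<close>; the modulus of
  \<open>S\<close> at \<open>w x\<close> provides the absolute summability.\<close>

lemma regular_mult: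
  assumes S: "S \<in> regular_ops p" and T: "T \<in> regular_ops p"
  shows "compose (lp p) S T \<in> regular_ops p"
proof -
  let ?U = "compose (lp p) S T"
  let ?n = "\<lambda>T. op_norm (lp p) (lp_norm p) (modulus T)"
  have TV: "T (unit_seq j) \<in> lp p" for j by (rule opsD(1)[OF regularD(1)[OF T] unit_lp])
  have m: "matrix_of ?U i j = suminf (\<lambda>k. matrix_of S i k * matrix_of T k j)" for i j
    using unit_lp by (simp add: matrix_of_unit_seq[of ?U] compose_eq regularD(4)[OF S TV] matrix_of_unit_seq[of T])
  define w where "w x = modulus T (absv x)" for x
  have w: "w x \<in> lp p" "cmod (w x k) = suminf (\<lambda>j. cmod (matrix_of T k j) * cmod (x j))" "absv (w x) = w x"
    if x: "x \<in> lp p" for x k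
  proof -
    show "w x \<in> lp p" unfolding w_def by (rule modulus_bound(1)[OF T x])
    have *: "w x k = of_real (suminf (\<lambda>j. cmod (matrix_of T k j) * cmod (x j)))" for k
      unfolding w_def by (rule regularD(5)[OF T x])
    have **: "suminf (\<lambda>j. cmod (matrix_of T k j) * cmod (x j)) \<ge> 0" for k
      by (rule suminf_nonneg[OF regularD(3)[OF T x]]) simp
    show "cmod (w x k) = suminf (\<lambda>j. cmod (matrix_of T k j) * cmod (x j))" using ** by (simp add: *)
    show "absv (w x) = w x" using ** by (simp add: absv_def fun_eq_iff *)
  qed
  show ?thesis
  proof (rule regularI[where y = "\<lambda>x. modulus S (absv (w x))" and K = "?n S * ?n T"])
    show "?U \<in> ops" by (rule mult_ops(1)[OF regularD(1)[OF S] regularD(1)[OF T]])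
    fix x i assume x: "x \<in> lp p"
    define g where "g k j = matrix_of S i k * (matrix_of T k j * x j)" for k j
    have cg: "cmod (g k j) = cmod (matrix_of S i k) * (cmod (matrix_of T k j) * cmod (x j))" for k j
      by (simp add: g_def norm_mult)
    have g1: "summable (\<lambda>j. cmod (g k j))" for k
      unfolding cg by (rule summable_mult[OF regularD(3)[OF T x]])
    have g1': "suminf (\<lambda>j. cmod (g k j)) = cmod (matrix_of S i k) * cmod (w x k)" for k
      unfolding cg w(2)[OF x] by (rule suminf_mult[OF regularD(3)[OF T x]])
    have g2: "summable (\<lambda>k. suminf (\<lambda>j. cmod (g k j)))"
      unfolding g1' by (rule regularD(3)[OF S w(1)[OF x]])
    note sw = suminf_swap[OF g1 g2]
    have col: "suminf (\<lambda>k. g k j) = matrix_of ?U i j * x j" for j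
    proof -
      have "summable (\<lambda>k. matrix_of S i k * matrix_of T k j)"
        by (rule summable_norm_cancel) (use regularD(3)[OF S TV, of i j] in \<open>simp add: norm_mult matrix_of_unit_seq[of T]\<close>)
      then show ?thesis unfolding m g_def by (simp add: suminf_mult2 mult.assoc)
    qed
    have le: "cmod (matrix_of ?U i j) * cmod (x j) \<le> suminf (\<lambda>k. cmod (g k j))" for j
      using summable_norm[OF sw(1)[of j]] unfolding col by (simp add: norm_mult)
    show sU: "summable (\<lambda>j. cmod (matrix_of ?U i j) * cmod (x j))"
      by (rule summable_comparison_test[OF _ sw(2)]) (use le in auto)
    have row: "suminf (\<lambda>j. g k j) = matrix_of S i k * T x k" for k
    proof -
      have "summable (\<lambda>j. matrix_of T k j * x j)"
        by (rule summable_norm_cancel) (use regularD(3)[OF T x, of k] in \<open>simp add: norm_mult\<close>)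
      then show ?thesis unfolding g_def by (simp add: suminf_mult regularD(4)[OF T x])
    qed
    have "?U x i = suminf (\<lambda>k. matrix_of S i k * T x k)"
      using x by (simp add: compose_eq regularD(4)[OF S opsD(1)[OF regularD(1)[OF T] x]])
    also have "\<dots> = suminf (\<lambda>j. matrix_of ?U i j * x j)" using sw(4) by (simp add: row col)
    finally show "?U x i = suminf (\<lambda>j. matrix_of ?U i j * x j)" .
    show "modulus S (absv (w x)) \<in> lp p" by (rule modulus_bound(1)[OF S w(1)[OF x]])
    have "lp_norm p (modulus S (absv (w x))) \<le> ?n S * lp_norm p (w x)"
      by (rule modulus_bound(2)[OF S w(1)[OF x]])
    also have "\<dots> \<le> ?n S * (?n T * lp_norm p x)" unfolding w_def
      by (intro mult_left_mono modulus_bound(2)[OF T x] op_norm_nonneg regularD(2)[OF S])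
    finally show "lp_norm p (modulus S (absv (w x))) \<le> ?n S * ?n T * lp_norm p x" by (simp add: mult.assoc)
    have "suminf (\<lambda>j. cmod (matrix_of ?U i j) * cmod (x j)) \<le> suminf (\<lambda>j. suminf (\<lambda>k. cmod (g k j)))"
      by (rule suminf_le[OF le sU sw(2)])
    also have "\<dots> = suminf (\<lambda>k. cmod (matrix_of S i k) * cmod (w x k))" by (simp add: sw(3) g1')
    also have "\<dots> \<le> cmod (modulus S (absv (w x)) i)" by (simp add: regularD(5)[OF S w(1)[OF x]])
    finally show "suminf (\<lambda>j. cmod (matrix_of ?U i j) * cmod (x j)) \<le> cmod (modulus S (absv (w x)) i)" .
  qed
qed

text \<open>Every row has a single nonzero entry, of modulus one, so the generator itself can serve
  as the dominating \<open>y\<close>.\<close>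

lemma regular_generator: "generator p j \<in> regular_ops p"
proof -
  let ?c = "torus_phase (Sigma {0..} torus) to_nat j" and ?q = "torus_perm (Sigma {0..} torus) to_nat j"
  have G: "generator p j x i = ?c i * x (?q i)" if "x \<in> lp p" for x i
    using that by (simp add: generator_def weighted_perm_def)
  have m: "matrix_of (generator p j) i k = (if k = ?q i then ?c i else 0)" for i k
    unfolding matrix_of_unit_seq G[OF unit_lp] by (simp add: unit_seq_def)
  have f: "suminf (\<lambda>k. cmod (matrix_of (generator p j) i k) * cmod (x k)) = cmod (x (?q i))" for x i
    by (subst suminf_finite[of "{?q i}"]) (auto simp: m)
  have gO: "generator p j \<in> ops" by (rule generator_ops[OF p])
  show ?thesis
  proof (rule regularI[where y = "\<lambda>x. generator p j x" and K = "op_norm (lp p) (lp_norm p) (generator p j)"])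
    show "generator p j \<in> ops" by (rule gO)
    fix x i assume x: "x \<in> lp p"
    show "summable (\<lambda>k. cmod (matrix_of (generator p j) i k) * cmod (x k))"
      by (rule summable_finite[of "{?q i}"]) (auto simp: m)
    show "generator p j x i = suminf (\<lambda>k. matrix_of (generator p j) i k * x k)"
      by (subst suminf_finite[of "{?q i}"]) (auto simp: m G[OF x])
    show "generator p j x \<in> lp p" by (rule opsD(1)[OF gO x])
    show "lp_norm p (generator p j x) \<le> op_norm (lp p) (lp_norm p) (generator p j) * lp_norm p x"
      by (rule op_norm_bound[OF gO x])
    show "suminf (\<lambda>k. cmod (matrix_of (generator p j) i k) * cmod (x k)) \<le> cmod (generator p j x i)"
      by (simp add: f G[OF x] norm_mult)
  qed
qed

end

theorem not_amenable_Br_lp: assumes p: "1 \<le> p" shows "\<not> amenable (Br_lp p)"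
proof -
  interpret regular_algebra p by standard (rule p)
  show ?thesis unfolding Br_lp_def
  proof (rule not_amenable_subalgebra[OF p])
    show "regular_ops p \<subseteq> ops" using regularD(1) by blast
    show "op_norm (lp p) (lp_norm p) T \<le> anorm (B_lp p) (matrix_op p (abs_matrix (matrix_of T)))"
      if "T \<in> regular_ops p" for T
      using op_norm_le_modulus[OF that] by (simp add: modulus_def B_lp_def op_algebra_def)
  qed (simp_all add: B_lp_def op_algebra_def regular_zero regular_add regular_mult regular_smult regular_generator)
qed

section \<open>The product of the finite-dimensional algebras\<close>

text \<open>The torus of size \<open>0\<close> is a point, so that factors of non-square dimension carry a trivial block.\<close>

definition block_size :: "nat \<Rightarrow> int" where
  "block_size n = (if \<exists>m. m \<ge> 0 \<and> card (torus m) = Suc n then SOME m. m \<ge> 0 \<and> card (torus m) = Suc n else 0)"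

lemma block_size: "block_size n \<ge> 0" "card (torus (block_size n)) \<le> Suc n"
proof -
  have "block_size n \<ge> 0 \<and> card (torus (block_size n)) \<le> Suc n"
  proof (cases "\<exists>m. m \<ge> 0 \<and> card (torus m) = Suc n")
    case True
    then show ?thesis using someI_ex[OF True] by (simp add: block_size_def)
  next
    case False
    then have "block_size n = 0" unfolding block_size_def by (simp only: if_False)
    then show ?thesis by (simp add: card_torus)
  qed
  then show "block_size n \<ge> 0" "card (torus (block_size n)) \<le> Suc n" by auto
qed

text \<open>The number of points determines \<open>m\<close>, so the choice in
  \<open>block_size\<close> recovers it. Every size thus occurs, in the factor of dimension
  \<open>card (torus m)\<close>.\<close>

lemma block_size_card:
  assumes m: "m \<ge> 0" shows "block_size (card (torus m) - 1) = m"
proof -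
  have inj: "m' = m" if "m' \<ge> 0" "card (torus m') = card (torus m)" for m'
  proof -
    have "(nat (2 * m' + 1))\<^sup>2 = (nat (2 * m + 1))\<^sup>2" using that m by (simp add: card_torus)
    then have "nat (2 * m' + 1) = nat (2 * m + 1)" by simp
    then show ?thesis using that m by simp
  qed
  have c: "Suc (card (torus m) - 1) = card (torus m)" using m by (simp add: card_torus)
  have ex: "\<exists>m'. m' \<ge> 0 \<and> card (torus m') = card (torus m)" using m by blast
  show ?thesis unfolding block_size_def c using ex someI_ex[OF ex] inj by auto
qed

lemma ex_torus_enum: "\<exists>f :: int \<times> int \<Rightarrow> nat. inj_on f (torus m) \<and> f ` torus m = {..<card (torus m)}"
  using ex_bij_betw_finite_nat[OF finite_torus[of m]] by (auto simp: bij_betw_def lessThan_atLeast0)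

text \<open>The image is an initial segment, unlike that of \<open>to_nat\<close>; this keeps the
  torus within the coordinates of its factor.\<close>

definition torus_enum :: "int \<Rightarrow> int \<times> int \<Rightarrow> nat" where
  "torus_enum m = (SOME f. inj_on f (torus m) \<and> f ` torus m = {..<card (torus m)})"

lemma torus_enum: "inj_on (torus_enum m) (torus m)" "torus_enum m ` torus m = {..<card (torus m)}"
  using someI_ex[OF ex_torus_enum[of m]] by (auto simp: torus_enum_def)

text \<open>A union of one torus only, in the triple format expected by \<open>torus_perm\<close>
  and \<open>torus_phase\<close>.\<close>

definition block_index :: "nat \<Rightarrow> (int \<times> int \<times> int) set" where
  "block_index n = Sigma {block_size n} torus"

definition block_enum :: "int \<times> int \<times> int \<Rightarrow> nat" where
  "block_enum k = torus_enum (fst k) (snd k)"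

definition product_generator :: "nat \<Rightarrow> nat \<Rightarrow> seq_op" where
  "product_generator j n = seq_space.weighted_perm (lp_fin (Suc n))
     (torus_phase (block_index n) block_enum j) (torus_perm (block_index n) block_enum j)"

lemma inj_block_enum: "inj_on block_enum (block_index n)"
  using torus_enum(1)[of "block_size n"] by (auto simp: block_index_def block_enum_def inj_on_def)

lemma block_enum_less: assumes "k \<in> block_index n" shows "block_enum k < Suc n"
proof -
  have "torus_enum (block_size n) (snd k) \<in> {..<card (torus (block_size n))}"
    using assms unfolding torus_enum(2)[symmetric] by (auto simp: block_index_def)
  then show ?thesis using assms block_size(2)[of n] by (auto simp: block_index_def block_enum_def)
qed

lemma inj_block_perm: "inj (torus_perm (block_index n) block_enum j)"
  by (rule inj_torus_perm[OF inj_block_enum]) (auto simp: block_index_def block_size)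

lemma block_perm_less:
  assumes "torus_perm (block_index n) block_enum j i < Suc n" shows "i < Suc n"
  using assms block_enum_less[of _ n] by (cases "i \<in> block_enum ` block_index n") (auto simp: torus_perm_def)

lemma product_generator_ops:
  assumes p: "1 \<le> p"
  shows "product_generator j n \<in> bounded_ops (lp_fin (Suc n)) (lp_norm p)"
    "op_norm (lp_fin (Suc n)) (lp_norm p) (product_generator j n) \<le> 1"
proof -
  interpret l: seq_space "lp_fin (Suc n)" "lp_norm p" by (rule seq_space_lp_fin[OF p])
  show "product_generator j n \<in> bounded_ops (lp_fin (Suc n)) (lp_norm p)"
    "op_norm (lp_fin (Suc n)) (lp_norm p) (product_generator j n) \<le> 1"
    unfolding product_generator_def
    by (rule l.weighted_perm_ops; simp add: inj_block_perm unit_seq_lp_fin block_perm_less)+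
qed

text \<open>A generator is a sequence with one torus in each factor. For given \<open>m\<close> the
  projection onto the factor of matching dimension is a homomorphism that does not increase norms,
  and the block estimate is carried out there.\<close>

theorem not_amenable_prod_B_lp_fin: assumes p: "1 \<le> p" shows "\<not> amenable (prod_B_lp_fin p)"
proof -
  let ?A = "\<lambda>n. op_algebra (lp_fin (Suc n)) (lp_norm p)" and ?C = "prod_B_lp_fin p"
  let ?N = "\<lambda>n. op_norm (lp_fin (Suc n)) (lp_norm p)"
  let ?O = "\<lambda>n. bounded_ops (lp_fin (Suc n)) (lp_norm p)"
  have sp: "seq_space (lp_fin (Suc n)) (lp_norm p)" for n by (rule seq_space_lp_fin[OF p])
  have car: "x \<in> carrier ?C \<longleftrightarrow> (\<forall>n. x n \<in> ?O n) \<and> bdd_above (range (\<lambda>n. ?N n (x n)))" for x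
    by (simp add: prod_B_lp_fin_def bounded_product_def B_lp_fin_def op_algebra_def)
  have ops: "(x \<oplus>\<^bsub>?C\<^esub> y) n = x n \<oplus>\<^bsub>?A n\<^esub> y n" "(x \<otimes>\<^bsub>?C\<^esub> y) n = x n \<otimes>\<^bsub>?A n\<^esub> y n"
    "(c \<odot>\<^bsub>?C\<^esub> x) n = c \<odot>\<^bsub>?A n\<^esub> x n" "\<zero>\<^bsub>?C\<^esub> n = \<zero>\<^bsub>?A n\<^esub>" "\<one>\<^bsub>?C\<^esub> n = \<one>\<^bsub>?A n\<^esub>" for x y c n
    by (simp_all add: prod_B_lp_fin_def bounded_product_def B_lp_fin_def)
  \<comment> \<open>The bound is taken nonnegative for the sake of the product estimate in
    \<open>multC\<close>.\<close>
  have bd: "\<exists>K\<ge>0. \<forall>n. ?N n (x n) \<le> K" if x: "x \<in> carrier ?C" for x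
  proof -
    obtain K where K: "\<And>n. ?N n (x n) \<le> K" using x unfolding car bdd_above_def by auto
    have "0 \<le> ?N 0 (x 0)" using seq_space.op_norm_nonneg[OF sp] x unfolding car by blast
    with K[of 0] have "0 \<le> K" by linarith
    with K show ?thesis by blast
  qed
  have carI: "x \<in> carrier ?C" if "\<And>n. x n \<in> ?O n" "\<And>n. ?N n (x n) \<le> K" for x K
    unfolding car using that by (auto intro!: bdd_aboveI[of _ K])
  have addC: "x \<oplus>\<^bsub>?C\<^esub> y \<in> carrier ?C" if x: "x \<in> carrier ?C" and y: "y \<in> carrier ?C" for x y
  proof -
    obtain K L where K: "\<forall>n. ?N n (x n) \<le> K" and L: "\<forall>n. ?N n (y n) \<le> L" using bd[OF x] bd[OF y] by blast
    show ?thesis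
    proof (rule carI[where K = "4 * (K + L)"])
      fix n
      have xy: "x n \<in> ?O n" "y n \<in> ?O n" using x y by (simp_all add: car)
      show "(x \<oplus>\<^bsub>?C\<^esub> y) n \<in> ?O n"
        using seq_space.add_ops(1)[OF sp xy] by (simp add: ops op_algebra_def)
      have "?N n ((x \<oplus>\<^bsub>?C\<^esub> y) n) \<le> 4 * (?N n (x n) + ?N n (y n))"
        using seq_space.add_ops(2)[OF sp xy] by (simp add: ops op_algebra_def)
      also have "\<dots> \<le> 4 * (K + L)" using K L by (simp add: add_mono)
      finally show "?N n ((x \<oplus>\<^bsub>?C\<^esub> y) n) \<le> 4 * (K + L)" .
    qed
  qed
  have multC: "x \<otimes>\<^bsub>?C\<^esub> y \<in> carrier ?C" if x: "x \<in> carrier ?C" and y: "y \<in> carrier ?C" for x y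
  proof -
    obtain K L where K: "K \<ge> 0" "\<forall>n. ?N n (x n) \<le> K" and L: "\<forall>n. ?N n (y n) \<le> L" using bd[OF x] bd[OF y] by blast
    show ?thesis
    proof (rule carI[where K = "K * L"])
      fix n
      have xy: "x n \<in> ?O n" "y n \<in> ?O n" using x y by (simp_all add: car)
      show "(x \<otimes>\<^bsub>?C\<^esub> y) n \<in> ?O n"
        using seq_space.mult_ops(1)[OF sp xy] by (simp add: ops op_algebra_def)
      have "?N n ((x \<otimes>\<^bsub>?C\<^esub> y) n) \<le> ?N n (x n) * ?N n (y n)"
        using seq_space.mult_ops(2)[OF sp xy] by (simp add: ops op_algebra_def)
      also have "\<dots> \<le> K * L" using K L seq_space.op_norm_nonneg[OF sp xy(2)] by (intro mult_mono) auto
      finally show "?N n ((x \<otimes>\<^bsub>?C\<^esub> y) n) \<le> K * L" .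
    qed
  qed
  have smultC: "c \<odot>\<^bsub>?C\<^esub> x \<in> carrier ?C" if x: "x \<in> carrier ?C" for c x
  proof -
    obtain K where K: "\<forall>n. ?N n (x n) \<le> K" using bd[OF x] by blast
    show ?thesis
    proof (rule carI[where K = "cmod c * K"])
      fix n
      have xn: "x n \<in> ?O n" using x by (simp add: car)
      show "(c \<odot>\<^bsub>?C\<^esub> x) n \<in> ?O n"
        using seq_space.smult_ops(1)[OF sp xn] by (simp add: ops op_algebra_def)
      have "?N n ((c \<odot>\<^bsub>?C\<^esub> x) n) \<le> cmod c * ?N n (x n)"
        using seq_space.smult_ops(2)[OF sp xn] by (simp add: ops op_algebra_def)
      also have "\<dots> \<le> cmod c * K" using K by (simp add: mult_left_mono)
      finally show "?N n ((c \<odot>\<^bsub>?C\<^esub> x) n) \<le> cmod c * K" .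
    qed
  qed
  have zeroC: "\<zero>\<^bsub>?C\<^esub> \<in> carrier ?C"
    by (rule carI[where K = 0]) (use seq_space.zero_ops[OF sp] in \<open>simp_all add: ops op_algebra_def\<close>)
  have abA: "abelian_monoid (?A n)" for n by (rule seq_space.abelian_monoid_A[OF sp])
  have inA: "x n \<in> carrier (?A n)" if "x \<in> carrier ?C" for x n using that by (simp add: car op_algebra_def)
  have ab: "abelian_monoid ?C"
  proof (rule abelian_monoidI)
    fix x y z assume x: "x \<in> carrier ?C" and y: "y \<in> carrier ?C" and z: "z \<in> carrier ?C"
    show "x \<oplus>\<^bsub>?C\<^esub> y \<in> carrier ?C" by (rule addC[OF x y])
    show "(x \<oplus>\<^bsub>?C\<^esub> y) \<oplus>\<^bsub>?C\<^esub> z = x \<oplus>\<^bsub>?C\<^esub> (y \<oplus>\<^bsub>?C\<^esub> z)"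
      by (rule ext) (simp only: ops abelian_monoid.a_assoc[OF abA inA[OF x] inA[OF y] inA[OF z]])
    show "x \<oplus>\<^bsub>?C\<^esub> y = y \<oplus>\<^bsub>?C\<^esub> x"
      by (rule ext) (simp only: ops abelian_monoid.a_comm[OF abA inA[OF x] inA[OF y]])
  next
    show "\<zero>\<^bsub>?C\<^esub> \<in> carrier ?C" by (rule zeroC)
    fix x assume x: "x \<in> carrier ?C"
    show "\<zero>\<^bsub>?C\<^esub> \<oplus>\<^bsub>?C\<^esub> x = x"
      by (rule ext) (simp only: ops abelian_monoid.l_zero[OF abA inA[OF x]])
  qed
  have genC: "product_generator j \<in> carrier ?C" for j
    by (rule carI[where K = 1]) (simp_all add: product_generator_ops p)
  show ?thesis
  proof (rule not_amenableI[OF ab multC smultC, where x = product_generator])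
    fix m :: int and B :: "((nat \<Rightarrow> seq_op) \<times> (nat \<Rightarrow> seq_op)) set" and \<delta> :: real
    assume m: "m \<ge> 1" and B: "finite B" "B \<subseteq> carrier ?C \<times> carrier ?C" and d: "\<delta> > 0"
    \<comment> \<open>Factor \<open>n\<close> has dimension \<open>Suc n\<close>, hence the shift by
      one.\<close>
    define n where "n = card (torus m) - 1"
    interpret l: seq_space "lp_fin (Suc n)" "lp_norm p" by (rule sp)
    have bs: "block_size n = m" unfolding n_def using m by (intro block_size_card) simp
    have mK: "(m, s) \<in> block_index n" if "s \<in> torus m" for s using that by (simp add: block_index_def bs)
    have be: "block_enum (m, s) = torus_enum m s" for s by (simp add: block_enum_def)
    show "\<exists>J \<alpha> \<beta> ev. block_system ?C product_generator m B \<delta> J \<alpha> \<beta> ev"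
    proof (rule l.block_system_exists[OF m B d, where h = "\<lambda>T. T n" and e = "\<lambda>s. block_enum (m, s)"
          and c = "\<lambda>j. torus_phase (block_index n) block_enum j" and \<pi> = "\<lambda>j. torus_perm (block_index n) block_enum j"])
      show "inj_on (\<lambda>s. block_enum (m, s)) (torus m)" unfolding be by (rule torus_enum(1))
      show "unit_seq (block_enum (m, s)) \<in> lp_fin (Suc n)" if "s \<in> torus m" for s
        unfolding unit_seq_lp_fin by (rule block_enum_less[OF mK[OF that]])
      show "torus_perm (block_index n) block_enum j (block_enum (m, s)) = block_enum (m, perm m j s)" if "s \<in> torus m" for j s
        by (rule torus_perm_apply[OF inj_block_enum mK[OF that]])
      show "torus_phase (block_index n) block_enum j (block_enum (m, s)) = phase m j s" if "s \<in> torus m" for j s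
        by (rule torus_phase_apply[OF inj_block_enum mK[OF that]])
      show "?N n (a n) \<le> anorm ?C a" if "a \<in> carrier ?C" for a
      proof -
        have "?N n (a n) \<le> (SUP n. ?N n (a n))" using that unfolding car by (intro cSUP_upper) auto
        then show ?thesis by (simp add: prod_B_lp_fin_def bounded_product_def B_lp_fin_def op_algebra_def)
      qed
      show "product_generator j n = l.weighted_perm (torus_phase (block_index n) block_enum j) (torus_perm (block_index n) block_enum j)" for j
        by (simp add: product_generator_def)
      show "product_generator j \<in> carrier ?C" for j by (rule genC)
    qed (simp_all add: car ops inj_block_perm)
  qed (simp_all add: genC)
qed

theorem theorem1p1:
  shows "(\<forall>p \<in> {1, 2, \<infinity>}. \<not> amenable (B_lp p)) \<and>
         (\<forall>p::ereal. 1 \<le> p \<and> p \<le> \<infinity> \<longrightarrow> \<not> amenable (prod_B_lp_fin p)) \<and>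
         (\<forall>p::ereal. 1 \<le> p \<and> p \<le> \<infinity> \<longrightarrow> \<not> amenable (Br_lp p))"
  by (auto simp: not_amenable_B_lp not_amenable_prod_B_lp_fin not_amenable_Br_lp)

end
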